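(* In the independent action model of the sequential contract problem, for every constant number of outcomes $m$, an optimal (general) contract, i.e. a contract $t:[m]\to\mathbb{R}_{\ge0}$ maximizing $u_P(t)$ over all contracts, can be computed in polynomial time.
   Context: Sequential contract problem. An instance consists of a set $A$ of $n$ actions with costs $c_i\ge 0$ ($i\in A$), a set $[m]=\{1,\dots,m\}$ of outcomes with principal rewards $0=r(1)\le r(2)\le\dots\le r(m)$, and random variables $X_i$ with values in $[m]$ ($i\in A$), where $X_i$ is the outcome of action $i$. In the independent action model the $X_i$ are independent and $p_{ij}=\Pr[X_i=j]$; the input is the costs, the rewards and the probabilities $p_{ij}$. A contract is a function $t:[m]\to\mathbb{R}_{\ge 0}$. Given $t$, the agent acts sequentially: at each point he either takes a not-yet-taken action $i$, pays $c_i$ and observes the realization of $X_i$, or halts. On halting he selects one revealed outcome as the final outcome; outcome $1$ (the zero outcome) is always considered revealed. A (deterministic) strategy $\pi$ specifies all these decisions as a function of the history; there are finitely many strategies. $S(\pi)$ is the random set of actions taken, $\omega(\pi)$ the random final outcome. Utilities: $u_A(t,\pi)=\mathbb{E}[t(\omega(\pi))-\sum_{i\in S(\pi)}c_i]$ and $u_P(t,\pi)=\mathbb{E}[r(\omega(\pi))-t(\omega(\pi))]$. The best response $\pi^\star(t)$ is a strategy maximizing $u_A(t,\cdot)$, with ties broken in favour of larger $u_P(t,\cdot)$ and remaining ties broken consistently by a fixed total order on strategies. $u_P(t)=u_P(t,\pi^\star(t))$. *)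

theory Defs
  imports
    "HOL-Probability.Probability"
    "HOL-Computational_Algebra.Polynomial"
    "HOL-Library.Log_Nat"
begin

section \<open>The sequential contract problem, independent action model\<close>

text \<open>
  Actions are \<open>0, \<dots>, n - 1\<close> and outcomes are \<open>0, \<dots>, m - 1\<close>: outcome \<open>j\<close> here is outcome
  \<open>j + 1\<close> of the usual notation, so the zero outcome is \<open>0\<close>.  Instances are rational, because
  they are inputs of an algorithm; contracts are real.
\<close>

record inst =
  costs :: "rat list"
  rewards :: "rat list"
  probs :: "rat list list"  \<comment> \<open>\<open>probs I ! i ! j\<close> is the probability that action \<open>i\<close> has outcome \<open>j\<close>\<close>

definition n_act :: "inst \<Rightarrow> nat" where
  "n_act I = length (costs I)"

definition n_out :: "inst \<Rightarrow> nat" where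
  "n_out I = length (rewards I)"

definition valid_inst :: "inst \<Rightarrow> bool" where
  "valid_inst I \<longleftrightarrow>
     (\<forall>c \<in> set (costs I). 0 \<le> c) \<and>
     0 < n_out I \<and> rewards I ! 0 = 0 \<and> sorted (rewards I) \<and>
     length (probs I) = n_act I \<and>
     (\<forall>row \<in> set (probs I). length row = n_out I \<and> (\<forall>q \<in> set row. 0 \<le> q) \<and> sum_list row = 1)"

definition cost :: "inst \<Rightarrow> nat \<Rightarrow> real" where
  "cost I i = of_rat (costs I ! i)"

definition reward :: "inst \<Rightarrow> nat \<Rightarrow> real" where
  "reward I j = of_rat (rewards I ! j)"

definition outcome_pmf :: "inst \<Rightarrow> nat \<Rightarrow> nat pmf" where
  "outcome_pmf I i = embed_pmf (\<lambda>j. if j < n_out I then of_rat (probs I ! i ! j) else 0)"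

definition outcomes_pmf :: "inst \<Rightarrow> (nat \<Rightarrow> nat) pmf" where
  "outcomes_pmf I = Pi_pmf {..<n_act I} 0 (outcome_pmf I)"

subsection \<open>Strategies\<close>

text \<open>A history lists the actions taken so far, in order, each with its observed outcome.\<close>

type_synonym history = "(nat \<times> nat) list"

datatype decision = Take nat | Halt nat  \<comment> \<open>\<open>Halt j\<close>: halt and select \<open>j\<close> as the final outcome\<close>

type_synonym strategy = "history \<Rightarrow> decision"

definition histories :: "inst \<Rightarrow> history set" where
  "histories I = {h. distinct (map fst h) \<and> set h \<subseteq> {..<n_act I} \<times> {..<n_out I}}"

definition legal :: "inst \<Rightarrow> history \<Rightarrow> decision set" where
  "legal I h = Take ` ({..<n_act I} - fst ` set h) \<union> Halt ` insert 0 (snd ` set h)"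

definition strategies :: "inst \<Rightarrow> strategy set" where
  "strategies I = Pi\<^sub>E (histories I) (legal I)"

definition advance :: "strategy \<Rightarrow> (nat \<Rightarrow> nat) \<Rightarrow> history \<Rightarrow> history" where
  "advance \<pi> x h = (case \<pi> h of Take i \<Rightarrow> h @ [(i, x i)] | Halt j \<Rightarrow> h)"

text \<open>
  The argument \<open>x\<close> is a joint realization of the outcomes of all actions.  No action is taken
  twice, so \<open>n\<close> rounds always reach the point where the strategy halts.
\<close>

definition final_history :: "inst \<Rightarrow> strategy \<Rightarrow> (nat \<Rightarrow> nat) \<Rightarrow> history" where
  "final_history I \<pi> x = (advance \<pi> x ^^ n_act I) []"

definition taken :: "inst \<Rightarrow> strategy \<Rightarrow> (nat \<Rightarrow> nat) \<Rightarrow> nat set" where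
  "taken I \<pi> x = fst ` set (final_history I \<pi> x)"

definition final_outcome :: "inst \<Rightarrow> strategy \<Rightarrow> (nat \<Rightarrow> nat) \<Rightarrow> nat" where
  "final_outcome I \<pi> x = (case \<pi> (final_history I \<pi> x) of Take i \<Rightarrow> undefined | Halt j \<Rightarrow> j)"

subsection \<open>Contracts, utilities and best responses\<close>

type_synonym contract = "nat \<Rightarrow> real"  \<comment> \<open>only the values on \<open>{..<n_out I}\<close> matter\<close>

definition is_contract :: "inst \<Rightarrow> contract \<Rightarrow> bool" where
  "is_contract I t \<longleftrightarrow> (\<forall>j < n_out I. 0 \<le> t j)"

definition agent_utility :: "inst \<Rightarrow> contract \<Rightarrow> strategy \<Rightarrow> real" where
  "agent_utility I t \<pi> =
     measure_pmf.expectation (outcomes_pmf I)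
       (\<lambda>x. t (final_outcome I \<pi> x) - (\<Sum>i \<in> taken I \<pi> x. cost I i))"

definition principal_utility :: "inst \<Rightarrow> contract \<Rightarrow> strategy \<Rightarrow> real" where
  "principal_utility I t \<pi> =
     measure_pmf.expectation (outcomes_pmf I)
       (\<lambda>x. reward I (final_outcome I \<pi> x) - t (final_outcome I \<pi> x))"

definition agent_optimal :: "inst \<Rightarrow> contract \<Rightarrow> strategy set" where
  "agent_optimal I t =
     {\<pi> \<in> strategies I. \<forall>\<pi>' \<in> strategies I. agent_utility I t \<pi>' \<le> agent_utility I t \<pi>}"

definition favourable :: "inst \<Rightarrow> contract \<Rightarrow> strategy set" where
  "favourable I t =
     {\<pi> \<in> agent_optimal I t.
        \<forall>\<pi>' \<in> agent_optimal I t. principal_utility I t \<pi>' \<le> principal_utility I t \<pi>}"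

text \<open>The relation \<open>ord\<close> is the fixed total order on strategies that breaks the remaining ties.\<close>

definition best_response :: "inst \<Rightarrow> strategy rel \<Rightarrow> contract \<Rightarrow> strategy" where
  "best_response I ord t =
     (THE \<pi>. \<pi> \<in> favourable I t \<and> (\<forall>\<pi>' \<in> favourable I t. (\<pi>, \<pi>') \<in> ord))"

definition principal_value :: "inst \<Rightarrow> strategy rel \<Rightarrow> contract \<Rightarrow> real" where
  "principal_value I ord t = principal_utility I t (best_response I ord t)"

definition optimal_contract :: "inst \<Rightarrow> strategy rel \<Rightarrow> contract \<Rightarrow> bool" where
  "optimal_contract I ord t \<longleftrightarrow>
     is_contract I t \<and> (\<forall>t'. is_contract I t' \<longrightarrow> principal_value I ord t' \<le> principal_value I ord t)"

subsection \<open>Well-definedness\<close>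

lemma pmf_outcome_pmf:
  assumes "valid_inst I" "i < n_act I"
  shows "pmf (outcome_pmf I i) j = (if j < n_out I then of_rat (probs I ! i ! j) else 0)"
proof -
  let ?f = "\<lambda>j. if j < n_out I then real_of_rat (probs I ! i ! j) else 0"
  have row: "probs I ! i \<in> set (probs I)"
    using assms by (auto simp: valid_inst_def)
  hence len: "length (probs I ! i) = n_out I" and nn: "\<forall>q \<in> set (probs I ! i). 0 \<le> q"
    and one: "sum_list (probs I ! i) = 1"
    using assms(1) by (auto simp: valid_inst_def)
  have nonneg: "0 \<le> ?f j" for j using nn len by auto
  have "(\<Sum>j<n_out I. real_of_rat (probs I ! i ! j)) = of_rat (\<Sum>j<n_out I. probs I ! i ! j)"
    by (simp add: of_rat_sum)
  also have "\<dots> = 1"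
    using one len by (simp add: sum_list_sum_nth atLeast0LessThan)
  finally have s: "(\<Sum>j<n_out I. ?f j) = 1" by simp
  have "(\<integral>\<^sup>+j. ennreal (?f j) \<partial>count_space UNIV)
      = (\<integral>\<^sup>+j. ennreal (?f j) \<partial>count_space {..<n_out I})"
    by (subst nn_integral_count_space_indicator)
       (auto intro!: nn_integral_cong simp: indicator_def)
  also have "\<dots> = (\<Sum>j<n_out I. ennreal (?f j))"
    by (simp add: nn_integral_count_space_finite)
  also have "\<dots> = ennreal (\<Sum>j<n_out I. ?f j)"
    by (rule sum_ennreal) (rule nonneg)
  also have "\<dots> = 1" using s by simp
  finally show ?thesis
    unfolding outcome_pmf_def using nonneg by (subst pmf_embed_pmf) auto
qed

lemma finite_histories: "finite (histories I)"
proof -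
  have "length h \<le> n_act I" if "h \<in> histories I" for h
  proof -
    have "length h = card (fst ` set h)"
      using that distinct_card[of "map fst h"] by (simp add: histories_def)
    also have "\<dots> \<le> card {..<n_act I}"
      using that by (intro card_mono) (auto simp: histories_def)
    finally show ?thesis by simp
  qed
  hence "histories I \<subseteq>
      {h. set h \<subseteq> {..<n_act I} \<times> {..<n_out I} \<and> length h \<le> n_act I}"
    by (auto simp: histories_def)
  thus ?thesis
    by (rule finite_subset) (intro finite_lists_length_le finite_cartesian_product finite_lessThan)
qed

lemma finite_strategies: "finite (strategies I)"
  unfolding strategies_def
  by (intro finite_PiE finite_histories) (auto simp: legal_def)

lemma strategies_nonempty: "strategies I \<noteq> {}"
  by (auto simp: strategies_def PiE_eq_empty_iff legal_def)

lemma strategy_halts: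
  assumes "\<pi> \<in> strategies I" "\<And>i. i < n_act I \<Longrightarrow> x i < n_out I"
  shows "final_history I \<pi> x \<in> histories I"
    and "\<exists>j \<in> insert 0 (snd ` set (final_history I \<pi> x)). \<pi> (final_history I \<pi> x) = Halt j"
proof -
  let ?h = "\<lambda>k. (advance \<pi> x ^^ k) []"
  have legal: "\<pi> h \<in> legal I h" if "h \<in> histories I" for h
    using assms(1) that by (auto simp: strategies_def)
  have inv: "?h k \<in> histories I \<and> ((\<exists>j. \<pi> (?h k) = Halt j) \<or> length (?h k) = k)" for k
  proof (induction k)
    case 0
    show ?case by (simp add: histories_def)
  next
    case (Suc k)
    show ?case
    proof (cases "\<pi> (?h k)")
      case (Take i)
      hence i: "i < n_act I" "i \<notin> fst ` set (?h k)"
        using legal[of "?h k"] Suc by (auto simp: legal_def)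
      have "?h (Suc k) = ?h k @ [(i, x i)]" by (simp add: advance_def Take)
      thus ?thesis using Suc i assms(2)[of i] Take by (auto simp: histories_def)
    next
      case (Halt j)
      hence "?h (Suc k) = ?h k" by (simp add: advance_def)
      thus ?thesis using Suc Halt by simp
    qed
  qed
  show hist: "final_history I \<pi> x \<in> histories I"
    using inv[of "n_act I"] by (simp add: final_history_def)
  have "{..<n_act I} \<subseteq> fst ` set (final_history I \<pi> x)"
    if "length (final_history I \<pi> x) = n_act I"
  proof -
    have "card (fst ` set (final_history I \<pi> x)) = n_act I"
      using hist that distinct_card[of "map fst (final_history I \<pi> x)"]
      by (simp add: histories_def)
    moreover have "fst ` set (final_history I \<pi> x) \<subseteq> {..<n_act I}"
      using hist by (auto simp: histories_def)
    ultimately show ?thesis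
      using card_subset_eq[of "{..<n_act I}" "fst ` set (final_history I \<pi> x)"] by simp
  qed
  hence "\<exists>j. \<pi> (final_history I \<pi> x) = Halt j"
    using inv[of "n_act I"] legal[OF hist] by (auto simp: final_history_def legal_def)
  thus "\<exists>j \<in> insert 0 (snd ` set (final_history I \<pi> x)). \<pi> (final_history I \<pi> x) = Halt j"
    using legal[OF hist] by (auto simp: legal_def)
qed

lemma finite_maximizer:
  fixes f :: "'a \<Rightarrow> real"
  assumes "finite A" "A \<noteq> {}"
  shows "{a \<in> A. \<forall>b \<in> A. f b \<le> f a} \<noteq> {}"
proof -
  have "Max (f ` A) \<in> f ` A" using assms by (intro Max_in) auto
  then obtain a where "a \<in> A" "f a = Max (f ` A)" by auto
  hence "a \<in> {a \<in> A. \<forall>b \<in> A. f b \<le> f a}" using assms by auto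
  thus ?thesis by blast
qed

lemma linear_order_finite_least:
  assumes "linear_order_on A r" "finite B" "B \<noteq> {}" "B \<subseteq> A"
  shows "\<exists>b \<in> B. \<forall>b' \<in> B. (b, b') \<in> r"
  using assms(2-4)
proof (induction B rule: finite_ne_induct)
  case (singleton b)
  thus ?case using assms(1) by (auto simp: order_on_defs refl_on_def)
next
  case (insert a B)
  then obtain b where b: "b \<in> B" "\<forall>b' \<in> B. (b, b') \<in> r" by auto
  have refl: "(a, a) \<in> r" "(b, b) \<in> r" and tr: "trans r" and tot: "total_on A r"
    using assms(1) insert.prems b by (auto simp: order_on_defs refl_on_def)
  show ?case
  proof (cases "(a, b) \<in> r")
    case True
    hence "\<forall>b' \<in> insert a B. (a, b') \<in> r" using b refl tr by (auto dest: transD)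
    thus ?thesis by blast
  next
    case False
    hence "(b, a) \<in> r" using tot refl insert.prems b(1) by (auto simp: total_on_def)
    thus ?thesis using b by blast
  qed
qed

lemma best_response_unique:
  assumes "linear_order_on (strategies I) ord"
  shows "\<exists>!\<pi>. \<pi> \<in> favourable I t \<and> (\<forall>\<pi>' \<in> favourable I t. (\<pi>, \<pi>') \<in> ord)"
proof -
  have "agent_optimal I t \<noteq> {}"
    unfolding agent_optimal_def by (intro finite_maximizer finite_strategies strategies_nonempty)
  moreover have "finite (agent_optimal I t)"
    by (rule finite_subset[OF _ finite_strategies]) (auto simp: agent_optimal_def)
  ultimately have ne: "favourable I t \<noteq> {}"
    unfolding favourable_def by (intro finite_maximizer)
  have sub: "favourable I t \<subseteq> strategies I"
    by (auto simp: favourable_def agent_optimal_def)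
  have "\<exists>\<pi> \<in> favourable I t. \<forall>\<pi>' \<in> favourable I t. (\<pi>, \<pi>') \<in> ord"
    using assms finite_subset[OF sub finite_strategies] ne sub by (rule linear_order_finite_least)
  moreover have "antisym ord" using assms by (simp add: order_on_defs)
  ultimately show ?thesis by (auto dest: antisymD)
qed

section \<open>Polynomial time\<close>

text \<open>
  The machine model is a WHILE language on binary trees with integers at the leaves.  Time is
  charged at the bit level (logarithmic cost): evaluating an expression costs, for each of its
  nodes, the size of the value computed there, with integers measured by their binary length.
  The size of every operand and every result is therefore paid for, copies included, so that a
  Turing machine simulates a program with polynomial slowdown, and conversely.
\<close>

datatype val = Atom int | Node val val

fun vsize :: "val \<Rightarrow> nat" where
  "vsize (Atom a) = Suc (nat (bitlen \<bar>a\<bar>))"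
| "vsize (Node u v) = Suc (vsize u + vsize v)"

fun to_int :: "val \<Rightarrow> int" where
  "to_int (Atom a) = a"
| "to_int (Node u v) = 0"

definition truth :: "bool \<Rightarrow> val" where
  "truth b = Atom (if b then 1 else 0)"

datatype op1 = Left | Right | Is_Node

datatype op2 = Join | Add | Sub | Mul | Div | Less

fun eval1 :: "op1 \<Rightarrow> val \<Rightarrow> val" where
  "eval1 Left w = (case w of Node u v \<Rightarrow> u | Atom a \<Rightarrow> Atom 0)"
| "eval1 Right w = (case w of Node u v \<Rightarrow> v | Atom a \<Rightarrow> Atom 0)"
| "eval1 Is_Node w = truth (case w of Node u v \<Rightarrow> True | Atom a \<Rightarrow> False)"

fun eval2 :: "op2 \<Rightarrow> val \<Rightarrow> val \<Rightarrow> val" where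
  "eval2 Join u v = Node u v"
| "eval2 Add u v = Atom (to_int u + to_int v)"
| "eval2 Sub u v = Atom (to_int u - to_int v)"
| "eval2 Mul u v = Atom (to_int u * to_int v)"
| "eval2 Div u v = Atom (to_int u div to_int v)"
| "eval2 Less u v = truth (to_int u < to_int v)"

datatype expr = Var nat | Lit int | Op1 op1 expr | Op2 op2 expr expr

type_synonym state = "nat \<Rightarrow> val"

fun value_of :: "expr \<Rightarrow> state \<Rightarrow> val" where
  "value_of (Var x) s = s x"
| "value_of (Lit a) s = Atom a"
| "value_of (Op1 f e) s = eval1 f (value_of e s)"
| "value_of (Op2 f d e) s = eval2 f (value_of d s) (value_of e s)"

fun time_of :: "expr \<Rightarrow> state \<Rightarrow> nat" where
  "time_of (Var x) s = vsize (s x)"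
| "time_of (Lit a) s = vsize (Atom a)"
| "time_of (Op1 f e) s = time_of e s + vsize (value_of (Op1 f e) s)"
| "time_of (Op2 f d e) s = time_of d s + time_of e s + vsize (value_of (Op2 f d e) s)"

datatype com =
    Assign nat expr
  | Seq com com
  | If expr com com
  | While expr com

text \<open>
  \<open>exec c s k s'\<close>: started in \<open>s\<close>, the program \<open>c\<close> terminates in \<open>s'\<close> after time \<open>k\<close>.
  Guards count as true unless they evaluate to \<open>Atom 0\<close>.
\<close>

inductive exec :: "com \<Rightarrow> state \<Rightarrow> nat \<Rightarrow> state \<Rightarrow> bool" where
  assign: "exec (Assign x e) s (Suc (time_of e s)) (s(x := value_of e s))"
| seq: "exec c s j s' \<Longrightarrow> exec d s' k s'' \<Longrightarrow> exec (Seq c d) s (Suc (j + k)) s''"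
| if_true: "value_of e s \<noteq> Atom 0 \<Longrightarrow> exec c s k s' \<Longrightarrow>
    exec (If e c d) s (Suc (time_of e s + k)) s'"
| if_false: "value_of e s = Atom 0 \<Longrightarrow> exec d s k s' \<Longrightarrow>
    exec (If e c d) s (Suc (time_of e s + k)) s'"
| while_false: "value_of e s = Atom 0 \<Longrightarrow> exec (While e c) s (Suc (time_of e s)) s"
| while_true: "value_of e s \<noteq> Atom 0 \<Longrightarrow> exec c s j s' \<Longrightarrow> exec (While e c) s' k s'' \<Longrightarrow>
    exec (While e c) s (Suc (time_of e s + j + k)) s''"

lemma exec_deterministic:
  "exec c s k s' \<Longrightarrow> exec c s l s'' \<Longrightarrow> l = k \<and> s'' = s'"
proof (induction arbitrary: l s'' rule: exec.induct)
  case (assign x e s)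
  thus ?case by cases auto
next
  case (seq c s j s' d k t)
  from seq.prems obtain j' k' u where
    "exec c s j' u" "exec d u k' s''" "l = Suc (j' + k')" by cases
  thus ?case using seq.IH(1)[of j' u] seq.IH(2)[of k' s''] by simp
next
  case (if_true e s c k s' d)
  from if_true.prems if_true.hyps(1) obtain k' where
    "exec c s k' s''" "l = Suc (time_of e s + k')" by cases auto
  thus ?case using if_true.IH[of k' s''] by simp
next
  case (if_false e s d k s' c)
  from if_false.prems if_false.hyps(1) obtain k' where
    "exec d s k' s''" "l = Suc (time_of e s + k')" by cases auto
  thus ?case using if_false.IH[of k' s''] by simp
next
  case (while_false e s c)
  from while_false.prems while_false.hyps show ?case by cases auto
next
  case (while_true e s c j s' k t)
  from while_true.prems while_true.hyps(1) obtain j' k' u where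
    "exec c s j' u" "exec (While e c) u k' s''" "l = Suc (time_of e s + j' + k')"
    by cases auto
  thus ?case using while_true.IH(1)[of j' u] while_true.IH(2)[of k' s''] by simp
qed

definition initial :: "val \<Rightarrow> state" where
  "initial v = (\<lambda>x. if x = 0 then v else Atom 0)"

text \<open>
  A search problem: whenever \<open>E v i\<close>, that is, \<open>v\<close> encodes the problem instance \<open>i\<close>, the program
  maps \<open>v\<close>, in time polynomial in the size of \<open>v\<close>, to some \<open>w\<close> that is a solution, \<open>R i w\<close>.
\<close>

definition poly_time_solvable :: "(val \<Rightarrow> 'i \<Rightarrow> bool) \<Rightarrow> ('i \<Rightarrow> val \<Rightarrow> bool) \<Rightarrow> bool" where
  "poly_time_solvable E R \<longleftrightarrow>
     (\<exists>c. \<exists>p :: nat poly. \<forall>v i. E v i \<longrightarrow>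
        (\<exists>k s. exec c (initial v) k s \<and> k \<le> poly p (vsize v) \<and> R i (s 0)))"

subsection \<open>Encodings\<close>

text \<open>
  A rational number is given by a numerator and a positive denominator, both in binary and not
  necessarily coprime.  Lists are terminated by \<open>Atom 0\<close>.
\<close>

definition enc_rat :: "val \<Rightarrow> rat \<Rightarrow> bool" where
  "enc_rat v q \<longleftrightarrow> (\<exists>a b. 0 < b \<and> v = Node (Atom a) (Atom b) \<and> q = Rat.Fract a b)"

primrec enc_list :: "(val \<Rightarrow> 'a \<Rightarrow> bool) \<Rightarrow> val \<Rightarrow> 'a list \<Rightarrow> bool" where
  "enc_list E v [] \<longleftrightarrow> v = Atom 0"
| "enc_list E v (x # xs) \<longleftrightarrow> (\<exists>u w. v = Node u w \<and> E u x \<and> enc_list E w xs)"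

definition enc_inst :: "val \<Rightarrow> inst \<Rightarrow> bool" where
  "enc_inst v I \<longleftrightarrow>
     (\<exists>vc vr vp. v = Node vc (Node vr vp) \<and> enc_list enc_rat vc (costs I) \<and>
        enc_list enc_rat vr (rewards I) \<and> enc_list (enc_list enc_rat) vp (probs I))"

definition enc_contract :: "inst \<Rightarrow> val \<Rightarrow> contract \<Rightarrow> bool" where
  "enc_contract I v t \<longleftrightarrow>
     (\<exists>ts. length ts = n_out I \<and> enc_list enc_rat v ts \<and> (\<forall>j < n_out I. t j = of_rat (ts ! j)))"

end

theory Submission
  imports Defs
begin

text \<open>
  The agent faces Pandora's problem.  By Weitzman's theorem his optimal utility under the contract
  \<open>t\<close> is \<open>V t = E (max (t 0) (max i. min (t X\<^sub>i) z\<^sub>i))\<close>, where the index \<open>z\<^sub>i\<close> is a maximum of at most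
  \<open>2\<^sup>m\<close> affine functions of \<open>t\<close>.  Hence \<open>V\<close> is affine on each cell of the arrangement of the
  hyperplanes \<open>t j = 0\<close> and \<open>f = g\<close>, with \<open>f\<close> and \<open>g\<close> among these affine functions and the
  coordinates.  A best response at a point of a cell stays one on the closure of the cell, and the
  utility that it gives to the principal is affine and bounded above there, so that some vertex is
  at least as good.  For fixed \<open>m\<close> there are polynomially many vertices.

  To evaluate a vertex \<open>t\<close>, note that the agent's utility from a strategy under
  \<open>t + s (r - t)\<close> is his utility under \<open>t\<close> plus \<open>s\<close> times that of the principal.  With ties broken
  in favour of the principal, her utility is therefore the derivative of \<open>V\<close> at \<open>t\<close> in the direction
  \<open>r - t\<close>, which the explicit formula for \<open>V\<close> yields.
\<close>

section \<open>A calculus of polynomial-time programs in the WHILE language\<close>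

section \<open>Polynomial-time computable functions\<close>

subsection \<open>Sizes and running times\<close>

text \<open>As a function of the contract, the principal's value need not be continuous: it can jump
  where the best response changes. That a maximum exists is therefore not a matter of compactness.
  The argument keeps the agent's strategy fixed while the contract moves to a vertex and lets the
  agent choose again only there, which cannot hurt, since ties favour the principal. The coordinate
  hyperplanes keep the closure of a cell inside the nonnegative orthant, so that it contains no line
  and does have a vertex.

  No explicit step size \<open>s\<close> is ever computed. Affine functions are carried as pairs of
  their values at \<open>t\<close> and at the rewards, and a lexicographic comparison of the pairs
  is the comparison at an infinitesimal step.\<close>

lemma poly_nat_mono: "poly p x \<le> poly p y" if "x \<le> y" for p :: "nat poly"
  using that by (induction p) (auto intro!: add_mono mult_mono)

definition bits :: "int \<Rightarrow> nat" where
  "bits a = nat (bitlen \<bar>a\<bar>)"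

lemma bits_le_iff: "bits a \<le> n \<longleftrightarrow> \<bar>a\<bar> < 2 ^ n"
  using bitlen_le_iff_power[of "\<bar>a\<bar>" "int n"] bitlen_nonneg[of "\<bar>a\<bar>"] by (auto simp: bits_def nat_le_iff)

lemma bits_bound: "\<bar>a\<bar> < 2 ^ bits a"
  using bits_le_iff by blast

lemma bits_add: "bits (a + b) \<le> Suc (max (bits a) (bits b))"
proof -
  have "\<bar>a\<bar> < 2 ^ max (bits a) (bits b)" "\<bar>b\<bar> < 2 ^ max (bits a) (bits b)"
    using bits_le_iff max.cobounded1 max.cobounded2 by blast+
  thus ?thesis unfolding bits_le_iff by simp
qed

lemma bits_diff: "bits (a - b) \<le> Suc (max (bits a) (bits b))"
  using bits_add[of a "- b"] by (simp add: bits_def)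

lemma bits_mult: "bits (a * b) \<le> bits a + bits b"
  unfolding bits_le_iff
  by (simp add: abs_mult power_add bits_bound mult_strict_mono)

lemma bits_mono: "\<bar>a\<bar> \<le> \<bar>b\<bar> \<Longrightarrow> bits a \<le> bits b"
  using bits_bound[of b] unfolding bits_le_iff by linarith

text \<open>Division rounds down, so a negative quotient can exceed the true one in absolute value;
  comparison with the divisor 1 still bounds it by the dividend.\<close>

lemma abs_div_le: "\<bar>a div b\<bar> \<le> \<bar>a\<bar>" for a b :: int
proof -
  have pos: "\<bar>a div b\<bar> \<le> \<bar>a\<bar>" if "0 < b" for a b :: int
  proof (cases "0 \<le> a")
    case True
    thus ?thesis
      using that zdiv_mono2[of a 1 b] pos_imp_zdiv_nonneg_iff[of b a] by simp
  next
    case False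
    thus ?thesis
      using that zdiv_mono2_neg[of a 1 b] div_neg_pos_less0[of a b] by simp
  qed
  consider "b = 0" | "0 < b" | "b < 0" by linarith
  thus ?thesis
  proof cases
    case 3
    thus ?thesis using pos[of "- b" "- a"] by simp
  qed (auto intro: pos)
qed

lemma vsize_Atom: "vsize (Atom a) = Suc (bits a)"
  by (simp add: bits_def)

lemma vsize_truth: "vsize (truth b) \<le> Suc (Suc n)"
  by (auto simp: truth_def bitlen_alt_def)

lemma bits_to_int: "bits (to_int v) \<le> vsize v"
  by (cases v) (auto simp: bits_def)

lemma vsize_eval1: "vsize (eval1 f v) \<le> vsize v + 2"
  by (cases f; cases v) (auto simp: vsize_truth)

lemma vsize_eval2: "vsize (eval2 f u v) \<le> vsize u + vsize v + 2"
proof -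
  have *: "bits (to_int u) \<le> vsize u" "bits (to_int v) \<le> vsize v"
    by (rule bits_to_int)+
  show ?thesis
  proof (cases f)
    case Add thus ?thesis using * bits_add[of "to_int u" "to_int v"] by (simp add: vsize_Atom del: vsize.simps(1))
  next
    case Sub thus ?thesis using * bits_diff[of "to_int u" "to_int v"] by (simp add: vsize_Atom del: vsize.simps(1))
  next
    case Mul thus ?thesis using * bits_mult[of "to_int u" "to_int v"] by (simp add: vsize_Atom del: vsize.simps(1))
  next
    case Div thus ?thesis using * bits_mono[OF abs_div_le, of "to_int u" "to_int v"] by (simp add: vsize_Atom del: vsize.simps(1))
  next
    case Less thus ?thesis by (simp add: vsize_truth)
  qed auto
qed

lemma vsize_value_of: "vsize (value_of e s) \<le> time_of e s"
  by (cases e) auto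

text \<open>Whatever is written into a register was paid for by the expression that computed it, so
  the running time bounds the growth of every register.\<close>

lemma exec_vsize: "exec c s k s' \<Longrightarrow> vsize (s' x) \<le> vsize (s x) + k"
proof (induction rule: exec.induct)
  case (assign y e s)
  thus ?case using vsize_value_of[of e s] by auto
qed auto

subsection \<open>Transformations of a single register\<close>

definition poly_expr :: "expr \<Rightarrow> bool" where
  "poly_expr e \<longleftrightarrow> (\<exists>p. \<forall>s. time_of e s \<le> poly p (vsize (s 0)))"

lemma poly_exprI: "(\<And>s. time_of e s \<le> poly p (vsize (s 0))) \<Longrightarrow> poly_expr e"
  unfolding poly_expr_def by blast

lemma poly_expr_Var: "poly_expr (Var 0)"
  by (rule poly_exprI[of _ "[:0, 1:]"]) simp

lemma poly_expr_Lit: "poly_expr (Lit a)"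
  by (rule poly_exprI[of _ "[:vsize (Atom a):]"]) simp

lemma poly_expr_Op1:
  assumes "poly_expr e"
  shows "poly_expr (Op1 f e)"
proof -
  obtain p where p: "\<And>s. time_of e s \<le> poly p (vsize (s 0))"
    using assms unfolding poly_expr_def by blast
  show ?thesis
  proof (rule poly_exprI)
    fix s
    show "time_of (Op1 f e) s \<le> poly (p + p + [:2:]) (vsize (s 0))"
      using p[of s] vsize_eval1[of f "value_of e s"] vsize_value_of[of e s] by simp
  qed
qed

lemma poly_expr_Op2:
  assumes "poly_expr d" "poly_expr e"
  shows "poly_expr (Op2 f d e)"
proof -
  obtain p q where p: "\<And>s. time_of d s \<le> poly p (vsize (s 0))"
    and q: "\<And>s. time_of e s \<le> poly q (vsize (s 0))"
    using assms unfolding poly_expr_def by blast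
  show ?thesis
  proof (rule poly_exprI)
    fix s
    show "time_of (Op2 f d e) s \<le> poly (p + p + q + q + [:2:]) (vsize (s 0))"
      using p[of s] q[of s] vsize_eval2[of f "value_of d s" "value_of e s"]
        vsize_value_of[of d s] vsize_value_of[of e s] by simp
  qed
qed

lemmas poly_expr_intros = poly_expr_Var poly_expr_Lit poly_expr_Op1 poly_expr_Op2

text \<open>The bound is uniform over a family: \<open>i\<close> may carry an input together with a
  stack or a loop counter, and \<open>g i\<close> and \<open>f i\<close> are the contents of
  register 0 before and after. All other registers are arbitrary, so programs can be chained without
  cleaning up.\<close>

definition transforms :: "'i set \<Rightarrow> ('i \<Rightarrow> val) \<Rightarrow> ('i \<Rightarrow> val) \<Rightarrow> bool" where
  "transforms A g f \<longleftrightarrow>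
     (\<exists>c p. \<forall>i \<in> A. \<forall>s. s 0 = g i \<longrightarrow>
        (\<exists>k s'. exec c s k s' \<and> s' 0 = f i \<and> k \<le> poly p (vsize (g i))))"

lemma transformsI:
  assumes "\<And>i s. i \<in> A \<Longrightarrow> s 0 = g i \<Longrightarrow> \<exists>k s'. exec c s k s' \<and> s' 0 = f i \<and> k \<le> poly p (vsize (g i))"
  shows "transforms A g f"
  unfolding transforms_def using assms by blast

lemma transforms_reindex:
  assumes "transforms A g f" "\<And>j. j \<in> B \<Longrightarrow> \<exists>i \<in> A. g i = g' j \<and> f i = f' j"
  shows "transforms B g' f'"
  using assms unfolding transforms_def by (metis (no_types, lifting))

lemma transforms_expr:
  assumes "poly_expr e" "\<And>i s. i \<in> A \<Longrightarrow> s 0 = g i \<Longrightarrow> value_of e s = f i"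
  shows "transforms A g f"
proof -
  obtain p where p: "\<And>s. time_of e s \<le> poly p (vsize (s 0))"
    using assms(1) unfolding poly_expr_def by blast
  show ?thesis
  proof (rule transformsI[of A g "Assign 0 e" f "p + [:1:]"])
    fix i and s :: state assume "i \<in> A" "s 0 = g i"
    thus "\<exists>k s'. exec (Assign 0 e) s k s' \<and> s' 0 = f i \<and> k \<le> poly (p + [:1:]) (vsize (g i))"
      using assms(2)[of i s] p[of s]
      by (intro exI[of _ "Suc (time_of e s)"] exI[of _ "s(0 := value_of e s)"])
        (use exec.assign[of 0 e s] in auto)
  qed
qed

text \<open>The second program is polynomial in the intermediate value, whose size is at most the
  input size plus the time of the first program; polynomials are closed under this
  substitution.\<close>

lemma transforms_seq:
  assumes "transforms A g f" "transforms A f h"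
  shows "transforms A g h"
proof -
  obtain c p where c: "\<And>i s. i \<in> A \<Longrightarrow> s 0 = g i \<Longrightarrow>
    \<exists>k s'. exec c s k s' \<and> s' 0 = f i \<and> k \<le> poly p (vsize (g i))"
    using assms(1) unfolding transforms_def by blast
  obtain d q where d: "\<And>i s. i \<in> A \<Longrightarrow> s 0 = f i \<Longrightarrow>
    \<exists>k s'. exec d s k s' \<and> s' 0 = h i \<and> k \<le> poly q (vsize (f i))"
    using assms(2) unfolding transforms_def by blast
  show ?thesis
  proof (rule transformsI)
    fix i and s :: state assume i: "i \<in> A" and s: "s 0 = g i"
    obtain j s' where j: "exec c s j s'" "s' 0 = f i" "j \<le> poly p (vsize (g i))"
      using c[of i s] i s by blast
    obtain k s'' where k: "exec d s' k s''" "s'' 0 = h i" "k \<le> poly q (vsize (f i))"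
      using d[of i s'] i j(2) by blast
    have "vsize (f i) \<le> vsize (g i) + poly p (vsize (g i))"
      using exec_vsize[OF j(1), of 0] j s by simp
    hence "k \<le> poly q (vsize (g i) + poly p (vsize (g i)))"
      using k(3) poly_nat_mono le_trans by blast
    hence "Suc (j + k) \<le> poly ([:1:] + p + pcompose q ([:0, 1:] + p)) (vsize (g i))"
      using j(3) by (simp add: poly_pcompose)
    thus "\<exists>k s'. exec (Seq c d) s k s' \<and> s' 0 = h i \<and>
        k \<le> poly ([:1:] + p + pcompose q ([:0, 1:] + p)) (vsize (g i))"
      using exec.seq[OF j(1) k(1)] k(2) by blast
  qed
qed

lemma transforms_if:
  assumes "poly_expr e"
    and guard: "\<And>i s. i \<in> A \<Longrightarrow> s 0 = g i \<Longrightarrow> value_of e s \<noteq> Atom 0 \<longleftrightarrow> P i"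
    and "transforms {i \<in> A. P i} g f" "transforms {i \<in> A. \<not> P i} g f"
  shows "transforms A g f"
proof -
  obtain r where r: "\<And>s. time_of e s \<le> poly r (vsize (s 0))"
    using assms(1) unfolding poly_expr_def by blast
  obtain c p where c: "\<And>i s. i \<in> {i \<in> A. P i} \<Longrightarrow> s 0 = g i \<Longrightarrow>
    \<exists>k s'. exec c s k s' \<and> s' 0 = f i \<and> k \<le> poly p (vsize (g i))"
    using assms(3) unfolding transforms_def by blast
  obtain d q where d: "\<And>i s. i \<in> {i \<in> A. \<not> P i} \<Longrightarrow> s 0 = g i \<Longrightarrow>
    \<exists>k s'. exec d s k s' \<and> s' 0 = f i \<and> k \<le> poly q (vsize (g i))"
    using assms(4) unfolding transforms_def by blast
  show ?thesis
  proof (rule transformsI)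
    fix i and s :: state assume i: "i \<in> A" and s: "s 0 = g i"
    show "\<exists>k s'. exec (If e c d) s k s' \<and> s' 0 = f i \<and> k \<le> poly ([:1:] + r + p + q) (vsize (g i))"
    proof (cases "P i")
      case True
      then obtain k s' where k: "exec c s k s'" "s' 0 = f i" "k \<le> poly p (vsize (g i))"
        using c[of i s] i s by blast
      have "exec (If e c d) s (Suc (time_of e s + k)) s'"
        using guard[of i s] i s True k(1) by (intro exec.if_true) auto
      moreover have "Suc (time_of e s + k) \<le> poly ([:1:] + r + p + q) (vsize (g i))"
        using r[of s] k(3) s by simp
      ultimately show ?thesis using k(2) by blast
    next
      case False
      then obtain k s' where k: "exec d s k s'" "s' 0 = f i" "k \<le> poly q (vsize (g i))"
        using d[of i s] i s by blast
      have "exec (If e c d) s (Suc (time_of e s + k)) s'"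
        using guard[of i s] i s False k(1) by (intro exec.if_false) auto
      moreover have "Suc (time_of e s + k) \<le> poly ([:1:] + r + p + q) (vsize (g i))"
        using r[of s] k(3) s by simp
      ultimately show ?thesis using k(2) by blast
    qed
  qed
qed

text \<open>\<open>g i k\<close> is the content of register 0 after \<open>k\<close> rounds. A
  polynomial-time body alone could double the size in every round; hence the separate bound
  \<open>size\<close> on every intermediate state in terms of the initial one.\<close>

lemma transforms_while:
  fixes g :: "'i \<Rightarrow> nat \<Rightarrow> val"
  assumes "poly_expr e"
    and guard: "\<And>i k s. i \<in> A \<Longrightarrow> k \<le> n i \<Longrightarrow> s 0 = g i k \<Longrightarrow> value_of e s \<noteq> Atom 0 \<longleftrightarrow> k < n i"
    and body: "transforms {(i, k). i \<in> A \<and> k < n i} (\<lambda>(i, k). g i k) (\<lambda>(i, k). g i (Suc k))"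
    and size: "\<And>i k. i \<in> A \<Longrightarrow> k \<le> n i \<Longrightarrow> vsize (g i k) \<le> poly q (vsize (g i 0))"
    and rounds: "\<And>i. i \<in> A \<Longrightarrow> n i \<le> vsize (g i 0)"
  shows "transforms A (\<lambda>i. g i 0) (\<lambda>i. g i (n i))"
proof -
  obtain r where r: "\<And>s. time_of e s \<le> poly r (vsize (s 0))"
    using assms(1) unfolding poly_expr_def by blast
  obtain c p where "\<And>x s. x \<in> {(i, k). i \<in> A \<and> k < n i} \<Longrightarrow> s 0 = (\<lambda>(i, k). g i k) x \<Longrightarrow>
    \<exists>k s'. exec c s k s' \<and> s' 0 = (\<lambda>(i, k). g i (Suc k)) x \<and> k \<le> poly p (vsize ((\<lambda>(i, k). g i k) x))"
    using body unfolding transforms_def by blast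
  hence c: "\<exists>l s'. exec c s l s' \<and> s' 0 = g i (Suc k) \<and> l \<le> poly p (vsize (g i k))"
    if "i \<in> A" "k < n i" "s 0 = g i k" for i k s
    using that by (metis (mono_tags, lifting) case_prod_conv mem_Collect_eq)
  \<comment> \<open>\<open>T N\<close> bounds one round from any state reached from an initial state
    of size \<open>N\<close>. The induction is on the number \<open>d\<close> of rounds that are
    left.\<close>
  define T where "T N = Suc (poly r (poly q N) + poly p (poly q N))" for N
  have run: "\<exists>l s'. exec (While e c) s l s' \<and> s' 0 = g i (n i) \<and> l \<le> Suc d * T (vsize (g i 0))"
    if "i \<in> A" "d \<le> n i" "s 0 = g i (n i - d)" for i d s
    using that
  proof (induction d arbitrary: s)
    case 0
    have "exec (While e c) s (Suc (time_of e s)) s"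
      using 0 guard[of i "n i" s] by (intro exec.while_false) auto
    moreover have "time_of e s \<le> poly r (poly q (vsize (g i 0)))"
      using r[of s] 0 size[of i "n i"] poly_nat_mono le_trans by (metis diff_zero order_refl)
    ultimately show ?case using 0 by (intro exI[of _ "Suc (time_of e s)"] exI[of _ s]) (auto simp: T_def)
  next
    case (Suc d)
    let ?k = "n i - Suc d"
    have k: "?k < n i" "Suc ?k = n i - d" using Suc.prems by auto
    obtain j s' where j: "exec c s j s'" "s' 0 = g i (n i - d)" "j \<le> poly p (vsize (g i ?k))"
      using c[of i ?k s] Suc.prems k by auto
    obtain l s'' where l: "exec (While e c) s' l s''" "s'' 0 = g i (n i)" "l \<le> Suc d * T (vsize (g i 0))"
      using Suc.IH[of s'] Suc.prems j(2) by auto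
    have "exec (While e c) s (Suc (time_of e s + j + l)) s''"
      using guard[of i ?k s] Suc.prems k j(1) l(1) by (intro exec.while_true) auto
    moreover have sz: "vsize (g i ?k) \<le> poly q (vsize (g i 0))"
      using size[of i ?k] Suc.prems by simp
    have "time_of e s \<le> poly r (poly q (vsize (g i 0)))"
      using r[of s] Suc.prems poly_nat_mono[OF sz] le_trans by metis
    moreover have "j \<le> poly p (poly q (vsize (g i 0)))"
      using j(3) poly_nat_mono[OF sz] le_trans by blast
    ultimately show ?case using l(2,3)
      by (intro exI[of _ "Suc (time_of e s + j + l)"] exI[of _ s'']) (auto simp: T_def)
  qed
  show ?thesis
  proof (rule transformsI)
    fix i and s :: state assume i: "i \<in> A" and s: "s 0 = g i 0"
    obtain l s' where l: "exec (While e c) s l s'" "s' 0 = g i (n i)" "l \<le> Suc (n i) * T (vsize (g i 0))"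
      using run[of i "n i" s] i s by auto
    have "Suc (n i) * T (vsize (g i 0)) \<le> Suc (vsize (g i 0)) * T (vsize (g i 0))"
      using rounds[OF i] by (intro mult_right_mono) auto
    also have "\<dots> = poly ([:1, 1:] * ([:1:] + pcompose r q + pcompose p q)) (vsize (g i 0))"
      by (simp add: T_def poly_pcompose algebra_simps)
    finally show "\<exists>k s'. exec (While e c) s k s' \<and> s' 0 = g i (n i) \<and>
        k \<le> poly ([:1, 1:] * ([:1:] + pcompose r q + pcompose p q)) (vsize (g i 0))"
      using l le_trans by blast
  qed
qed

subsection \<open>Typed functions\<close>

class encodable =
  fixes code :: "'a \<Rightarrow> val"

instantiation int :: encodable
begin
definition code_int :: "int \<Rightarrow> val" where "code_int = Atom"
instance ..
end

instantiation bool :: encodable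
begin
definition code_bool :: "bool \<Rightarrow> val" where "code_bool = truth"
instance ..
end

instantiation prod :: (encodable, encodable) encodable
begin
definition code_prod :: "'a \<times> 'b \<Rightarrow> val" where "code_prod p = Node (code (fst p)) (code (snd p))"
instance ..
end

instantiation list :: (encodable) encodable
begin
primrec code_list :: "'a list \<Rightarrow> val" where
  "code_list [] = Atom 0"
| "code_list (x # xs) = Node (code x) (code_list xs)"
instance ..
end

lemma code_Pair [simp]: "code (x, y) = Node (code x) (code y)"
  by (simp add: code_prod_def)

text \<open>
  The input sits on top of a stack that the program must preserve, so that programs compose
  without renaming of variables.
\<close>

definition ptime :: "('a :: encodable \<Rightarrow> 'b :: encodable) \<Rightarrow> bool" where
  "ptime f \<longleftrightarrow> transforms UNIV (\<lambda>(x, stk). Node (code x) stk) (\<lambda>(x, stk). Node (code (f x)) stk)"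

text \<open>The output is written within the running time, here above the empty stack
  \<open>Atom 0\<close>.\<close>

lemma ptime_vsize:
  assumes "ptime f"
  obtains q where "\<And>x. vsize (code (f x)) \<le> poly q (vsize (code x))"
proof -
  obtain c p where c: "\<And>y s. s 0 = (\<lambda>(x, stk). Node (code x) stk) y \<Longrightarrow>
    \<exists>k s'. exec c s k s' \<and> s' 0 = (\<lambda>(x, stk). Node (code (f x)) stk) y \<and>
      k \<le> poly p (vsize ((\<lambda>(x, stk). Node (code x) stk) y))"
    using assms unfolding ptime_def transforms_def by blast
  have "vsize (code (f x)) \<le> poly ([:2, 1:] + pcompose p [:2, 1:]) (vsize (code x))" for x
  proof -
    obtain k s' where "exec c (\<lambda>_. Node (code x) (Atom 0)) k s'" "s' 0 = Node (code (f x)) (Atom 0)"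
      "k \<le> poly p (vsize (Node (code x) (Atom 0)))"
      using c[of "\<lambda>_. Node (code x) (Atom 0)" "(x, Atom 0)"] by auto
    thus ?thesis
      using exec_vsize[of c "\<lambda>_. Node (code x) (Atom 0)" k s' 0] by (simp add: poly_pcompose)
  qed
  thus thesis by (rule that)
qed

lemma ptime_expr:
  assumes "poly_expr e"
    and "\<And>x stk s. s 0 = Node (code x) stk \<Longrightarrow> value_of e s = Node (code (f x)) stk"
  shows "ptime f"
  unfolding ptime_def using assms(1) by (rule transforms_expr) (use assms(2) in auto)

lemma ptime_comp:
  assumes "ptime f" "ptime g"
  shows "ptime (\<lambda>x. g (f x))"
  unfolding ptime_def
proof (rule transforms_seq)
  show "transforms UNIV (\<lambda>(x, stk). Node (code x) stk) (\<lambda>(x, stk). Node (code (f x)) stk)"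
    using assms(1) unfolding ptime_def .
  show "transforms UNIV (\<lambda>(x, stk). Node (code (f x)) stk) (\<lambda>(x, stk). Node (code (g (f x))) stk)"
    using assms(2) unfolding ptime_def by (rule transforms_reindex) auto
qed

abbreviation Top :: expr where "Top \<equiv> Op1 Left (Var 0)"
abbreviation Stack :: expr where "Stack \<equiv> Op1 Right (Var 0)"
abbreviation Pair_expr :: "expr \<Rightarrow> expr \<Rightarrow> expr" where "Pair_expr \<equiv> Op2 Join"

named_theorems ptime_intros

lemma ptime_id [ptime_intros]: "ptime (\<lambda>x. x)"
  by (rule ptime_expr[of "Var 0"]) (auto intro: poly_expr_intros)

text \<open>A copy of the input on the stack survives the run of \<open>f\<close>; a swap then
  exposes it to \<open>g\<close>, while the result of \<open>f\<close> waits below.\<close>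

lemma ptime_pair [ptime_intros]:
  assumes "ptime f" "ptime g"
  shows "ptime (\<lambda>x. (f x, g x))"
  unfolding ptime_def
proof (rule transforms_seq)
  show "transforms UNIV (\<lambda>(x, stk). Node (code x) stk)
      (\<lambda>(x, stk). Node (code x) (Node (code x) stk))"
    by (rule transforms_expr[of "Pair_expr Top (Pair_expr Top Stack)"])
      (auto intro!: poly_expr_intros)
  show "transforms UNIV (\<lambda>(x, stk). Node (code x) (Node (code x) stk))
      (\<lambda>(x, stk). Node (code (f x, g x)) stk)"
  proof (rule transforms_seq)
    show "transforms UNIV (\<lambda>(x, stk). Node (code x) (Node (code x) stk))
        (\<lambda>(x, stk). Node (code (f x)) (Node (code x) stk))"
      using assms(1) unfolding ptime_def by (rule transforms_reindex) auto
    show "transforms UNIV (\<lambda>(x, stk). Node (code (f x)) (Node (code x) stk))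
        (\<lambda>(x, stk). Node (code (f x, g x)) stk)"
    proof (rule transforms_seq)
      show "transforms UNIV (\<lambda>(x, stk). Node (code (f x)) (Node (code x) stk))
          (\<lambda>(x, stk). Node (code x) (Node (code (f x)) stk))"
        by (rule transforms_expr[of "Pair_expr (Op1 Left Stack) (Pair_expr Top (Op1 Right Stack))"])
          (auto intro!: poly_expr_intros)
      show "transforms UNIV (\<lambda>(x, stk). Node (code x) (Node (code (f x)) stk))
          (\<lambda>(x, stk). Node (code (f x, g x)) stk)"
      proof (rule transforms_seq)
        show "transforms UNIV (\<lambda>(x, stk). Node (code x) (Node (code (f x)) stk))
            (\<lambda>(x, stk). Node (code (g x)) (Node (code (f x)) stk))"
          using assms(2) unfolding ptime_def by (rule transforms_reindex) auto
        show "transforms UNIV (\<lambda>(x, stk). Node (code (g x)) (Node (code (f x)) stk))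
            (\<lambda>(x, stk). Node (code (f x, g x)) stk)"
          by (rule transforms_expr[of
                "Pair_expr (Pair_expr (Op1 Left Stack) Top) (Op1 Right Stack)"])
            (auto intro!: poly_expr_intros)
      qed
    qed
  qed
qed

lemma ptime_comp2:
  assumes "ptime (\<lambda>p. F (fst p) (snd p))" "ptime f" "ptime g"
  shows "ptime (\<lambda>x. F (f x) (g x))"
  using ptime_comp[OF ptime_pair[OF assms(2,3)] assms(1)] by simp

primrec const_expr :: "val \<Rightarrow> expr" where
  "const_expr (Atom a) = Lit a"
| "const_expr (Node u v) = Pair_expr (const_expr u) (const_expr v)"

lemma value_of_const_expr: "value_of (const_expr v) s = v"
  by (induction v) auto

lemma poly_expr_const: "poly_expr (const_expr v)"
  by (induction v) (auto intro: poly_expr_intros)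

text \<open>The constant is part of the program text. This is how data that depend on
  \<open>m\<close> only, such as \<open>coords m\<close> and the exponentially many vectors of
  \<open>masks m\<close>, enter the programs.\<close>

lemma ptime_const [ptime_intros]: "ptime (\<lambda>x. c)"
  by (rule ptime_expr[of "Pair_expr (const_expr (code c)) Stack"])
    (auto intro!: poly_expr_intros poly_expr_const simp: value_of_const_expr)

lemma ptime_fst [ptime_intros]: "ptime f \<Longrightarrow> ptime (\<lambda>x. fst (f x))"
  by (rule ptime_comp[of f fst], assumption)
    (rule ptime_expr[of "Pair_expr (Op1 Left Top) Stack"],
     auto intro!: poly_expr_intros simp: code_prod_def)

lemma ptime_snd [ptime_intros]: "ptime f \<Longrightarrow> ptime (\<lambda>x. snd (f x))"
  by (rule ptime_comp[of f snd], assumption)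
    (rule ptime_expr[of "Pair_expr (Op1 Right Top) Stack"],
     auto intro!: poly_expr_intros simp: code_prod_def)

lemma ptime_Cons [ptime_intros]: "ptime f \<Longrightarrow> ptime g \<Longrightarrow> ptime (\<lambda>x. f x # g x)"
  by (rule ptime_comp2)
    (rule ptime_expr[of "Var 0"], auto intro!: poly_expr_intros simp: code_prod_def)

lemma ptime_add [ptime_intros]: "ptime f \<Longrightarrow> ptime g \<Longrightarrow> ptime (\<lambda>x. f x + g x :: int)"
  by (rule ptime_comp2)
    (rule ptime_expr[of "Pair_expr (Op2 Add (Op1 Left Top) (Op1 Right Top)) Stack"],
     auto intro!: poly_expr_intros simp: code_prod_def code_int_def)

lemma ptime_diff [ptime_intros]: "ptime f \<Longrightarrow> ptime g \<Longrightarrow> ptime (\<lambda>x. f x - g x :: int)"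
  by (rule ptime_comp2)
    (rule ptime_expr[of "Pair_expr (Op2 Sub (Op1 Left Top) (Op1 Right Top)) Stack"],
     auto intro!: poly_expr_intros simp: code_prod_def code_int_def)

lemma ptime_mult [ptime_intros]: "ptime f \<Longrightarrow> ptime g \<Longrightarrow> ptime (\<lambda>x. f x * g x :: int)"
  by (rule ptime_comp2)
    (rule ptime_expr[of "Pair_expr (Op2 Mul (Op1 Left Top) (Op1 Right Top)) Stack"],
     auto intro!: poly_expr_intros simp: code_prod_def code_int_def)

lemma ptime_less [ptime_intros]: "ptime f \<Longrightarrow> ptime g \<Longrightarrow> ptime (\<lambda>x. f x < (g x :: int))"
  by (rule ptime_comp2)
    (rule ptime_expr[of "Pair_expr (Op2 Less (Op1 Left Top) (Op1 Right Top)) Stack"],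
     auto intro!: poly_expr_intros simp: code_prod_def code_int_def code_bool_def)

lemma ptime_Nil_eq [ptime_intros]: "ptime f \<Longrightarrow> ptime (\<lambda>x. f x = [])"
proof (rule ptime_comp[of f "\<lambda>xs. xs = []"], assumption,
    rule ptime_expr[of "Pair_expr (Op2 Sub (Lit 1) (Op1 Is_Node Top)) Stack"])
  fix xs :: "'b list" and stk and s :: state
  assume "s 0 = Node (code xs) stk"
  thus "value_of (Pair_expr (Op2 Sub (Lit 1) (Op1 Is_Node Top)) Stack) s = Node (code (xs = [])) stk"
    by (cases xs) (auto simp: code_bool_def truth_def)
qed (intro poly_expr_intros)

text \<open>Guards are single expressions, so the condition is computed beforehand and put next to
  the input; both branches start by dropping it.\<close>

lemma ptime_if [ptime_intros]:
  assumes "ptime b" "ptime f" "ptime g"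
  shows "ptime (\<lambda>x. if b x then f x else g x)"
proof -
  let ?h = "\<lambda>x. if b x then f x else g x"
  have "ptime (\<lambda>x. (b x, x))" using assms(1) by (intro ptime_intros)
  moreover have "transforms UNIV (\<lambda>(x, stk). Node (code (b x, x)) stk) (\<lambda>(x, stk). Node (code (?h x)) stk)"
  proof (rule transforms_if[of "Op1 Left Top" _ _ "\<lambda>(x, stk). b x"])
    show "poly_expr (Op1 Left Top)" by (intro poly_expr_intros)
  next
    fix i :: "'a \<times> val" and s :: state
    assume "s 0 = (\<lambda>(x, stk). Node (code (b x, x)) stk) i"
    thus "(value_of (Op1 Left Top) s \<noteq> Atom 0) = (\<lambda>(x, stk). b x) i"
      by (auto simp: code_bool_def truth_def split: prod.splits)
  next
    let ?drop = "Pair_expr (Op1 Right Top) Stack"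
    have drop: "transforms A (\<lambda>(x, stk). Node (code (b x, x)) stk) (\<lambda>(x, stk). Node (code x) stk)" for A
      by (rule transforms_expr[of ?drop]) (auto intro!: poly_expr_intros)
    show "transforms {i \<in> UNIV. (\<lambda>(x, stk). b x) i} (\<lambda>(x, stk). Node (code (b x, x)) stk)
        (\<lambda>(x, stk). Node (code (?h x)) stk)"
      using drop by (rule transforms_seq)
        (use assms(2) in \<open>unfold ptime_def, erule_tac transforms_reindex, auto\<close>)
    show "transforms {i \<in> UNIV. \<not> (\<lambda>(x, stk). b x) i} (\<lambda>(x, stk). Node (code (b x, x)) stk)
        (\<lambda>(x, stk). Node (code (?h x)) stk)"
      using drop by (rule transforms_seq)
        (use assms(3) in \<open>unfold ptime_def, erule_tac transforms_reindex, auto\<close>)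
  qed
  ultimately show ?thesis unfolding ptime_def by (rule transforms_seq)
qed

lemma ptime_not [ptime_intros]:
  assumes "ptime b"
  shows "ptime (\<lambda>x. \<not> b x)"
proof -
  have "ptime (\<lambda>x. if b x then False else True)" using assms by (intro ptime_intros)
  moreover have "(\<lambda>x. if b x then False else True) = (\<lambda>x. \<not> b x)" by auto
  ultimately show ?thesis by (simp only:)
qed

lemma ptime_conj [ptime_intros]:
  assumes "ptime b" "ptime c"
  shows "ptime (\<lambda>x. b x \<and> c x)"
proof -
  have "ptime (\<lambda>x. if b x then c x else False)" using assms by (intro ptime_intros)
  moreover have "(\<lambda>x. if b x then c x else False) = (\<lambda>x. b x \<and> c x)" by auto
  ultimately show ?thesis by (simp only:)
qed

lemma ptime_disj [ptime_intros]:
  assumes "ptime b" "ptime c"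
  shows "ptime (\<lambda>x. b x \<or> c x)"
proof -
  have "ptime (\<lambda>x. \<not> (\<not> b x \<and> \<not> c x))" using assms by (intro ptime_intros)
  thus ?thesis by simp
qed

text \<open>The code of a list is \<open>Atom 0\<close> exactly if the list is empty, so the list
  itself serves as the guard; head and tail are the components of its code.\<close>

lemma ptime_case_list [ptime_intros]:
  assumes "ptime h" "ptime d" "ptime (\<lambda>p. f (fst p) (fst (snd p)) (snd (snd p)))"
  shows "ptime (\<lambda>z. case h z of [] \<Rightarrow> d z | x # xs \<Rightarrow> f z x xs)"
proof -
  let ?g = "\<lambda>z. case h z of [] \<Rightarrow> d z | x # xs \<Rightarrow> f z x xs"
  have "ptime (\<lambda>z. (h z, z))" using assms(1) by (intro ptime_intros)
  moreover have "transforms UNIV (\<lambda>(z, stk). Node (code (h z, z)) stk) (\<lambda>(z, stk). Node (code (?g z)) stk)"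
  proof (rule transforms_if[of "Op1 Left Top" _ _ "\<lambda>(z, stk). h z \<noteq> []"])
    show "poly_expr (Op1 Left Top)" by (intro poly_expr_intros)
  next
    fix i :: "'a \<times> val" and s :: state
    assume "s 0 = (\<lambda>(z, stk). Node (code (h z, z)) stk) i"
    thus "(value_of (Op1 Left Top) s \<noteq> Atom 0) = (\<lambda>(z, stk). h z \<noteq> []) i"
      by (cases "h (fst i)") (auto split: prod.splits)
  next
    have "transforms {i \<in> UNIV. (\<lambda>(z, stk). h z \<noteq> []) i} (\<lambda>(z, stk). Node (code (h z, z)) stk)
       (\<lambda>(z, stk). Node (code (z, hd (h z), tl (h z))) stk)"
    proof (rule transforms_expr[of "Pair_expr (Pair_expr (Op1 Right Top) (Op1 Left Top)) Stack"])
      fix i :: "'a \<times> val" and s :: state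
      assume "i \<in> {i \<in> UNIV. (\<lambda>(z, stk). h z \<noteq> []) i}" "s 0 = (\<lambda>(z, stk). Node (code (h z, z)) stk) i"
      thus "value_of (Pair_expr (Pair_expr (Op1 Right Top) (Op1 Left Top)) Stack) s =
         (\<lambda>(z, stk). Node (code (z, hd (h z), tl (h z))) stk) i"
        by (cases "h (fst i)") (auto split: prod.splits)
    qed (intro poly_expr_intros)
    moreover have "transforms {i \<in> UNIV. (\<lambda>(z, stk). h z \<noteq> []) i}
        (\<lambda>(z, stk). Node (code (z, hd (h z), tl (h z))) stk) (\<lambda>(z, stk). Node (code (?g z)) stk)"
      using assms(3) unfolding ptime_def
      by (rule transforms_reindex) (force simp: neq_Nil_conv)
    ultimately show "transforms {i \<in> UNIV. (\<lambda>(z, stk). h z \<noteq> []) i}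
        (\<lambda>(z, stk). Node (code (h z, z)) stk) (\<lambda>(z, stk). Node (code (?g z)) stk)"
      by (rule transforms_seq)
  next
    have "transforms {i \<in> UNIV. \<not> (\<lambda>(z, stk). h z \<noteq> []) i} (\<lambda>(z, stk). Node (code (h z, z)) stk)
       (\<lambda>(z, stk). Node (code z) stk)"
      by (rule transforms_expr[of "Pair_expr (Op1 Right Top) Stack"]) (auto intro!: poly_expr_intros)
    moreover have "transforms {i \<in> UNIV. \<not> (\<lambda>(z, stk). h z \<noteq> []) i}
        (\<lambda>(z, stk). Node (code z) stk) (\<lambda>(z, stk). Node (code (?g z)) stk)"
      using assms(2) unfolding ptime_def by (rule transforms_reindex) auto
    ultimately show "transforms {i \<in> UNIV. \<not> (\<lambda>(z, stk). h z \<noteq> []) i}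
        (\<lambda>(z, stk). Node (code (h z, z)) stk) (\<lambda>(z, stk). Node (code (?g z)) stk)"
      by (rule transforms_seq)
  qed
  ultimately show ?thesis unfolding ptime_def by (rule transforms_seq)
qed

subsection \<open>Iteration over lists\<close>

lemma vsize_code_list: "vsize (code xs) = Suc (\<Sum>x\<leftarrow>xs. Suc (vsize (code x)))"
  by (induction xs) auto

lemma length_le_vsize: "length xs \<le> vsize (code xs)"
  by (induction xs) auto

lemma vsize_member: "x \<in> set xs \<Longrightarrow> vsize (code x) \<le> vsize (code xs)"
  by (induction xs) auto

lemma vsize_append: "vsize (code zs) \<le> vsize (code (ys @ zs))"
  by (induction ys) auto

lemma vsize_drop: "vsize (code (drop k xs)) \<le> vsize (code xs)"
  using vsize_append[of "drop k xs" "take k xs"] by simp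

text \<open>A loop over the code of the list: register 0 holds the parameter \<open>z\<close>, the
  accumulator and the unread rest. The premise \<open>size\<close>, at every prefix, excludes
  exponential growth of the accumulator.\<close>

lemma ptime_foldl:
  fixes f :: "'z :: encodable \<Rightarrow> 'b :: encodable \<Rightarrow> 'x :: encodable \<Rightarrow> 'b"
  assumes step: "ptime (\<lambda>p. f (fst p) (fst (snd p)) (snd (snd p)))"
    and "ptime a" "ptime xs"
    and size: "\<And>z k. k \<le> length (xs z) \<Longrightarrow>
      vsize (code (foldl (f z) (a z) (take k (xs z)))) \<le> poly q (vsize (code z))"
  shows "ptime (\<lambda>z. foldl (f z) (a z) (xs z))"
proof -
  define st where "st = (\<lambda>(z, stk) k. Node (Node (code z)
    (Node (code (foldl (f z) (a z) (take k (xs z)))) (code (drop k (xs z))))) stk)"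
  define n where "n = (\<lambda>(z, stk :: val). length (xs z))"
  have "ptime (\<lambda>z. (z, a z, xs z))" using assms(2,3) by (intro ptime_intros)
  hence init: "transforms UNIV (\<lambda>(z, stk). Node (code z) stk) (\<lambda>i. st i 0)"
    unfolding ptime_def by (rule transforms_reindex) (auto simp: st_def)
  have loop: "transforms UNIV (\<lambda>i. st i 0) (\<lambda>i. st i (n i))"
  proof (rule transforms_while[of "Op1 Right (Op1 Right Top)"])
    show "poly_expr (Op1 Right (Op1 Right Top))" by (intro poly_expr_intros)
  next
    fix i k and s :: state assume "k \<le> n i" "s 0 = st i k"
    thus "value_of (Op1 Right (Op1 Right Top)) s \<noteq> Atom 0 \<longleftrightarrow> k < n i"
      by (cases "drop k (xs (fst i))") (auto simp: st_def n_def split: prod.splits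
          dest: arg_cong[of "drop _ _" _ length])
  next
    fix i k assume k: "k \<le> n i"
    obtain z stk where i: "i = (z, stk)" by fastforce
    have "vsize (code z) \<le> vsize (st i 0)" "vsize stk \<le> vsize (st i 0)"
      "vsize (code (xs z)) \<le> vsize (st i 0)"
      by (auto simp: st_def i)
    moreover have "vsize (code (foldl (f z) (a z) (take k (xs z)))) \<le> poly q (vsize (code z))"
      using size k by (simp add: n_def i)
    moreover have "vsize (code (drop k (xs z))) \<le> vsize (code (xs z))"
      by (rule vsize_drop)
    ultimately show "vsize (st i k) \<le> poly ([:3, 3:] + q) (vsize (st i 0))"
      using poly_nat_mono[of "vsize (code z)" "vsize (st i 0)" q] by (simp add: st_def i)
  next
    fix i show "n i \<le> vsize (st i 0)"
      using length_le_vsize[of "xs (fst i)"] by (auto simp: st_def n_def split: prod.splits)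
  next
    let ?A = "{(i, k). i \<in> UNIV \<and> k < n i}"
    \<comment> \<open>Within a round, the arguments of the step function lie on top, with
      \<open>z\<close> and the rest of the list saved below.\<close>
    let ?mid = "\<lambda>g. \<lambda>((z, stk), k). Node (g z k) (Node (Node (code z) (code (drop (Suc k) (xs z)))) stk)"
    let ?before = "\<lambda>z k. code (z, foldl (f z) (a z) (take k (xs z)), xs z ! k)"
    let ?after = "\<lambda>z k. code (foldl (f z) (a z) (take (Suc k) (xs z)))"
    have "transforms ?A (\<lambda>(i, k). st i k) (?mid ?before)"
    proof (rule transforms_expr[of "let z = Op1 Left Top; acc = Op1 Left (Op1 Right Top);
        ys = Op1 Right (Op1 Right Top) in Pair_expr (Pair_expr z (Pair_expr acc (Op1 Left ys)))
          (Pair_expr (Pair_expr z (Op1 Right ys)) Stack)"])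
    qed (auto simp: Let_def st_def n_def Cons_nth_drop_Suc[symmetric] intro!: poly_expr_intros)
    moreover have "transforms ?A (?mid ?before) (?mid ?after)"
      using step unfolding ptime_def
      by (rule transforms_reindex)
        (clarsimp simp: n_def take_Suc_conv_app_nth, intro exI conjI, (rule refl)+)
    moreover have "transforms ?A (?mid ?after) (\<lambda>(i, k). st i (Suc k))"
    proof (rule transforms_expr[of "let z = Op1 Left (Op1 Left Stack); ys = Op1 Right (Op1 Left Stack)
        in Pair_expr (Pair_expr z (Pair_expr Top ys)) (Op1 Right Stack)"])
    qed (auto simp: Let_def st_def intro!: poly_expr_intros)
    ultimately show "transforms ?A (\<lambda>(i, k). st i k) (\<lambda>(i, k). st i (Suc k))"
      by (blast intro: transforms_seq)
  qed
  have final: "transforms UNIV (\<lambda>i. st i (n i)) (\<lambda>(z, stk). Node (code (foldl (f z) (a z) (xs z))) stk)"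
    by (rule transforms_expr[of "Pair_expr (Op1 Left (Op1 Right Top)) Stack"])
      (auto simp: st_def n_def intro!: poly_expr_intros)
  show ?thesis
    unfolding ptime_def by (rule transforms_seq[OF transforms_seq[OF init loop] final])
qed

section \<open>List operations as folds with polynomially bounded accumulators\<close>

lemma vsize_code_append: "Suc (vsize (code (xs @ ys))) = vsize (code xs) + vsize (code ys)"
  by (induction xs) auto

lemma vsize_code_rev: "vsize (code (rev xs)) = vsize (code xs)"
  by (induction xs) (use vsize_code_append in \<open>auto simp: vsize_code_list\<close>)

lemma vsize_take: "vsize (code (take k xs)) \<le> vsize (code xs)"
  using vsize_append[of "rev (take k xs)" "rev (drop k xs)"]
  by (metis append_take_drop_id rev_append vsize_code_rev)

lemma vsize_concat: "vsize (code (concat xss)) \<le> vsize (code xss)"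
proof (induction xss)
  case (Cons xs xss)
  thus ?case using vsize_code_append[of xs "concat xss"] by simp
qed simp

lemma vsize_zip: "vsize (code (zip xs ys)) \<le> vsize (code xs) + vsize (code ys)"
proof (induction xs arbitrary: ys)
  case IH: (Cons x xs)
  show ?case
  proof (cases ys)
    case (Cons y ys')
    thus ?thesis using IH[of ys'] by simp
  qed simp
qed simp

lemma vsize_list_le:
  assumes "\<And>x. x \<in> set xs \<Longrightarrow> vsize (code x) \<le> B"
  shows "vsize (code xs) \<le> Suc (length xs * Suc B)"
  using assms by (induction xs) force+

lemma foldl_Cons_rev: "foldl (\<lambda>ys x. f x # ys) ys xs = rev (map f xs) @ ys"
  by (induction xs arbitrary: ys) auto

lemma foldl_Cons: "foldl (\<lambda>ys x. x # ys) ys xs = rev xs @ ys"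
  using foldl_Cons_rev[of id] by simp

lemma foldl_append_concat: "foldl (@) ys xss = ys @ concat xss"
  by (induction xss arbitrary: ys) auto

text \<open>Consumes the second list alongside the first, which makes \<open>zip\<close> a fold; the
  pairs are collected in reverse.\<close>

definition zip_step :: "('a \<times> 'b) list \<times> 'b list \<Rightarrow> 'a \<Rightarrow> ('a \<times> 'b) list \<times> 'b list" where
  "zip_step p x = (case snd p of [] \<Rightarrow> (fst p, []) | y # ys \<Rightarrow> ((x, y) # fst p, ys))"

lemma foldl_zip_step: "foldl zip_step (out, ys) xs = (rev (zip xs ys) @ out, drop (length xs) ys)"
  by (induction xs arbitrary: out ys) (auto simp: zip_step_def split: list.splits)

text \<open>A maximum that is generic in the comparison, since it serves lexicographic pairs as well
  as scored contracts. The result is one of the given elements, which bounds its size.\<close>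

definition pick :: "('a \<Rightarrow> 'a \<Rightarrow> bool) \<Rightarrow> 'a \<Rightarrow> 'a list \<Rightarrow> 'a" where
  "pick lt a xs = foldl (\<lambda>a x. if lt a x then x else a) a xs"

lemma pick_in: "pick lt a xs \<in> insert a (set xs)"
proof (induction xs arbitrary: a)
  case (Cons x xs)
  show ?case using Cons[of "if lt a x then x else a"] by (auto simp: pick_def)
qed (simp add: pick_def)

lemma ptime_rev [ptime_intros]:
  assumes "ptime f"
  shows "ptime (\<lambda>z. rev (f z))"
proof (rule ptime_comp[OF assms])
  have "ptime (\<lambda>xs :: 'b list. foldl (\<lambda>ys x. x # ys) [] xs)"
  proof (rule ptime_foldl[where q = "[:0, 1:]"])
    fix xs :: "'b list" and k
    show "vsize (code (foldl (\<lambda>ys x. x # ys) [] (take k xs))) \<le> poly [:0, 1:] (vsize (code xs))"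
      by (simp add: foldl_Cons vsize_code_rev vsize_take)
  qed (intro ptime_intros)+
  thus "ptime (rev :: 'b list \<Rightarrow> 'b list)"
    by (simp add: foldl_Cons)
qed

lemma ptime_append [ptime_intros]: "ptime f \<Longrightarrow> ptime g \<Longrightarrow> ptime (\<lambda>z. f z @ g z)"
proof (rule ptime_comp2[where F = "(@)"])
  have "ptime (\<lambda>p :: 'b list \<times> 'b list. foldl (\<lambda>ys x. x # ys) (snd p) (rev (fst p)))"
  proof (rule ptime_foldl[where q = "[:0, 2:]"])
    fix p :: "'b list \<times> 'b list" and k
    have "vsize (code (rev (take k (rev (fst p))))) \<le> vsize (code (fst p))"
      using vsize_take[of k "rev (fst p)"] by (simp only: vsize_code_rev)
    moreover have "foldl (\<lambda>ys x. x # ys) (snd p) (take k (rev (fst p))) =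
        rev (take k (rev (fst p))) @ snd p"
      by (rule foldl_Cons)
    ultimately show "vsize (code (foldl (\<lambda>ys x. x # ys) (snd p) (take k (rev (fst p)))))
        \<le> poly [:0, 2:] (vsize (code p))"
      using vsize_code_append[of "rev (take k (rev (fst p)))" "snd p"] by (simp add: code_prod_def)
  qed (intro ptime_intros)+
  thus "ptime (\<lambda>p :: 'b list \<times> 'b list. fst p @ snd p)"
    by (simp add: foldl_Cons)
qed

text \<open>The accumulator has no more entries than the size of the input, each polynomial in the
  input by \<open>ptime_vsize\<close>.\<close>

lemma ptime_map [ptime_intros]:
  fixes f :: "'z :: encodable \<Rightarrow> 'x :: encodable \<Rightarrow> 'y :: encodable"
  assumes f: "ptime (\<lambda>p. f (fst p) (snd p))" and "ptime h"
  shows "ptime (\<lambda>z. map (f z) (h z))"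
proof -
  obtain q where q: "\<And>p. vsize (code (f (fst p) (snd p))) \<le> poly q (vsize (code p))"
    using ptime_vsize[OF f] by blast
  have "ptime (\<lambda>p. rev (foldl (\<lambda>ys x. f (fst p) x # ys) [] (snd p)))"
  proof (rule ptime_rev, rule ptime_foldl[where q = "[:1, 1:] + [:0, 1:] * q"])
    have "ptime (\<lambda>p :: ('z \<times> 'x list) \<times> 'y list \<times> 'x. (fst (fst p), snd (snd p)))"
      by (intro ptime_intros)
    from ptime_comp[OF this f] show
      "ptime (\<lambda>p :: ('z \<times> 'x list) \<times> 'y list \<times> 'x. f (fst (fst p)) (snd (snd p)) # fst (snd p))"
      by (intro ptime_intros) simp
  next
    fix p :: "'z \<times> 'x list" and k assume "k \<le> length (snd p)"
    have sz: "vsize (code (snd p)) \<le> vsize (code p)" by (simp add: code_prod_def)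
    have "vsize (code (map (f (fst p)) (take k (snd p)))) \<le>
        Suc (length (take k (snd p)) * Suc (poly q (vsize (code p))))"
      unfolding length_map[of "f (fst p)", symmetric]
    proof (rule vsize_list_le)
      fix y assume "y \<in> set (map (f (fst p)) (take k (snd p)))"
      then obtain x where x: "x \<in> set (snd p)" "y = f (fst p) x" by (auto dest: in_set_takeD)
      have "vsize (code (fst p, x)) \<le> vsize (code p)"
        using vsize_member[OF x(1)] by (simp add: code_prod_def)
      from poly_nat_mono[OF this, of q] show "vsize (code y) \<le> poly q (vsize (code p))"
        using q[of "(fst p, x)"] x(2) by (simp only: fst_conv snd_conv)
    qed
    also have "\<dots> \<le> Suc (vsize (code p) * Suc (poly q (vsize (code p))))"
      using length_le_vsize[of "snd p"] sz by (intro Suc_le_mono[THEN iffD2] mult_right_mono) auto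
    finally show "vsize (code (foldl (\<lambda>ys x. f (fst p) x # ys) [] (take k (snd p)))) \<le>
        poly ([:1, 1:] + [:0, 1:] * q) (vsize (code p))"
      unfolding foldl_Cons_rev by (simp add: vsize_code_rev)
  qed (intro ptime_intros)+
  hence "ptime (\<lambda>p. map (f (fst p)) (snd p))"
    unfolding foldl_Cons_rev by simp
  thus ?thesis using ptime_id assms(2) by (rule ptime_comp2)
qed

lemma ptime_concat [ptime_intros]:
  assumes "ptime f"
  shows "ptime (\<lambda>z. concat (f z))"
proof (rule ptime_comp[OF assms])
  have "ptime (\<lambda>xss :: 'b list list. foldl (@) [] xss)"
  proof (rule ptime_foldl[where q = "[:0, 1:]"])
    fix xss :: "'b list list" and k
    show "vsize (code (foldl (@) [] (take k xss))) \<le> poly [:0, 1:] (vsize (code xss))"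
      using vsize_concat[of "take k xss"] vsize_take[of k xss] by (simp add: foldl_append_concat)
  qed (intro ptime_intros)+
  thus "ptime (concat :: 'b list list \<Rightarrow> 'b list)"
    by (simp add: foldl_append_concat ptime_def)
qed

lemma ptime_filter [ptime_intros]:
  assumes "ptime (\<lambda>p. P (fst p) (snd p))" "ptime h"
  shows "ptime (\<lambda>z. filter (P z) (h z))"
proof -
  have "ptime (\<lambda>z. concat (map (\<lambda>x. if P z x then [x] else []) (h z)))"
    using assms by (intro ptime_intros)
  moreover have "concat (map (\<lambda>x. if P x then [x] else []) xs) = filter P xs"
    for P :: "'b \<Rightarrow> bool" and xs by (induction xs) auto
  ultimately show ?thesis by simp
qed

lemma ptime_zip [ptime_intros]: "ptime f \<Longrightarrow> ptime g \<Longrightarrow> ptime (\<lambda>z. zip (f z) (g z))"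
proof (rule ptime_comp2[where F = zip])
  have "ptime (\<lambda>p :: 'b list \<times> 'c list. rev (fst (foldl zip_step ([], snd p) (fst p))))"
  proof (intro ptime_rev ptime_fst, rule ptime_foldl[where q = "[:1, 3:]"])
    fix p :: "'b list \<times> 'c list" and k
    show "vsize (code (foldl zip_step ([], snd p) (take k (fst p)))) \<le> poly [:1, 3:] (vsize (code p))"
      using vsize_zip[of "take k (fst p)" "snd p"] vsize_take[of k "fst p"]
        vsize_drop[of "length (take k (fst p))" "snd p"]
      unfolding foldl_zip_step by (simp add: vsize_code_rev code_prod_def[of p])
  qed ((unfold zip_step_def)?, intro ptime_intros)+
  thus "ptime (\<lambda>p :: 'b list \<times> 'c list. zip (fst p) (snd p))"
    by (simp add: foldl_zip_step)
qed

lemma ptime_pick [ptime_intros]: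
  assumes lt: "ptime (\<lambda>p. lt (fst p) (snd p))" and "ptime f" "ptime g"
  shows "ptime (\<lambda>z. pick lt (f z) (g z))"

proof (rule ptime_comp2[where F = "pick lt", OF _ assms(2,3)])
  show "ptime (\<lambda>p. pick lt (fst p) (snd p))"
    unfolding pick_def
  proof (rule ptime_foldl[where q = "[:0, 1:]"])
    have "ptime (\<lambda>p. (fst (snd p), snd (snd p)))" by (intro ptime_intros)
    from ptime_comp[OF this lt]
    show "ptime (\<lambda>p. if lt (fst (snd p)) (snd (snd p)) then snd (snd p) else fst (snd p))"
      by (intro ptime_intros) simp
  next
    fix p k
    have "foldl (\<lambda>a x. if lt a x then x else a) (fst p) (take k (snd p)) \<in>
        insert (fst p) (set (snd p))"
      using pick_in[of lt "fst p" "take k (snd p)"] by (auto simp: pick_def dest: in_set_takeD)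
    thus "vsize (code (foldl (\<lambda>a x. if lt a x then x else a) (fst p) (take k (snd p)))) \<le>
        poly [:0, 1:] (vsize (code p))"
      using vsize_member[of _ "snd p"] by (auto simp: code_prod_def intro: le_SucI trans_le_add2)
  qed (intro ptime_intros)+
qed

lemma ptime_int_eq [ptime_intros]:
  assumes "ptime f" "ptime g"
  shows "ptime (\<lambda>x. f x = (g x :: int))"
proof -
  have "ptime (\<lambda>x. \<not> f x < g x \<and> \<not> g x < f x)" using assms by (intro ptime_intros)
  moreover have "(\<lambda>x. \<not> f x < g x \<and> \<not> g x < f x) = (\<lambda>x. f x = g x)" by force
  ultimately show ?thesis by (simp only:)
qed

section \<open>Exact arithmetic on unreduced fractions\<close>

section \<open>Rational arithmetic\<close>

typedef frac = "{(a :: int, b :: int). 0 < b}"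
  by (rule exI[of _ "(0, 1)"]) simp

setup_lifting type_definition_frac

lemma denominator_pos: "0 < snd (Rep_frac x)"
  using Rep_frac[of x] by auto

instantiation frac :: encodable
begin
definition code_frac :: "frac \<Rightarrow> val" where "code_frac x = code (Rep_frac x)"
instance ..
end

lemma ptime_Rep_frac [ptime_intros]: "ptime f \<Longrightarrow> ptime (\<lambda>z. Rep_frac (f z))"
  by (simp add: ptime_def code_frac_def)

lemma ptime_frac: "ptime (\<lambda>z. Rep_frac (f z)) \<Longrightarrow> ptime f"
  by (simp add: ptime_def code_frac_def)

definition rv :: "frac \<Rightarrow> real" where
  "rv x = of_int (fst (Rep_frac x)) / of_int (snd (Rep_frac x))"

lift_definition fint :: "int \<Rightarrow> frac" is "\<lambda>a. (a, 1)" by simp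

lift_definition fadd :: "frac \<Rightarrow> frac \<Rightarrow> frac" is
  "\<lambda>x y. (fst x * snd y + fst y * snd x, snd x * snd y)" by auto

lift_definition fsub :: "frac \<Rightarrow> frac \<Rightarrow> frac" is
  "\<lambda>x y. (fst x * snd y - fst y * snd x, snd x * snd y)" by auto

lift_definition fmul :: "frac \<Rightarrow> frac \<Rightarrow> frac" is
  "\<lambda>x y. (fst x * fst y, snd x * snd y)" by auto

text \<open>Expanding by the numerator of \<open>y\<close> squares it in the denominator, which
  stays positive for either sign of \<open>y\<close>. Division by zero gives 0, as it does on the
  reals.\<close>

lift_definition fdiv :: "frac \<Rightarrow> frac \<Rightarrow> frac" is
  "\<lambda>x y. if fst y = 0 then (0, 1) else (fst x * snd y * fst y, snd x * (fst y * fst y))"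
  by (auto simp: zero_less_mult_iff)

definition fless :: "frac \<Rightarrow> frac \<Rightarrow> bool" where
  "fless x y \<longleftrightarrow> fst (Rep_frac x) * snd (Rep_frac y) < fst (Rep_frac y) * snd (Rep_frac x)"

lemma rv_fint [simp]: "rv (fint a) = of_int a"
  by (simp add: rv_def fint.rep_eq)

lemma rv_fadd [simp]: "rv (fadd x y) = rv x + rv y"
  using denominator_pos[of x] denominator_pos[of y]
  by (simp add: rv_def fadd.rep_eq field_simps)

lemma rv_fsub [simp]: "rv (fsub x y) = rv x - rv y"
  using denominator_pos[of x] denominator_pos[of y]
  by (simp add: rv_def fsub.rep_eq field_simps)

lemma rv_fmul [simp]: "rv (fmul x y) = rv x * rv y"
  by (simp add: rv_def fmul.rep_eq)

lemma rv_fdiv [simp]: "rv (fdiv x y) = rv x / rv y"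
  using denominator_pos[of x] denominator_pos[of y]
  by (simp add: rv_def fdiv.rep_eq field_simps)

lemma fless_iff [simp]: "fless x y \<longleftrightarrow> rv x < rv y"
proof -
  have "rv x < rv y \<longleftrightarrow> real_of_int (fst (Rep_frac x) * snd (Rep_frac y)) <
      real_of_int (fst (Rep_frac y) * snd (Rep_frac x))"
    using denominator_pos[of x] denominator_pos[of y] by (simp add: rv_def field_simps)
  thus ?thesis unfolding fless_def of_int_less_iff by simp
qed

lemma ptime_fadd [ptime_intros]: "ptime f \<Longrightarrow> ptime g \<Longrightarrow> ptime (\<lambda>z. fadd (f z) (g z))"
  by (rule ptime_frac, unfold fadd.rep_eq) (intro ptime_intros)

lemma ptime_fsub [ptime_intros]: "ptime f \<Longrightarrow> ptime g \<Longrightarrow> ptime (\<lambda>z. fsub (f z) (g z))"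
  by (rule ptime_frac, unfold fsub.rep_eq) (intro ptime_intros)

lemma ptime_fmul [ptime_intros]: "ptime f \<Longrightarrow> ptime g \<Longrightarrow> ptime (\<lambda>z. fmul (f z) (g z))"
  by (rule ptime_frac, unfold fmul.rep_eq) (intro ptime_intros)

lemma ptime_fdiv [ptime_intros]: "ptime f \<Longrightarrow> ptime g \<Longrightarrow> ptime (\<lambda>z. fdiv (f z) (g z))"
  by (rule ptime_frac, unfold fdiv.rep_eq) (intro ptime_intros)

lemma ptime_fless [ptime_intros]: "ptime f \<Longrightarrow> ptime g \<Longrightarrow> ptime (\<lambda>z. fless (f z) (g z))"
  unfolding fless_def by (intro ptime_intros)

text \<open>
  Fractions are never reduced, but sums and products of lists stay short because the bit lengths
  of numerator and denominator add up.
\<close>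

definition frac_bits :: "frac \<Rightarrow> nat" where
  "frac_bits x = max (bits (fst (Rep_frac x))) (bits (snd (Rep_frac x)))"

lemma vsize_frac: "vsize (code x) \<le> 3 + 2 * frac_bits x"
  by (simp add: code_frac_def code_prod_def code_int_def frac_bits_def bits_def)

lemma frac_bits_le: "frac_bits x \<le> vsize (code x)"
  by (simp add: code_frac_def code_prod_def code_int_def frac_bits_def bits_def)

lemma frac_bits_fadd: "frac_bits (fadd x y) \<le> Suc (frac_bits x + frac_bits y)"
proof -
  obtain a b c d where xy: "Rep_frac x = (a, b)" "Rep_frac y = (c, d)" by (meson surj_pair)
  show ?thesis
    using bits_add[of "a * d" "c * b"] bits_mult[of a d] bits_mult[of c b] bits_mult[of b d]
    by (simp add: frac_bits_def fadd.rep_eq xy) linarith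
qed

lemma frac_bits_fmul: "frac_bits (fmul x y) \<le> Suc (frac_bits x + frac_bits y)"
proof -
  obtain a b c d where xy: "Rep_frac x = (a, b)" "Rep_frac y = (c, d)" by (meson surj_pair)
  show ?thesis
    using bits_mult[of a c] bits_mult[of b d] by (simp add: frac_bits_def fmul.rep_eq xy) linarith
qed

lemma frac_bits_fint_1: "frac_bits (fint 1) = 1" and frac_bits_fint_0: "frac_bits (fint 0) = 1"
  by (auto simp: frac_bits_def fint.rep_eq bits_def bitlen_alt_def)

text \<open>The \<open>Suc\<close> of each operation is absorbed by the list node of the element
  that is combined.\<close>

lemma vsize_foldl_frac:
  assumes "\<And>x y. frac_bits (op x y) \<le> Suc (frac_bits x + frac_bits y)"
  shows "vsize (code (foldl op a xs)) \<le> 3 + 2 * (frac_bits a + vsize (code xs))"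
proof -
  have "frac_bits (foldl op a xs) \<le> frac_bits a + vsize (code xs)"
  proof (induction xs arbitrary: a)
    case (Cons x xs)
    show ?case using Cons[of "op a x"] assms[of a x] frac_bits_le[of x] by simp
  qed simp
  thus ?thesis using vsize_frac[of "foldl op a xs"] by simp
qed

definition frac_sum :: "frac list \<Rightarrow> frac" where
  "frac_sum xs = foldl fadd (fint 0) xs"

definition frac_prod :: "frac list \<Rightarrow> frac" where
  "frac_prod xs = foldl fmul (fint 1) xs"

lemma rv_frac_sum [simp]: "rv (frac_sum xs) = (\<Sum>x\<leftarrow>xs. rv x)"
proof -
  have "rv (foldl fadd a xs) = rv a + (\<Sum>x\<leftarrow>xs. rv x)" for a
    by (induction xs arbitrary: a) auto
  thus ?thesis by (simp add: frac_sum_def)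
qed

lemma rv_frac_prod [simp]: "rv (frac_prod xs) = (\<Prod>x\<leftarrow>xs. rv x)"
proof -
  have "rv (foldl fmul a xs) = rv a * (\<Prod>x\<leftarrow>xs. rv x)" for a
    by (induction xs arbitrary: a) auto
  thus ?thesis by (simp add: frac_prod_def)
qed

lemma ptime_frac_sum [ptime_intros]:
  assumes "ptime f"
  shows "ptime (\<lambda>z. frac_sum (f z))"
  unfolding frac_sum_def
proof (rule ptime_comp[OF assms], rule ptime_foldl[where q = "[:5, 2:]"])
  fix xs k
  show "vsize (code (foldl fadd (fint 0) (take k xs))) \<le> poly [:5, 2:] (vsize (code xs))"
    using vsize_foldl_frac[of fadd "fint 0" "take k xs"] frac_bits_fadd vsize_take[of k xs]
    by (simp add: frac_bits_fint_0)
qed (intro ptime_intros)+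

lemma ptime_frac_prod [ptime_intros]:
  assumes "ptime f"
  shows "ptime (\<lambda>z. frac_prod (f z))"
  unfolding frac_prod_def
proof (rule ptime_comp[OF assms], rule ptime_foldl[where q = "[:5, 2:]"])
  fix xs k
  show "vsize (code (foldl fmul (fint 1) (take k xs))) \<le> poly [:5, 2:] (vsize (code xs))"
    using vsize_foldl_frac[of fmul "fint 1" "take k xs"] frac_bits_fmul vsize_take[of k xs]
    by (simp add: frac_bits_fint_1)
qed (intro ptime_intros)+

section \<open>Enumeration of vertices, and exact evaluation of the principal's value at
  each\<close>

section \<open>The algorithm\<close>

text \<open>An affine function is the list of its coefficients with the constant term last; the
  appended 1 multiplies the constant.\<close>

definition fev :: "frac list \<Rightarrow> frac list \<Rightarrow> frac" where
  "fev f t = frac_sum (map (\<lambda>p. fmul (fst p) (snd p)) (zip f (t @ [fint 1])))"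

definition fnonzero :: "frac \<Rightarrow> bool" where
  "fnonzero a \<longleftrightarrow> fless a (fint 0) \<or> fless (fint 0) a"

text \<open>Substitutes the solution \<open>- as / a\<close> of the equation \<open>a # as\<close>
  for the leading variable of \<open>b # bs\<close>, which leaves
  \<open>bs - (b / a) * as\<close>.\<close>

definition elim :: "frac \<Rightarrow> frac list \<Rightarrow> frac list \<Rightarrow> frac list" where
  "elim a as g = (case g of [] \<Rightarrow> []
     | b # bs \<Rightarrow> map (\<lambda>p. fsub (snd p) (fmul (fdiv b a) (fst p))) (zip as bs))"

text \<open>
  Every candidate arises by solving, for one variable after the other, one of the equations
  \<open>f = 0\<close> for that variable and substituting the result into the others.  The recursion depth is
  the number of variables, so the running time is polynomial only because that number is fixed.
\<close>

primrec cand :: "nat \<Rightarrow> frac list list \<Rightarrow> frac list list" where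
  "cand 0 F = [[]]"
| "cand (Suc k) F = concat (map (\<lambda>f. case f of [] \<Rightarrow> [] | a # as \<Rightarrow>
     if fnonzero a
     then map (\<lambda>t. fdiv (fsub (fint 0) (fev as t)) a # t) (cand k (map (elim a as) F))
     else []) F)"

text \<open>The last of the \<open>Suc m\<close> entries is the constant term 0.\<close>

definition coords :: "nat \<Rightarrow> frac list list" where
  "coords m = map (\<lambda>k. map (\<lambda>j. fint (if j = k then 1 else 0)) [0..<Suc m]) [0..<m]"

text \<open>Sets of outcomes as 0/1 vectors.\<close>

definition masks :: "nat \<Rightarrow> frac list list" where
  "masks m = List.n_lists m [fint 0, fint 1]"

text \<open>The cost and the outcome probabilities of an action.\<close>

type_synonym box = "frac \<times> frac list"

definition masked :: "frac list \<Rightarrow> frac list \<Rightarrow> frac list" where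
  "masked e p = map (\<lambda>q. fmul (fst q) (snd q)) (zip e p)"

text \<open>
  The index \<open>z\<close> of a box with cost \<open>c\<close> solves \<open>E (max 0 (t X - z)) = c\<close>.  As \<open>max 0\<close> selects
  the best set of outcomes, \<open>z\<close> is the maximum of \<open>(E (t X; X \<in> S) - c) / P (X \<in> S)\<close> over all sets
  \<open>S\<close> of outcomes of positive probability; \<open>zfun\<close> is this affine function of \<open>t\<close>.
\<close>

definition zfun :: "frac \<Rightarrow> frac list \<Rightarrow> frac list" where
  "zfun c w = map (\<lambda>x. fdiv x (frac_sum w)) w @ [fsub (fint 0) (fdiv c (frac_sum w))]"

definition zfuns :: "nat \<Rightarrow> box \<Rightarrow> frac list list" where
  "zfuns m b = map (zfun (fst b))
     (filter (\<lambda>w. fless (fint 0) (frac_sum w)) (map (\<lambda>e. masked e (snd b)) (masks m)))"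

text \<open>
  The zero outcome is revealed from the start, as if by a free box that always contains it.
\<close>

definition zero_box :: "nat \<Rightarrow> box" where
  "zero_box m = (fint 0, map (\<lambda>j. fint (if j = 0 then 1 else 0)) [0..<m])"

definition lfuns :: "nat \<Rightarrow> box list \<Rightarrow> frac list list" where
  "lfuns m bs = coords m @ concat (map (zfuns m) bs)"

definition vsub :: "frac list \<Rightarrow> frac list \<Rightarrow> frac list" where
  "vsub f g = map (\<lambda>p. fsub (fst p) (snd p)) (zip f g)"

text \<open>A function minus itself also occurs; this is the zero function, on which
  \<open>cand\<close> never pivots.\<close>

definition walls :: "nat \<Rightarrow> box list \<Rightarrow> frac list list" where
  "walls m bs = coords m @ concat (map (\<lambda>f. map (vsub f) (lfuns m bs)) (lfuns m bs))"

type_synonym lex = "frac \<times> frac"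

definition lex_less :: "lex \<Rightarrow> lex \<Rightarrow> bool" where
  "lex_less u v \<longleftrightarrow> fless (fst u) (fst v) \<or> (\<not> fless (fst v) (fst u) \<and> fless (snd u) (snd v))"

text \<open>
  For small \<open>s > 0\<close>, affine functions compare at \<open>t + s (r - t)\<close> as the pairs of their values at
  \<open>t\<close> and at \<open>r\<close> compare lexicographically.
\<close>

definition lval :: "frac list \<Rightarrow> frac list \<Rightarrow> frac list \<Rightarrow> lex" where
  "lval t r f = (fev f t, fev f r)"

definition index :: "nat \<Rightarrow> frac list \<Rightarrow> frac list \<Rightarrow> box \<Rightarrow> lex" where
  "index m t r b = (case map (lval t r) (zfuns m b) of [] \<Rightarrow> (fint 0, fint 0)
     | v # vs \<Rightarrow> pick lex_less v vs)"

text \<open>The law of the capped payment \<open>min (t X) z\<close> of a box, as a list of values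
  and probabilities in which a value may be repeated.\<close>

definition atoms :: "nat \<Rightarrow> frac list \<Rightarrow> frac list \<Rightarrow> box \<Rightarrow> (lex \<times> frac) list" where
  "atoms m t r b = map (\<lambda>q. (if lex_less (fst q) (index m t r b) then fst q else index m t r b, snd q))
     (zip (zip t r) (snd b))"

definition mass :: "(lex \<times> frac) list \<Rightarrow> frac" where
  "mass A = frac_sum (map snd A)"

text \<open>
  The difference of the two products is the probability that the maximum of the capped values
  is \<open>u\<close>.  It is divided by the number of occurrences of \<open>u\<close>, since \<open>score\<close> sums over all of them.
\<close>

definition weight :: "(lex \<times> frac) list list \<Rightarrow> lex \<Rightarrow> frac" where
  "weight AA u = fdiv
     (fsub (frac_prod (map (\<lambda>A. mass (filter (\<lambda>a. \<not> lex_less u (fst a)) A)) AA))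
           (frac_prod (map (\<lambda>A. mass (filter (\<lambda>a. lex_less (fst a) u) A)) AA)))
     (frac_sum (map (\<lambda>a. fint 1)
       (filter (\<lambda>a. \<not> lex_less u (fst a) \<and> \<not> lex_less (fst a) u) (concat AA))))"

text \<open>On the way from \<open>t\<close> to the rewards, each value changes at the rate
  \<open>snd - fst\<close> while its probability initially stays fixed, so this sum is the
  derivative of the agent's value.\<close>

definition score :: "(lex \<times> frac) list list \<Rightarrow> frac" where
  "score AA = frac_sum (map (\<lambda>a. fmul (fsub (snd (fst a)) (fst (fst a))) (weight AA (fst a))) (concat AA))"

definition nonneg :: "frac list \<Rightarrow> bool" where
  "nonneg t \<longleftrightarrow> filter (\<lambda>x. fless x (fint 0)) t = []"

definition feasible :: "nat \<Rightarrow> box list \<Rightarrow> frac list list" where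
  "feasible m bs = filter nonneg (cand m (walls m bs))"

definition scored :: "nat \<Rightarrow> frac list \<Rightarrow> box list \<Rightarrow> (frac \<times> frac list) list" where
  "scored m r bs = map (\<lambda>t. (score (map (atoms m t r) bs), t)) (feasible m bs)"

definition best :: "(frac \<times> frac list) list \<Rightarrow> frac list" where
  "best xs = (case xs of [] \<Rightarrow> [] | v # vs \<Rightarrow> snd (pick (\<lambda>x y. fless (fst x) (fst y)) v vs))"

definition solve :: "nat \<Rightarrow> frac list \<times> frac list \<times> frac list list \<Rightarrow> frac list" where
  "solve m x = best (scored m (fst (snd x)) (zero_box m # zip (fst x) (snd (snd x))))"

subsection \<open>Running time\<close>

lemma ptime_comp3:
  assumes "ptime (\<lambda>p. F (fst p) (fst (snd p)) (snd (snd p)))" "ptime f" "ptime g" "ptime h"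
  shows "ptime (\<lambda>x. F (f x) (g x) (h x))"
  using ptime_comp[OF ptime_pair[OF assms(2) ptime_pair[OF assms(3,4)]] assms(1)] by simp

lemma ptime_fev [ptime_intros]: "ptime f \<Longrightarrow> ptime g \<Longrightarrow> ptime (\<lambda>z. fev (f z) (g z))"
  by (rule ptime_comp2[where F = fev]) (unfold fev_def, intro ptime_intros)

lemma ptime_fnonzero [ptime_intros]: "ptime f \<Longrightarrow> ptime (\<lambda>z. fnonzero (f z))"
  unfolding fnonzero_def by (intro ptime_intros)

lemma ptime_elim [ptime_intros]:
  "ptime f \<Longrightarrow> ptime g \<Longrightarrow> ptime h \<Longrightarrow> ptime (\<lambda>z. elim (f z) (g z) (h z))"
  by (rule ptime_comp3[where F = elim]) (unfold elim_def, intro ptime_intros)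

text \<open>There is one program for each \<open>k\<close>, and its polynomial depends on
  \<open>k\<close>.\<close>

lemma ptime_cand: "ptime (cand k)"
proof (induction k)
  case (Suc k)
  have [ptime_intros]: "ptime (\<lambda>z. cand k (f z))" if "ptime f" for f :: "'z :: encodable \<Rightarrow> _"
    using that Suc by (rule ptime_comp)
  show ?case unfolding cand.simps by (intro ptime_intros)
qed (simp add: ptime_const)

lemma ptime_vsub [ptime_intros]: "ptime f \<Longrightarrow> ptime g \<Longrightarrow> ptime (\<lambda>z. vsub (f z) (g z))"
  by (rule ptime_comp2[where F = vsub]) (unfold vsub_def, intro ptime_intros)

lemma ptime_masked [ptime_intros]: "ptime f \<Longrightarrow> ptime g \<Longrightarrow> ptime (\<lambda>z. masked (f z) (g z))"
  by (rule ptime_comp2[where F = masked]) (unfold masked_def, intro ptime_intros)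

lemma ptime_zfun [ptime_intros]: "ptime f \<Longrightarrow> ptime g \<Longrightarrow> ptime (\<lambda>z. zfun (f z) (g z))"
  by (rule ptime_comp2[where F = zfun]) (unfold zfun_def, intro ptime_intros)

lemma ptime_zfuns [ptime_intros]: "ptime f \<Longrightarrow> ptime (\<lambda>z. zfuns m (f z))"
  by (rule ptime_comp[where g = "zfuns m"], assumption) (unfold zfuns_def, intro ptime_intros)

lemma ptime_lfuns [ptime_intros]: "ptime f \<Longrightarrow> ptime (\<lambda>z. lfuns m (f z))"
  by (rule ptime_comp[where g = "lfuns m"], assumption) (unfold lfuns_def, intro ptime_intros)

lemma ptime_walls [ptime_intros]: "ptime f \<Longrightarrow> ptime (\<lambda>z. walls m (f z))"
  by (rule ptime_comp[where g = "walls m"], assumption) (unfold walls_def, intro ptime_intros)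

lemma ptime_lex_less [ptime_intros]: "ptime f \<Longrightarrow> ptime g \<Longrightarrow> ptime (\<lambda>z. lex_less (f z) (g z))"
  unfolding lex_less_def by (intro ptime_intros)

lemma ptime_index [ptime_intros]:
  "ptime f \<Longrightarrow> ptime g \<Longrightarrow> ptime h \<Longrightarrow> ptime (\<lambda>z. index m (f z) (g z) (h z))"
  by (rule ptime_comp3[where F = "index m"]) (unfold index_def lval_def, intro ptime_intros)

lemma ptime_atoms [ptime_intros]:
  "ptime f \<Longrightarrow> ptime g \<Longrightarrow> ptime h \<Longrightarrow> ptime (\<lambda>z. atoms m (f z) (g z) (h z))"
  by (rule ptime_comp3[where F = "atoms m"]) (unfold atoms_def, intro ptime_intros)

lemma ptime_mass [ptime_intros]: "ptime f \<Longrightarrow> ptime (\<lambda>z. mass (f z))"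
  by (rule ptime_comp[where g = mass], assumption) (unfold mass_def, intro ptime_intros)

lemma ptime_weight [ptime_intros]: "ptime f \<Longrightarrow> ptime g \<Longrightarrow> ptime (\<lambda>z. weight (f z) (g z))"
  by (rule ptime_comp2[where F = weight]) (unfold weight_def, intro ptime_intros)

lemma ptime_score [ptime_intros]: "ptime f \<Longrightarrow> ptime (\<lambda>z. score (f z))"
  by (rule ptime_comp[where g = score], assumption) (unfold score_def, intro ptime_intros)

lemma ptime_nonneg [ptime_intros]: "ptime f \<Longrightarrow> ptime (\<lambda>z. nonneg (f z))"
  by (rule ptime_comp[where g = nonneg], assumption) (unfold nonneg_def, intro ptime_intros)

lemma ptime_feasible [ptime_intros]: "ptime f \<Longrightarrow> ptime (\<lambda>z. feasible m (f z))"
  by (rule ptime_comp[where g = "feasible m"], assumption)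
    (unfold feasible_def, intro ptime_filter ptime_comp[OF _ ptime_cand] ptime_intros)

lemma ptime_scored [ptime_intros]: "ptime f \<Longrightarrow> ptime g \<Longrightarrow> ptime (\<lambda>z. scored m (f z) (g z))"
  by (rule ptime_comp2[where F = "scored m"]) (unfold scored_def, intro ptime_intros)

lemma ptime_best [ptime_intros]: "ptime f \<Longrightarrow> ptime (\<lambda>z. best (f z))"
  by (rule ptime_comp[where g = best], assumption) (unfold best_def, intro ptime_intros)

lemma ptime_solve: "ptime (solve m)"
  unfolding solve_def by (intro ptime_intros)

section \<open>Moving a bounded affine objective to a vertex of the closure of a cell\<close>

section \<open>Candidate points of an arrangement of hyperplanes\<close>

definition aff :: "real list \<Rightarrow> real list \<Rightarrow> real" where
  "aff f t = (\<Sum>p\<leftarrow>zip f (t @ [1]). fst p * snd p)"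

abbreviation rvs :: "frac list \<Rightarrow> real list" where "rvs \<equiv> map rv"

lemma aff_Cons [simp]: "aff (a # f) (x # t) = a * x + aff f t"
  by (simp add: aff_def)

lemma aff_Nil [simp]: "aff [a] [] = a"
  by (simp add: aff_def)

lemma rv_fev [simp]: "rv (fev f t) = aff (rvs f) (rvs t)"
proof -
  have "(\<Sum>p\<leftarrow>zip (map rv f) (map rv s). fst p * snd p) = (\<Sum>p\<leftarrow>zip f s. rv (fst p) * rv (snd p))" for s
    unfolding zip_map_map by (simp add: comp_def case_prod_unfold)
  from this[of "t @ [fint 1]"] show ?thesis by (simp add: fev_def aff_def comp_def)
qed

text \<open>\<open>b\<close> lies in the closure of the sign class of \<open>a\<close>. Required at
  two points for all hyperplanes, it says that the second point lies in the closure of the cell of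
  the first.\<close>

definition wpres :: "real \<Rightarrow> real \<Rightarrow> bool" where
  "wpres a b \<longleftrightarrow> (0 < a \<longrightarrow> 0 \<le> b) \<and> (a < 0 \<longrightarrow> b \<le> 0) \<and> (a = 0 \<longrightarrow> b = 0)"

lemma wpres_refl [simp]: "wpres a a"
  by (auto simp: wpres_def)

lemma wpres_trans: "wpres a b \<Longrightarrow> wpres b c \<Longrightarrow> wpres a c"
  unfolding wpres_def by (cases "b = 0") force+

text \<open>A pair \<open>(c, a)\<close> is the affine function \<open>c + a * s\<close> on a line,
  seen from \<open>s = 0\<close>. On the way towards negative \<open>s\<close>, the first root met
  is the greatest nonpositive one, and no function changes sign before it.\<close>

lemma line_stop:
  fixes S :: "(real \<times> real) set"
  assumes "finite S" "(c0, a0) \<in> S" "a0 \<noteq> 0" "- c0 / a0 \<le> 0"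
  shows "\<exists>s \<le> 0. (\<forall>(c, a) \<in> S. wpres c (c + a * s)) \<and> (\<exists>(c, a) \<in> S. a \<noteq> 0 \<and> c + a * s = 0)"
proof -
  define R where "R = (\<lambda>(c, a). - c / a) ` {(c, a) \<in> S. a \<noteq> 0 \<and> - c / a \<le> 0}"
  have fin: "finite R" unfolding R_def using assms(1) by (auto intro: finite_subset)
  have ne: "R \<noteq> {}" using assms by (auto simp: R_def)
  define s where "s = Max R"
  have "s \<in> R" unfolding s_def using fin ne by (rule Max_in)
  then obtain c1 a1 where 1: "(c1, a1) \<in> S" "a1 \<noteq> 0" "s = - c1 / a1" "s \<le> 0"
    by (auto simp: R_def)
  have "wpres c (c + a * s)" if "(c, a) \<in> S" for c a
  proof (cases "a = 0")
    case False
    \<comment> \<open>In terms of the root \<rho>, the values at 0 and at \<open>s\<close> are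
      \<open>a\<close> times \<open>0 - \<rho>\<close> and \<open>s - \<rho>\<close>, so only the
      position of \<rho> matters.\<close>
    define \<rho> where "\<rho> = - c / a"
    have c: "c = a * (0 - \<rho>)" "c + a * s = a * (s - \<rho>)"
      using False by (auto simp: \<rho>_def field_simps)
    show ?thesis
    proof (cases "\<rho> \<le> 0")
      case True
      hence "\<rho> \<in> R" using that False by (force simp: R_def \<rho>_def)
      hence "\<rho> \<le> s" unfolding s_def using fin by simp
      thus ?thesis unfolding c using 1(4) True
        by (auto simp: wpres_def zero_less_mult_iff mult_less_0_iff zero_le_mult_iff mult_le_0_iff)
    next
      case False
      thus ?thesis unfolding c using 1(4)
        by (auto simp: wpres_def zero_less_mult_iff mult_less_0_iff zero_le_mult_iff mult_le_0_iff)
    qed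
  qed simp
  moreover have "c1 + a1 * s = 0" using 1(2,3) by simp
  ultimately show ?thesis using 1 by blast
qed

definition relim :: "real \<Rightarrow> real list \<Rightarrow> real list \<Rightarrow> real list" where
  "relim a as g = map (\<lambda>p. snd p - hd g / a * fst p) (zip as (tl g))"

lemma rvs_elim: "g \<noteq> [] \<Longrightarrow> rvs (elim a as g) = relim (rv a) (rvs as) (rvs g)"
  by (cases g) (auto simp: elim_def relim_def zip_map_map)

lemma aff_relim:
  assumes "length as = Suc (length x)" "length g = Suc (Suc (length x))"
  shows "aff (relim a as g) x = aff g (- aff as x / a # x)"
proof -
  obtain b bs where g: "g = b # bs" "length bs = Suc (length x)"
    using assms(2) by (cases g) auto
  have "aff (map (\<lambda>p. snd p - c * fst p) (zip as bs)) x = aff bs x - c * aff as x" for c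
    using assms(1) g(2)
  proof (induction x arbitrary: as bs)
    case Nil
    thus ?case by (auto simp: length_Suc_conv)
  next
    case (Cons y x)
    then obtain a as' b bs' where *: "as = a # as'" "bs = b # bs'" by (metis length_Suc_conv)
    thus ?case using Cons.IH[of as' bs'] Cons.prems by (simp add: algebra_simps)
  qed
  from this[of "b / a"] show ?thesis by (simp add: relim_def g)
qed

lemma fnonzero_iff [simp]: "fnonzero a \<longleftrightarrow> rv a \<noteq> 0"
  by (auto simp: fnonzero_def)

text \<open>
  Move along the first coordinate in a direction in which \<open>g\<close> does not decrease until the first
  hyperplane is hit; nonnegativity or the upper bound on \<open>g\<close> guarantees that one is.  Then
  continue inside that hyperplane.
\<close>

lemma cand_improve:
  assumes "\<And>f. f \<in> set F \<Longrightarrow> length f = Suc k"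
    and "\<And>j. j < k \<Longrightarrow> \<exists>f \<in> set F. \<forall>x. length x = k \<longrightarrow> aff (rvs f) x = x ! j"
    and "length t = k" "\<And>x. x \<in> set t \<Longrightarrow> 0 \<le> x" "length g = Suc k"
    and "\<And>x. length x = k \<Longrightarrow> (\<And>f. f \<in> set F \<Longrightarrow> wpres (aff (rvs f) t) (aff (rvs f) x)) \<Longrightarrow> aff g x \<le> B"
  shows "\<exists>c \<in> set (cand k F). length c = k \<and>
    (\<forall>f \<in> set F. wpres (aff (rvs f) t) (aff (rvs f) (rvs c))) \<and> aff g t \<le> aff g (rvs c)"
  using assms
proof (induction k arbitrary: F t g)
  case (Suc k)
  obtain t0 ts where t: "t = t0 # ts" "length ts = k"
    using Suc.prems(3) by (cases t) auto
  obtain g0 gs where g: "g = g0 # gs" "length gs = Suc k"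
    using Suc.prems(5) by (cases g) auto
  have shift: "aff (rvs f) ((t0 + s) # ts) = aff (rvs f) t + rv (hd f) * s" if "f \<in> set F" for f s
    using Suc.prems(1)[OF that] by (cases f) (auto simp: t algebra_simps)
  define S where "S = (\<lambda>f. (aff (rvs f) t, rv (hd f))) ` set F"
  have "\<exists>s. (\<forall>(c, a) \<in> S. wpres c (c + a * s)) \<and> (\<exists>(c, a) \<in> S. a \<noteq> 0 \<and> c + a * s = 0) \<and> 0 \<le> g0 * s"
  proof (cases "g0 \<le> 0")
    case True
    \<comment> \<open>The coordinate function itself has the root \<open>- t0\<close>, which is not
      positive, so the downward walk is stopped.\<close>
    obtain f where f: "f \<in> set F" "\<And>x. length x = Suc k \<Longrightarrow> aff (rvs f) x = x ! 0"
      using Suc.prems(2)[of 0] by auto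
    have "aff (rvs f) (t0 # ts) = t0" "aff (rvs f) ((t0 + 1) # ts) = t0 + 1"
      by (simp_all only: f(2) t(2) list.size(4) nth_Cons_0 add.commute add_0 plus_1_eq_Suc)
    hence "aff (rvs f) t = t0" "rv (hd f) = 1"
      using shift[OF f(1), of 1] t(1) by simp_all
    hence "(t0, 1) \<in> S" using f(1) by (force simp: S_def)
    moreover have "0 \<le> t0" using Suc.prems(4) t by simp
    ultimately obtain s where "s \<le> 0" "\<forall>(c, a) \<in> S. wpres c (c + a * s)"
      "\<exists>(c, a) \<in> S. a \<noteq> 0 \<and> c + a * s = 0"
      using line_stop[of S t0 1] by (auto simp: S_def)
    thus ?thesis using True by (intro exI[of _ s]) (simp add: mult_nonpos_nonpos)
  next
    case False
    have "\<exists>(c, a) \<in> S. a \<noteq> 0 \<and> 0 \<le> - c / a"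
    \<comment> \<open>Without a root ahead, the whole upward ray stays in the closure of the cell,
      and \<open>g\<close> would exceed its bound \<open>B\<close> there.\<close>
    proof (rule ccontr)
      assume none: "\<not> ?thesis"
      have free: "wpres c (c + a * s)" if "0 \<le> s" "(c, a) \<in> S" for s c a
      proof (cases "a = 0")
        case False
        hence "- c / a < 0" using none that(2) by force
        hence "0 < c / a" by simp
        thus ?thesis using that(1) False
          by (cases "0 < a") (auto simp: wpres_def zero_less_divide_iff add_pos_nonneg
              intro!: add_nonpos_nonpos mult_nonpos_nonneg)
      qed simp
      have le: "aff g ((t0 + s) # ts) \<le> B" if "0 \<le> s" for s
        using free[OF that] shift t by (intro Suc.prems(6)) (auto simp: S_def)
      have "aff g ((t0 + s) # ts) = aff g t + g0 * s" for s
        by (simp add: g t algebra_simps)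
      hence "aff g t + g0 * s \<le> B" if "0 \<le> s" for s
        using le[OF that] by simp
      \<comment> \<open>The second choice of \<open>s\<close> makes the value equal to
        \<open>B + 1\<close>; the first shows that this \<open>s\<close> is nonnegative.\<close>
      from this[of 0] this[of "(B - aff g t + 1) / g0"] show False
        using False by (simp add: field_simps)
    qed
    then obtain c a where ca: "(c, a) \<in> S" "a \<noteq> 0" "0 \<le> - c / a" by blast
    \<comment> \<open>\<open>line_stop\<close> walks downwards, so all slopes are negated for the
      upward walk.\<close>
    have "\<exists>s \<le> 0. (\<forall>(c, a) \<in> (\<lambda>(c, a). (c, - a)) ` S. wpres c (c + a * s)) \<and>
        (\<exists>(c, a) \<in> (\<lambda>(c, a). (c, - a)) ` S. a \<noteq> 0 \<and> c + a * s = 0)"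
      using ca by (intro line_stop[of _ c "- a"]) (auto simp: S_def)
    then obtain s where "s \<le> 0" "\<forall>(c, a) \<in> S. wpres c (c + a * (- s))"
      "\<exists>(c, a) \<in> S. a \<noteq> 0 \<and> c + a * (- s) = 0"
      by (auto simp: case_prod_unfold)
    thus ?thesis using False by (intro exI[of _ "- s"]) (auto simp: mult_nonneg_nonpos)
  qed
  then obtain s where s: "\<And>f. f \<in> set F \<Longrightarrow> wpres (aff (rvs f) t) (aff (rvs f) ((t0 + s) # ts))"
    "\<exists>f \<in> set F. rv (hd f) \<noteq> 0 \<and> aff (rvs f) ((t0 + s) # ts) = 0" "0 \<le> g0 * s"
    using shift by (auto simp: S_def)
  then obtain f where f: "f \<in> set F" "rv (hd f) \<noteq> 0" "aff (rvs f) ((t0 + s) # ts) = 0" by blast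
  obtain a as where fa: "f = a # as" "length as = Suc k"
    using Suc.prems(1)[OF f(1)] by (cases f) auto
  have a: "rv a \<noteq> 0" using f(2) fa by simp
  \<comment> \<open>Inside the hyperplane of \<open>f\<close>, the other coordinates determine the
    first one.\<close>
  define u where "u x = - aff (rvs as) x / rv a" for x
  have u: "u ts = t0 + s" using f(3) a by (simp add: u_def fa field_simps)
  have el: "aff (rvs (elim a as h)) x = aff (rvs h) (u x # x)" if "h \<in> set F" "length x = k" for h x
  proof -
    have "length h = Suc (Suc k)" using Suc.prems(1) that(1) by blast
    hence "h \<noteq> []" by auto
    thus ?thesis using that \<open>length h = _\<close> fa
      by (simp add: rvs_elim u_def aff_relim)
  qed
  define g' where "g' = relim (rv a) (rvs as) g"
  have g': "aff g' x = aff g (u x # x)" if "length x = k" for x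
    unfolding g'_def u_def using that fa g by (intro aff_relim) auto
  have "\<exists>c \<in> set (cand k (map (elim a as) F)). length c = k \<and>
     (\<forall>f \<in> set (map (elim a as) F). wpres (aff (rvs f) ts) (aff (rvs f) (rvs c))) \<and> aff g' ts \<le> aff g' (rvs c)"
  proof (rule Suc.IH)
    fix h assume "h \<in> set (map (elim a as) F)"
    then obtain h' where h': "h' \<in> set F" "h = elim a as h'" by auto
    have "length h' = Suc (Suc k)" using Suc.prems(1) h'(1) .
    thus "length h = Suc k" using fa(2) by (cases h') (auto simp: h'(2) elim_def)
  next
    fix j assume "j < k"
    then obtain h where "h \<in> set F" "\<And>x. length x = Suc k \<Longrightarrow> aff (rvs h) x = x ! Suc j"
      using Suc.prems(2)[of "Suc j"] by auto
    thus "\<exists>f \<in> set (map (elim a as) F). \<forall>x. length x = k \<longrightarrow> aff (rvs f) x = x ! j"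
      using el by (intro bexI[of _ "elim a as h"]) auto
  next
    show "length g' = Suc k" using fa g by (simp add: g'_def relim_def)
  next
    fix x assume x: "length x = k"
      "\<And>f. f \<in> set (map (elim a as) F) \<Longrightarrow> wpres (aff (rvs f) ts) (aff (rvs f) x)"
    have "aff g (u x # x) \<le> B"
    proof (rule Suc.prems(6))
      fix h assume h: "h \<in> set F"
      have "wpres (aff (rvs h) ((t0 + s) # ts)) (aff (rvs h) (u x # x))"
        using x(2)[of "elim a as h"] el[OF h, of ts] el[OF h x(1)] h u t by simp
      thus "wpres (aff (rvs h) t) (aff (rvs h) (u x # x))"
        using s(1)[OF h] wpres_trans by blast
    qed (use x in simp)
    thus "aff g' x \<le> B" using g' x(1) by simp
  qed (use t Suc.prems(4) in auto)
  then obtain c where c: "c \<in> set (cand k (map (elim a as) F))" "length c = k"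
    "\<And>f. f \<in> set F \<Longrightarrow> wpres (aff (rvs (elim a as f)) ts) (aff (rvs (elim a as f)) (rvs c))"
    "aff g' ts \<le> aff g' (rvs c)"
    by auto
  define c' where "c' = fdiv (fsub (fint 0) (fev as c)) a # c"
  have c': "rvs c' = u (rvs c) # rvs c" by (simp add: c'_def u_def)
  have "c' \<in> set (cand (Suc k) F)"
    using f(1) fa c(1) a by (auto simp: c'_def intro!: bexI[of _ f])
  moreover have "length c' = Suc k" using c(2) by (simp add: c'_def)
  moreover have "wpres (aff (rvs h) t) (aff (rvs h) (rvs c'))" if h: "h \<in> set F" for h
    using wpres_trans[OF s(1)[OF h]] c(3)[OF h] el[OF h, of ts] el[OF h, of "rvs c"] c(2) u t c'
    by simp
  moreover have "aff g t \<le> aff g (rvs c')"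
  proof -
    have "aff g t \<le> aff g ((t0 + s) # ts)" using s(3) by (simp add: t g algebra_simps)
    also have "\<dots> \<le> aff g (rvs c')" using c(2,4) g' u t c' by simp
    finally show ?thesis .
  qed
  ultimately show ?case by blast
qed (simp add: wpres_def)

section \<open>Optimal search with costly inspection\<close>

section \<open>Weitzman's index rule\<close>

lemma expectation_cong:
  fixes f g :: "'a \<Rightarrow> real"
  assumes "\<And>x. x \<in> set_pmf M \<Longrightarrow> f x = g x"
  shows "measure_pmf.expectation M f = measure_pmf.expectation M g"
  using assms by (intro integral_cong_AE) (auto simp: AE_measure_pmf_iff)

lemma expectation_mono:
  fixes f g :: "'a \<Rightarrow> real"
  assumes "finite (set_pmf M)" "\<And>x. x \<in> set_pmf M \<Longrightarrow> f x \<le> g x"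
  shows "measure_pmf.expectation M f \<le> measure_pmf.expectation M g"
  using assms by (intro integral_mono_AE integrable_measure_pmf_finite) (auto simp: AE_measure_pmf_iff)

lemma expectation_add:
  fixes f g :: "'a \<Rightarrow> real"
  assumes "finite (set_pmf M)"
  shows "measure_pmf.expectation M (\<lambda>x. f x + g x) =
    measure_pmf.expectation M f + measure_pmf.expectation M g"
  using assms by (intro Bochner_Integration.integral_add integrable_measure_pmf_finite)

lemma expectation_diff:
  fixes f g :: "'a \<Rightarrow> real"
  assumes "finite (set_pmf M)"
  shows "measure_pmf.expectation M (\<lambda>x. f x - g x) =
    measure_pmf.expectation M f - measure_pmf.expectation M g"
  using assms by (intro Bochner_Integration.integral_diff integrable_measure_pmf_finite)

lemma finite_set_Pi_pmf:
  assumes "finite S" "\<And>i. i \<in> S \<Longrightarrow> finite (set_pmf (p i))"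
  shows "finite (set_pmf (Pi_pmf S d p))"
  using assms by (subst set_Pi_pmf) (auto intro!: finite_PiE_dflt)

lemma expectation_Pi_pmf_insert:
  fixes h :: "('i \<Rightarrow> 'a) \<Rightarrow> real"
  assumes "finite S" "i \<notin> S" "\<And>j. j \<in> insert i S \<Longrightarrow> finite (set_pmf (p j))"
  shows "measure_pmf.expectation (Pi_pmf (insert i S) d p) h =
    measure_pmf.expectation (p i) (\<lambda>a. measure_pmf.expectation (Pi_pmf S d p) (\<lambda>x. h (x(i := a))))"
proof -
  have "Pi_pmf (insert i S) d p = p i \<bind> (\<lambda>a. map_pmf (\<lambda>x. x(i := a)) (Pi_pmf S d p))"
    using assms(1,2) by (simp add: Pi_pmf_insert' map_pmf_def)
  moreover have "measure_pmf.expectation (p i \<bind> (\<lambda>a. map_pmf (\<lambda>x. x(i := a)) (Pi_pmf S d p))) h =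
    (\<Sum>a \<in> set_pmf (p i). pmf (p i) a *\<^sub>R measure_pmf.expectation (Pi_pmf S d p) (\<lambda>x. h (x(i := a))))"
    using assms finite_set_Pi_pmf[of S p d]
    by (subst pmf_expectation_bind[of "set_pmf (p i)"]) auto
  ultimately show ?thesis
    using assms(3)[of i] by (subst integral_measure_pmf[of "set_pmf (p i)"]) auto
qed

text \<open>\<open>z i\<close> is the reservation value: the expected excess over it just pays for
  opening box \<open>i\<close>. One function \<open>v\<close> values the outcomes of all boxes,
  because a contract pays by outcome only.\<close>

locale box_search =
  fixes N :: "nat set" and p :: "nat \<Rightarrow> nat pmf" and v c z :: "nat \<Rightarrow> real"
  assumes finite_N: "finite N"
    and finite_supp: "i \<in> N \<Longrightarrow> finite (set_pmf (p i))"
    and index: "i \<in> N \<Longrightarrow> measure_pmf.expectation (p i) (\<lambda>a. max 0 (v a - z i)) = c i"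
begin

definition cap :: "nat \<Rightarrow> nat \<Rightarrow> real" where
  "cap i a = min (v a) (z i)"

definition top_cap :: "nat set \<Rightarrow> real \<Rightarrow> (nat \<Rightarrow> nat) \<Rightarrow> real" where
  "top_cap S y x = Max (insert y ((\<lambda>i. cap i (x i)) ` S))"

text \<open>The value of continuing with closed boxes \<open>S\<close> and best revealed value
  \<open>y\<close>, as if the capped values were revealed for free.\<close>

definition W :: "nat set \<Rightarrow> real \<Rightarrow> real" where
  "W S y = measure_pmf.expectation (Pi_pmf S 0 p) (top_cap S y)"

lemma finite_sub: "S \<subseteq> N \<Longrightarrow> finite S"
  using finite_N finite_subset by blast

lemma finite_Pi: "S \<subseteq> N \<Longrightarrow> finite (set_pmf (Pi_pmf S 0 p))"
  by (intro finite_set_Pi_pmf) (auto intro: finite_sub finite_supp)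

lemma top_cap_mono:
  assumes "S \<subseteq> N" "y \<le> y'"
  shows "top_cap S y x \<le> top_cap S y' x" "top_cap S y' x \<le> top_cap S y x + (y' - y)"
proof -
  let ?A = "(\<lambda>i. cap i (x i)) ` S"
  have fin: "finite ?A" using finite_sub[OF assms(1)] by simp
  have ge: "u \<le> Max (insert w ?A)" if "u \<in> insert w ?A" for u w
    using fin that by (intro Max_ge) auto
  show "top_cap S y x \<le> top_cap S y' x"
    unfolding top_cap_def using fin order.trans[OF assms(2) ge[OF insertI1]] ge[OF insertI2]
    by (intro Max.boundedI) auto
  show "top_cap S y' x \<le> top_cap S y x + (y' - y)"
    unfolding top_cap_def using fin assms(2) ge[OF insertI1, of y] ge[OF insertI2, of _ y]
    by (intro Max.boundedI) (auto intro: add_increasing2)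
qed

lemma W_Lipschitz:
  assumes "S \<subseteq> N" "y \<le> y'"
  shows "W S y' \<le> W S y + (y' - y)"
proof -
  have "W S y' \<le> measure_pmf.expectation (Pi_pmf S 0 p) (\<lambda>x. top_cap S y x + (y' - y))"
    unfolding W_def using assms by (intro expectation_mono finite_Pi top_cap_mono)
  also have "\<dots> = W S y + (y' - y)"
    unfolding W_def using finite_Pi[OF assms(1)] by (subst expectation_add) auto
  finally show ?thesis .
qed

lemma W_ge: "S \<subseteq> N \<Longrightarrow> y \<le> W S y"
proof -
  assume S: "S \<subseteq> N"
  have "measure_pmf.expectation (Pi_pmf S 0 p) (\<lambda>_. y) \<le> W S y"
    unfolding W_def using finite_sub[OF S] by (intro expectation_mono finite_Pi S) (auto simp: top_cap_def)
  thus ?thesis by simp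
qed

lemma W_eq_self:
  assumes "S \<subseteq> N" "\<And>j. j \<in> S \<Longrightarrow> z j \<le> y"
  shows "W S y = y"
proof -
  have "top_cap S y = (\<lambda>_. y)"
    using assms(2) finite_sub[OF assms(1)]
    by (intro ext) (auto simp: top_cap_def cap_def intro!: Max_eqI intro: min.coboundedI2)
  thus ?thesis by (simp add: W_def)
qed

lemma W_insert:
  assumes "insert i S \<subseteq> N" "i \<notin> S"
  shows "W (insert i S) y = measure_pmf.expectation (p i) (\<lambda>a. W S (max y (cap i a)))"
proof -
  have "top_cap (insert i S) y (x(i := a)) = top_cap S (max y (cap i a)) x" for x a
  proof -
    have "(\<lambda>j. cap j ((x(i := a)) j)) ` insert i S = insert (cap i a) ((\<lambda>j. cap j (x j)) ` S)"
      using assms(2) by (auto simp: image_iff)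
    thus ?thesis using finite_sub[of S] assms(1)
      by (cases "S = {}") (auto simp: top_cap_def max.assoc max.commute max.left_commute)
  qed
  thus ?thesis
    unfolding W_def using assms finite_supp finite_sub[of S]
    by (subst expectation_Pi_pmf_insert) auto
qed

text \<open>Since \<open>v a = cap i a + max 0 (v a - z i)\<close>, this is where the index pays for the cost.\<close>

lemma open_le:
  assumes "insert i S \<subseteq> N" "i \<notin> S"
  shows "measure_pmf.expectation (p i) (\<lambda>a. W S (max y (v a))) - c i \<le> W (insert i S) y"
proof -
  have fin: "finite (set_pmf (p i))" and S: "S \<subseteq> N" using assms(1) finite_supp by auto
  have "measure_pmf.expectation (p i) (\<lambda>a. W S (max y (v a))) \<le>
      measure_pmf.expectation (p i) (\<lambda>a. W S (max y (cap i a)) + max 0 (v a - z i))"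
  proof (rule expectation_mono[OF fin])
    fix a
    have "W S (max y (v a)) \<le> W S (max y (cap i a)) + (max y (v a) - max y (cap i a))"
      by (intro W_Lipschitz S) (auto simp: cap_def)
    moreover have "max y (v a) - max y (cap i a) \<le> max 0 (v a - z i)"
      by (auto simp: cap_def)
    ultimately show "W S (max y (v a)) \<le> W S (max y (cap i a)) + max 0 (v a - z i)"
      by linarith
  qed
  also have "\<dots> = W (insert i S) y + c i"
    using W_insert[OF assms] index assms(1) by (simp add: expectation_add[OF fin])
  finally show ?thesis by simp
qed

text \<open>Nothing is lost in \<open>open_le\<close> here: below the index, capping has no effect,
  and above it both arguments of \<open>W S\<close> are at least every index of \<open>S\<close>,
  where \<open>W S\<close> is the identity.\<close>

lemma open_eq:
  assumes "insert i S \<subseteq> N" "i \<notin> S" "y < z i" "\<And>j. j \<in> S \<Longrightarrow> z j \<le> z i"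
  shows "measure_pmf.expectation (p i) (\<lambda>a. W S (max y (v a))) - c i = W (insert i S) y"
proof -
  have fin: "finite (set_pmf (p i))" and S: "S \<subseteq> N" using assms(1) finite_supp by auto
  have "W S (max y (v a)) = W S (max y (cap i a)) + max 0 (v a - z i)" for a
  proof (cases "v a \<le> z i")
    case False
    have "W S (max y (v a)) = v a" "W S (max y (cap i a)) = z i"
      using False assms(3,4) by (subst W_eq_self[OF S]; force simp: cap_def)+
    thus ?thesis using False by simp
  qed (simp add: cap_def)
  thus ?thesis
    using W_insert[OF assms(1,2)] index assms(1) by (simp add: expectation_add[OF fin])
qed

end

section \<open>The agent's problem from an arbitrary history on\<close>

definition remaining :: "inst \<Rightarrow> history \<Rightarrow> nat set" where
  "remaining I h = {..<n_act I} - fst ` set h"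

text \<open>One round per untaken action suffices to reach a halt, and taking an action lowers that
  number by one, which fits the recursion in \<open>gain_Take\<close>.\<close>

definition continuation :: "inst \<Rightarrow> strategy \<Rightarrow> (nat \<Rightarrow> nat) \<Rightarrow> history \<Rightarrow> history" where
  "continuation I \<pi> x h = (advance \<pi> x ^^ card (remaining I h)) h"

definition payoff :: "inst \<Rightarrow> contract \<Rightarrow> strategy \<Rightarrow> (nat \<Rightarrow> nat) \<Rightarrow> history \<Rightarrow> real" where
  "payoff I t \<pi> x h =
     t (case \<pi> (continuation I \<pi> x h) of Take i \<Rightarrow> undefined | Halt j \<Rightarrow> j) -
     (\<Sum>i \<in> fst ` set (continuation I \<pi> x h) - fst ` set h. cost I i)"

definition gain :: "inst \<Rightarrow> contract \<Rightarrow> strategy \<Rightarrow> history \<Rightarrow> real" where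
  "gain I t \<pi> h =
     measure_pmf.expectation (Pi_pmf (remaining I h) 0 (outcome_pmf I)) (\<lambda>x. payoff I t \<pi> x h)"

definition revealed_value :: "contract \<Rightarrow> history \<Rightarrow> real" where
  "revealed_value t h = Max (t ` insert 0 (snd ` set h))"

lemma agent_utility_gain: "agent_utility I t \<pi> = gain I t \<pi> []"
  by (simp add: agent_utility_def gain_def payoff_def remaining_def continuation_def
      outcomes_pmf_def final_outcome_def final_history_def taken_def)

lemma advance_extends: "set h \<subseteq> set ((advance \<pi> x ^^ k) h)"
  by (induction k) (auto simp: advance_def split: decision.splits)

lemma revealed_value_ge: "j \<in> insert 0 (snd ` set h) \<Longrightarrow> t j \<le> revealed_value t h"
  unfolding revealed_value_def by (intro Max_ge) auto

lemma revealed_value_attained: "\<exists>j \<in> insert 0 (snd ` set h). t j = revealed_value t h"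
proof -
  have "revealed_value t h \<in> t ` insert 0 (snd ` set h)"
    unfolding revealed_value_def by (intro Max_in) auto
  thus ?thesis by (metis imageE)
qed

lemma revealed_value_snoc: "revealed_value t (h @ [(i, a)]) = max (revealed_value t h) (t a)"
proof -
  have "t ` insert 0 (snd ` set (h @ [(i, a)])) = insert (t a) (t ` insert 0 (snd ` set h))" by auto
  thus ?thesis unfolding revealed_value_def by (simp add: max.commute)
qed

context
  fixes I :: inst
  assumes valid: "valid_inst I"
begin

lemma set_outcome_pmf: "i < n_act I \<Longrightarrow> set_pmf (outcome_pmf I i) \<subseteq> {..<n_out I}"
  using valid by (auto simp: set_pmf_eq pmf_outcome_pmf split: if_splits)

lemma finite_outcome_pmf: "i < n_act I \<Longrightarrow> finite (set_pmf (outcome_pmf I i))"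
  using set_outcome_pmf finite_subset by blast

lemma finite_outcomes_pmf: "finite (set_pmf (outcomes_pmf I))"
  unfolding outcomes_pmf_def by (intro finite_set_Pi_pmf) (auto intro: finite_outcome_pmf)

context
  fixes \<pi> :: strategy
  assumes \<pi>: "\<pi> \<in> strategies I"
begin

lemma decision_legal: "h \<in> histories I \<Longrightarrow> \<pi> h \<in> legal I h"
  using \<pi> by (auto simp: strategies_def)

lemma advance_histories:
  assumes "h \<in> histories I" "\<pi> h = Take i" "a < n_out I"
  shows "h @ [(i, a)] \<in> histories I"
  using assms decision_legal[OF assms(1)] by (auto simp: histories_def legal_def)

text \<open>Only outcomes of untaken actions can still be observed, so the outcome of an action just
  taken may be changed in the realization.\<close>

lemma advance_cong:
  assumes "h \<in> histories I" "\<And>i. i \<in> remaining I h \<Longrightarrow> x i = y i"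
    and "\<And>i. i \<in> remaining I h \<Longrightarrow> x i < n_out I"
  shows "(advance \<pi> x ^^ k) h = (advance \<pi> y ^^ k) h"
  using assms
proof (induction k arbitrary: h)
  case (Suc k)
  show ?case
  proof (cases "\<pi> h")
    case (Take i)
    hence i: "i \<in> remaining I h"
      using decision_legal[OF Suc.prems(1)] by (auto simp: legal_def remaining_def)
    hence eq: "x i = y i" "x i < n_out I" using Suc.prems(2,3) by blast+
    have "(advance \<pi> x ^^ k) (h @ [(i, x i)]) = (advance \<pi> y ^^ k) (h @ [(i, x i)])"
      using advance_histories[OF Suc.prems(1) Take eq(2)] Suc.prems(2,3)
      by (intro Suc.IH) (auto simp: remaining_def)
    moreover have "advance \<pi> x h = h @ [(i, x i)]" "advance \<pi> y h = h @ [(i, x i)]"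
      by (simp_all add: advance_def Take eq)
    ultimately show ?thesis by (simp add: funpow_Suc_right del: funpow.simps)
  next
    case (Halt j)
    thus ?thesis using Suc.IH[OF Suc.prems] by (simp add: funpow_Suc_right advance_def del: funpow.simps)
  qed
qed simp

lemma gain_Halt:
  assumes "\<pi> h = Halt j"
  shows "gain I t \<pi> h = t j"
proof -
  have "(advance \<pi> x ^^ k) h = h" for x k
    by (induction k) (auto simp: advance_def assms)
  thus ?thesis by (simp add: gain_def payoff_def continuation_def assms)
qed

text \<open>By independence the outcome of \<open>i\<close> can be drawn first; given it, the run
  continues from the longer history, and the cost of \<open>i\<close> is paid once.\<close>

lemma gain_Take:
  assumes h: "h \<in> histories I" and Take: "\<pi> h = Take i"
  shows "gain I t \<pi> h =
    measure_pmf.expectation (outcome_pmf I i) (\<lambda>a. gain I t \<pi> (h @ [(i, a)])) - cost I i"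
proof -
  define S where "S = remaining I h - {i}"
  have i: "i < n_act I" "i \<notin> fst ` set h"
    using decision_legal[OF h] Take by (auto simp: legal_def)
  have S: "remaining I h = insert i S" "i \<notin> S" "finite S" "S \<subseteq> {..<n_act I}"
    using i by (auto simp: S_def remaining_def)
  have S': "remaining I (h @ [(i, a)]) = S" for a by (auto simp: S_def remaining_def)
  have fin: "finite (set_pmf (outcome_pmf I j))" if "j \<in> insert i S" for j
    using that S(4) i(1) finite_outcome_pmf by blast
  have pay: "payoff I t \<pi> (x(i := a)) h = payoff I t \<pi> x (h @ [(i, a)]) - cost I i"
    if x: "x \<in> set_pmf (Pi_pmf S 0 (outcome_pmf I))" and a: "a \<in> set_pmf (outcome_pmf I i)" for x a
  proof -
    let ?h = "h @ [(i, a)]" and ?f = "continuation I \<pi> x (h @ [(i, a)])"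
    have h': "?h \<in> histories I"
      using advance_histories[OF h Take] set_outcome_pmf[OF i(1)] a by auto
    have "x j < n_out I" if "j \<in> S" for j
    proof -
      have "x j \<in> set_pmf (outcome_pmf I j)"
        using x that set_Pi_pmf_subset'[OF S(3), of 0 "outcome_pmf I"] by (auto simp: PiE_dflt_def)
      thus ?thesis using set_outcome_pmf S(4) that by blast
    qed
    hence "(advance \<pi> (x(i := a)) ^^ card S) ?h = ?f"
      unfolding continuation_def S' using S(2) by (intro advance_cong[OF h']) (auto simp: S')
    hence f: "continuation I \<pi> (x(i := a)) h = ?f"
      using S(2,3) by (simp add: continuation_def S(1) funpow_Suc_right advance_def Take del: funpow.simps)
    have "(i, a) \<in> set ?f"
      using advance_extends[where h = ?h and \<pi> = \<pi> and x = x and k = "card S"] by (auto simp: continuation_def S')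
    hence mem: "i \<in> fst ` set ?f" by force
    have "fst ` set ?h = insert i (fst ` set h)" by simp
    hence "fst ` set ?f - fst ` set h = insert i (fst ` set ?f - fst ` set ?h)"
      and "i \<notin> fst ` set ?f - fst ` set ?h"
      using i(2) mem by blast+
    moreover have "finite (fst ` set ?f - fst ` set ?h)" by simp
    ultimately have "(\<Sum>j \<in> fst ` set ?f - fst ` set h. cost I j) =
        cost I i + (\<Sum>j \<in> fst ` set ?f - fst ` set ?h. cost I j)"
      using sum.insert by metis
    thus ?thesis by (simp add: payoff_def f)
  qed
  have "gain I t \<pi> h = measure_pmf.expectation (outcome_pmf I i) (\<lambda>a.
      measure_pmf.expectation (Pi_pmf S 0 (outcome_pmf I)) (\<lambda>x. payoff I t \<pi> (x(i := a)) h))"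
    unfolding gain_def S(1) by (rule expectation_Pi_pmf_insert[OF S(3,2) fin])
  also have "\<dots> = measure_pmf.expectation (outcome_pmf I i) (\<lambda>a.
      measure_pmf.expectation (Pi_pmf S 0 (outcome_pmf I))
        (\<lambda>x. payoff I t \<pi> x (h @ [(i, a)]) - cost I i))"
    by (intro expectation_cong) (simp add: pay)
  also have "\<dots> = measure_pmf.expectation (outcome_pmf I i) (\<lambda>a. gain I t \<pi> (h @ [(i, a)]) - cost I i)"
    unfolding gain_def S' using fin S(3)
    by (subst expectation_diff) (auto intro!: finite_set_Pi_pmf)
  also have "\<dots> = measure_pmf.expectation (outcome_pmf I i) (\<lambda>a. gain I t \<pi> (h @ [(i, a)])) - cost I i"
    using fin by (subst expectation_diff) auto
  finally show ?thesis .
qed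

end

end

locale pandora =
  fixes I :: inst and t :: contract and z :: "nat \<Rightarrow> real"
  assumes valid: "valid_inst I"
    and index_eq: "i < n_act I \<Longrightarrow>
      measure_pmf.expectation (outcome_pmf I i) (\<lambda>a. max 0 (t a - z i)) = cost I i"

sublocale pandora \<subseteq> box_search "{..<n_act I}" "outcome_pmf I" t "cost I" z
  by unfold_locales (use valid index_eq finite_outcome_pmf in auto)

context pandora
begin

lemma remaining_subset: "remaining I h \<subseteq> {..<n_act I}"
  by (auto simp: remaining_def)

text \<open>Backward induction: halting gives at most the best revealed payment, and
  \<open>open_le\<close> bounds the effect of taking another action.\<close>

lemma gain_le:
  assumes "\<pi> \<in> strategies I" "h \<in> histories I"
  shows "gain I t \<pi> h \<le> W (remaining I h) (revealed_value t h)"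
  using assms(2)
proof (induction "card (remaining I h)" arbitrary: h rule: less_induct)
  case less
  note legal = decision_legal[OF valid assms(1) less.prems]
  show ?case
  proof (cases "\<pi> h")
    case (Halt j)
    hence "t j \<le> revealed_value t h" using legal by (intro revealed_value_ge) (auto simp: legal_def)
    thus ?thesis
      using gain_Halt[OF valid assms(1) Halt, of t] W_ge[OF remaining_subset, of "revealed_value t h" h] by simp
  next
    case (Take i)
    hence i: "i \<in> remaining I h" using legal by (auto simp: legal_def remaining_def)
    define S where "S = remaining I h - {i}"
    have S: "remaining I (h @ [(i, a)]) = S" for a by (auto simp: S_def remaining_def)
    have ins: "remaining I h = insert i S" "i \<notin> S" using i by (auto simp: S_def)
    have i': "i < n_act I" using i remaining_subset by blast
    have "gain I t \<pi> (h @ [(i, a)]) \<le> W S (max (revealed_value t h) (t a))"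
      if "a \<in> set_pmf (outcome_pmf I i)" for a
    proof -
      have "h @ [(i, a)] \<in> histories I"
        using advance_histories[OF valid assms(1) less.prems Take] set_outcome_pmf[OF valid i'] that by auto
      moreover have "card S < card (remaining I h)"
        using ins finite_sub[OF remaining_subset[of h]] by simp
      ultimately show ?thesis
        using less.hyps[of "h @ [(i, a)]"] by (simp add: S revealed_value_snoc)
    qed
    hence "gain I t \<pi> h \<le>
        measure_pmf.expectation (outcome_pmf I i) (\<lambda>a. W S (max (revealed_value t h) (t a))) - cost I i"
      unfolding gain_Take[OF valid assms(1) less.prems Take]
      using expectation_mono[OF finite_outcome_pmf[OF valid i']] by simp
    also have "\<dots> \<le> W (remaining I h) (revealed_value t h)"
      unfolding ins(1) using ins remaining_subset[of h] by (intro open_le) auto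
    finally show ?thesis .
  qed
qed

text \<open>Weitzman's rule. An action is taken only if its index strictly exceeds the revealed
  payment, as \<open>open_eq\<close> asks for.\<close>

definition follows_index :: "strategy \<Rightarrow> bool" where
  "follows_index \<pi> \<longleftrightarrow> (\<forall>h \<in> histories I.
     (\<exists>j. \<pi> h = Halt j \<and> t j = revealed_value t h \<and> (\<forall>i \<in> remaining I h. z i \<le> revealed_value t h)) \<or>
     (\<exists>i. \<pi> h = Take i \<and> revealed_value t h < z i \<and> (\<forall>j \<in> remaining I h. z j \<le> z i)))"

lemma gain_eq:
  assumes "\<pi> \<in> strategies I" "follows_index \<pi>" "h \<in> histories I"
  shows "gain I t \<pi> h = W (remaining I h) (revealed_value t h)"
  using assms(3)
proof (induction "card (remaining I h)" arbitrary: h rule: less_induct)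
  case less
  note legal = decision_legal[OF valid assms(1) less.prems]
  show ?case
  proof (cases "\<pi> h")
    case (Halt j)
    hence "t j = revealed_value t h" "\<forall>i \<in> remaining I h. z i \<le> revealed_value t h"
      using assms(2) less.prems by (fastforce simp: follows_index_def)+
    thus ?thesis
      using gain_Halt[OF valid assms(1) Halt, of t] W_eq_self[OF remaining_subset] by simp
  next
    case (Take i)
    hence i: "i \<in> remaining I h" using legal by (auto simp: legal_def remaining_def)
    define S where "S = remaining I h - {i}"
    have S: "remaining I (h @ [(i, a)]) = S" for a by (auto simp: S_def remaining_def)
    have ins: "remaining I h = insert i S" "i \<notin> S" using i by (auto simp: S_def)
    have i': "i < n_act I" using i remaining_subset by blast
    have z: "revealed_value t h < z i" "\<And>j. j \<in> S \<Longrightarrow> z j \<le> z i"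
      using assms(2) less.prems Take by (fastforce simp: follows_index_def S_def)+
    have "gain I t \<pi> (h @ [(i, a)]) = W S (max (revealed_value t h) (t a))"
      if "a \<in> set_pmf (outcome_pmf I i)" for a
    proof -
      have "h @ [(i, a)] \<in> histories I"
        using advance_histories[OF valid assms(1) less.prems Take] set_outcome_pmf[OF valid i'] that by auto
      moreover have "card S < card (remaining I h)"
        using ins finite_sub[OF remaining_subset[of h]] by simp
      ultimately show ?thesis
        using less.hyps[of "h @ [(i, a)]"] by (simp add: S revealed_value_snoc)
    qed
    hence "gain I t \<pi> h =
        measure_pmf.expectation (outcome_pmf I i) (\<lambda>a. W S (max (revealed_value t h) (t a))) - cost I i"
      unfolding gain_Take[OF valid assms(1) less.prems Take] by (simp cong: expectation_cong)
    also have "\<dots> = W (remaining I h) (revealed_value t h)"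
      unfolding ins(1) using ins remaining_subset[of h] z by (intro open_eq) auto
    finally show ?thesis .
  qed
qed

lemma index_strategy_exists: "\<exists>\<pi> \<in> strategies I. follows_index \<pi>"
proof -
  have "\<exists>d \<in> legal I h.
     (\<exists>j. d = Halt j \<and> t j = revealed_value t h \<and> (\<forall>i \<in> remaining I h. z i \<le> revealed_value t h)) \<or>
     (\<exists>i. d = Take i \<and> revealed_value t h < z i \<and> (\<forall>j \<in> remaining I h. z j \<le> z i))" for h
  proof (cases "\<forall>i \<in> remaining I h. z i \<le> revealed_value t h")
    case True
    obtain j where "j \<in> insert 0 (snd ` set h)" "t j = revealed_value t h"
      using revealed_value_attained by blast
    thus ?thesis using True by (intro bexI[of _ "Halt j"]) (auto simp: legal_def)
  next
    case False
    then obtain i0 where i0: "i0 \<in> remaining I h" "revealed_value t h < z i0" by force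
    have "finite (remaining I h)" "remaining I h \<noteq> {}"
      using i0 finite_sub[OF remaining_subset] by auto
    from finite_maximizer[OF this, of z] obtain i where
      "i \<in> remaining I h" "\<forall>j \<in> remaining I h. z j \<le> z i" by blast
    thus ?thesis using i0 by (intro bexI[of _ "Take i"]) (force simp: legal_def remaining_def)+
  qed
  then obtain d where d: "\<And>h. d h \<in> legal I h \<and>
     ((\<exists>j. d h = Halt j \<and> t j = revealed_value t h \<and> (\<forall>i \<in> remaining I h. z i \<le> revealed_value t h)) \<or>
     (\<exists>i. d h = Take i \<and> revealed_value t h < z i \<and> (\<forall>j \<in> remaining I h. z j \<le> z i)))"
    by metis
  have "restrict d (histories I) \<in> strategies I"
    using d by (auto simp: strategies_def)
  moreover have "follows_index (restrict d (histories I))"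
    using d by (simp add: follows_index_def)
  ultimately show ?thesis by blast
qed

theorem agent_optimum:
  "\<pi> \<in> strategies I \<Longrightarrow> agent_utility I t \<pi> \<le> W {..<n_act I} (t 0)"
  "\<exists>\<pi> \<in> strategies I. agent_utility I t \<pi> = W {..<n_act I} (t 0)"
proof -
  have nil: "[] \<in> histories I" "remaining I [] = {..<n_act I}" "revealed_value t [] = t 0"
    by (auto simp: histories_def remaining_def revealed_value_def)
  show "\<pi> \<in> strategies I \<Longrightarrow> agent_utility I t \<pi> \<le> W {..<n_act I} (t 0)"
    using gain_le[of \<pi> "[]"] nil by (simp add: agent_utility_gain)
  show "\<exists>\<pi> \<in> strategies I. agent_utility I t \<pi> = W {..<n_act I} (t 0)"
    using index_strategy_exists gain_eq[of _ "[]"] nil by (auto simp: agent_utility_gain)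
qed

end

section \<open>The implicitly defined index as a finite maximum over sets of outcomes\<close>

section \<open>Indices as maxima of affine functions\<close>

lemma aff_sum:
  assumes "length f = Suc (length t)"
  shows "aff f t = (\<Sum>j<length t. f ! j * t ! j) + f ! length t"
  using assms
proof (induction t arbitrary: f)
  case Nil
  thus ?case by (cases f) auto
next
  case (Cons x t)
  then obtain a f' where "f = a # f'" "length f' = Suc (length t)" by (cases f) auto
  thus ?case using Cons.IH[of f']
    by (simp add: sum.lessThan_Suc_shift del: sum.lessThan_Suc)
qed

lemma aff_vsub:
  assumes "length f = Suc (length t)" "length g = Suc (length t)"
  shows "aff (rvs (vsub f g)) t = aff (rvs f) t - aff (rvs g) t"
  using assms by (simp add: aff_sum vsub_def sum_subtractf algebra_simps)

lemma coords_aff: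
  assumes "k < m"
  shows "\<exists>f \<in> set (coords m). \<forall>t. length t = m \<longrightarrow> aff (rvs f) t = t ! k"
proof -
  let ?f = "map (\<lambda>j. fint (if j = k then 1 else 0)) [0..<Suc m]"
  have "aff (rvs ?f) t = t ! k" if "length t = m" for t
  proof -
    have "aff (rvs ?f) t = (\<Sum>j<m. (if j = k then 1 else 0) * t ! j) + 0"
      using that assms by (subst aff_sum) (auto simp: nth_append simp del: upt_Suc intro!: sum.cong)
    also have "\<dots> = t ! k" using assms by (simp add: if_distrib[of "\<lambda>c. c * _"] sum.delta cong: if_cong)
    finally show ?thesis .
  qed
  thus ?thesis using assms by (intro bexI[of _ ?f]) (auto simp: coords_def)
qed

lemma length_coords: "f \<in> set (coords m) \<Longrightarrow> length f = Suc m"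
  by (auto simp: coords_def)

lemma set_masks: "set (masks m) = {e. length e = m \<and> set e \<subseteq> {fint 0, fint 1}}"
  by (auto simp: masks_def set_n_lists)

lemma nth_masked: "length e = m \<Longrightarrow> length p = m \<Longrightarrow> j < m \<Longrightarrow> rv (masked e p ! j) = rv (e ! j) * rv (p ! j)"
  by (simp add: masked_def)

lemma length_masked: "length e = m \<Longrightarrow> length p = m \<Longrightarrow> length (masked e p) = m"
  by (simp add: masked_def)

lemma set_zfuns:
  "set (zfuns m b) = {zfun (fst b) w |w. \<exists>e \<in> set (masks m). w = masked e (snd b) \<and> 0 < rv (frac_sum w)}"
  unfolding zfuns_def by auto

lemma rv_frac_sum_nth: "rv (frac_sum w) = (\<Sum>j<length w. rv (w ! j))"
  by (simp add: sum_list_sum_nth atLeast0LessThan)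

lemma aff_zfun:
  assumes "length w = length t"
  shows "aff (rvs (zfun c w)) t = ((\<Sum>j<length t. rv (w ! j) * t ! j) - rv c) / rv (frac_sum w)"
proof -
  have "aff (rvs (zfun c w)) t = (\<Sum>j<length t. rv (w ! j) / rv (frac_sum w) * t ! j) - rv c / rv (frac_sum w)"
    using assms by (subst aff_sum) (auto simp: zfun_def nth_append simp del: rv_frac_sum)
  thus ?thesis by (simp add: diff_divide_distrib sum_divide_distrib)
qed

definition zval :: "nat \<Rightarrow> real list \<Rightarrow> box \<Rightarrow> real" where
  "zval m t b = Max ((\<lambda>f. aff (rvs f) t) ` set (zfuns m b))"

definition wf_box :: "nat \<Rightarrow> box \<Rightarrow> bool" where
  "wf_box m b \<longleftrightarrow> 0 \<le> rv (fst b) \<and> length (snd b) = m \<and> (\<forall>x \<in> set (snd b). 0 \<le> rv x) \<and>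
     (\<Sum>x\<leftarrow>snd b. rv x) = 1"

text \<open>The set of all outcomes has probability 1 and passes the filter.\<close>

lemma zfuns_nonempty:
  assumes "wf_box m b"
  shows "zfuns m b \<noteq> []"
proof -
  let ?e = "replicate m (fint 1)"
  have p: "length (snd b) = m" "(\<Sum>x\<leftarrow>snd b. rv x) = 1" using assms by (auto simp: wf_box_def)
  have "rv (frac_sum (masked ?e (snd b))) = (\<Sum>j<m. rv (snd b ! j))"
    unfolding rv_frac_sum_nth using p(1) by (simp add: length_masked nth_masked)
  also have "\<dots> = 1" using p by (simp add: sum_list_sum_nth atLeast0LessThan)
  finally have "0 < rv (frac_sum (masked ?e (snd b)))" by (simp only: zero_less_one)
  moreover have "?e \<in> set (masks m)" by (auto simp: set_masks)
  ultimately have "zfun (fst b) (masked ?e (snd b)) \<in> set (zfuns m b)"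
    unfolding set_zfuns by blast
  thus ?thesis by (metis empty_iff list.set(1))
qed

lemma length_zfuns: "wf_box m b \<Longrightarrow> f \<in> set (zfuns m b) \<Longrightarrow> length f = Suc m"
  by (auto simp: set_zfuns set_masks wf_box_def zfun_def length_masked)

text \<open>For a set of positive probability, the affine function is at most \<open>z\<close>
  exactly if the expected \<open>t - z\<close> on the set is at most the cost. The set where
  \<open>t\<close> exceeds \<open>z\<close> gives one inequality; a set attaining the maximum gives
  the other, as passing to positive parts only increases the sum.\<close>

lemma index_equation:
  assumes b: "wf_box m b" and t: "length t = m"
  shows "(\<Sum>j<m. rv (snd b ! j) * max 0 (t ! j - zval m t b)) = rv (fst b)"
proof (rule antisym)
  define z where "z = zval m t b"
  define c where "c = fst b"
  define p where "p = snd b"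
  have p: "length p = m" "\<And>j. j < m \<Longrightarrow> 0 \<le> rv (p ! j)" and c: "0 \<le> rv c"
    using b by (auto simp: wf_box_def p_def c_def)
  have sums: "(\<Sum>j<m. rv (w ! j) * t ! j) - z * rv (frac_sum w) = (\<Sum>j<m. rv (w ! j) * (t ! j - z))"
    if "length w = m" for w
    unfolding rv_frac_sum_nth using that by (simp add: sum_distrib_left sum_subtractf algebra_simps)
  show "(\<Sum>j<m. rv (snd b ! j) * max 0 (t ! j - zval m t b)) \<le> rv (fst b)"
    unfolding z_def[symmetric] c_def[symmetric] p_def[symmetric]
  proof -
    \<comment> \<open>The outcomes that pay more than \<open>z\<close>: on them, the sum of
      \<open>t - z\<close> is the sum of the positive parts. If they have probability 0, it vanishes
      and the cost is nonnegative.\<close>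
    define e where "e = map (\<lambda>j. fint (if z < t ! j then 1 else 0)) [0..<m]"
    define w where "w = masked e p"
    have e: "e \<in> set (masks m)" by (auto simp: set_masks e_def)
    have w: "length w = m" "\<And>j. j < m \<Longrightarrow> rv (w ! j) = (if z < t ! j then rv (p ! j) else 0)"
      using p(1) by (auto simp: w_def e_def length_masked nth_masked)
    have eq: "(\<Sum>j<m. rv (p ! j) * max 0 (t ! j - z)) = (\<Sum>j<m. rv (w ! j) * (t ! j - z))"
      using w(2) by (intro sum.cong) auto
    show "(\<Sum>j<m. rv (p ! j) * max 0 (t ! j - z)) \<le> rv c"
    proof (cases "0 < rv (frac_sum w)")
      case True
      hence "zfun c w \<in> set (zfuns m b)" using e by (auto simp: set_zfuns c_def p_def w_def simp del: rv_frac_sum)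
      hence "aff (rvs (zfun c w)) t \<le> z" unfolding z_def zval_def by (intro Max_ge) auto
      hence "(\<Sum>j<m. rv (w ! j) * t ! j) - rv c \<le> z * rv (frac_sum w)"
        using True w(1) t by (simp add: aff_zfun pos_divide_le_eq del: rv_frac_sum)
      thus ?thesis using sums[OF w(1)] eq by simp
    next
      case False
      have nn: "\<And>j. j \<in> {..<m} \<Longrightarrow> 0 \<le> rv (w ! j)" using w(2) p(2) by simp
      have "(\<Sum>j<m. rv (w ! j)) = 0"
        using False sum_nonneg[of "{..<m}" "\<lambda>j. rv (w ! j)"] nn w(1)
        unfolding rv_frac_sum_nth by force
      hence "\<And>j. j < m \<Longrightarrow> rv (w ! j) = 0" using nn by (subst (asm) sum_nonneg_eq_0_iff) auto
      thus ?thesis unfolding eq using c by simp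
    qed
  qed
  show "rv (fst b) \<le> (\<Sum>j<m. rv (snd b ! j) * max 0 (t ! j - zval m t b))"
    unfolding z_def[symmetric] c_def[symmetric] p_def[symmetric]
  proof -
    have "z \<in> (\<lambda>f. aff (rvs f) t) ` set (zfuns m b)"
      unfolding z_def zval_def using zfuns_nonempty[OF b] by (intro Max_in) auto
    then obtain e where e: "e \<in> set (masks m)" "0 < rv (frac_sum (masked e p))"
      "z = aff (rvs (zfun c (masked e p))) t"
      unfolding set_zfuns c_def p_def by blast
    let ?w = "masked e p"
    have w: "length ?w = m" "\<And>j. j < m \<Longrightarrow> rv (?w ! j) = rv (e ! j) * rv (p ! j)"
      using e(1) p(1) by (auto simp: set_masks length_masked nth_masked)
    have "rv c = (\<Sum>j<m. rv (?w ! j) * t ! j) - z * rv (frac_sum ?w)"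
      using e(2,3) w(1) t by (simp add: aff_zfun field_simps del: rv_frac_sum)
    also have "\<dots> = (\<Sum>j<m. rv (?w ! j) * (t ! j - z))" using sums w(1) by blast
    also have "\<dots> \<le> (\<Sum>j<m. rv (p ! j) * max 0 (t ! j - z))"
    proof (rule sum_mono)
      fix j assume "j \<in> {..<m}"
      hence j: "j < m" by simp
      have "e ! j \<in> {fint 0, fint 1}" using e(1) j nth_mem by (fastforce simp: set_masks)
      hence "rv (?w ! j) = 0 \<or> rv (?w ! j) = rv (p ! j)" using w(2)[OF j] by auto
      moreover have "rv (p ! j) * (t ! j - z) \<le> rv (p ! j) * max 0 (t ! j - z)"
        using p(2)[OF j] by (intro mult_left_mono) auto
      moreover have "0 \<le> rv (p ! j) * max 0 (t ! j - z)"
        using p(2)[OF j] by (intro mult_nonneg_nonneg) auto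
      ultimately show "rv (?w ! j) * (t ! j - z) \<le> rv (p ! j) * max 0 (t ! j - z)"
        by (metis mult_zero_left)
    qed
    finally show "rv c \<le> (\<Sum>j<m. rv (p ! j) * max 0 (t ! j - z))" .
  qed
qed

lemma wf_zero_box: "0 < m \<Longrightarrow> wf_box m (zero_box m)"
  by (auto simp: wf_box_def zero_box_def comp_def interv_sum_list_conv_sum_set_nat
      if_distrib[of real_of_int] cong: if_cong)

text \<open>The box is free and surely contains outcome 0, so its expected excess can vanish only if
  its index is at least \<open>t ! 0\<close>. Capping hence leaves that payment unchanged.\<close>

lemma zval_zero_box:
  assumes "0 < m" "length t = m"
  shows "t ! 0 \<le> zval m t (zero_box m)"
proof -
  have "(\<Sum>j<m. (if j = 0 then 1 else 0) * max 0 (t ! j - zval m t (zero_box m))) = 0"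
    using index_equation[OF wf_zero_box[OF assms(1)] assms(2)]
    by (simp add: zero_box_def if_distrib[of real_of_int] cong: if_cong)
  hence "max 0 (t ! 0 - zval m t (zero_box m)) = 0"
    using assms(1) by (simp add: if_distrib[of "\<lambda>c. c * _"] sum.delta cong: if_cong)
  thus ?thesis by simp
qed

section \<open>Closures of cells, and affine selection on them\<close>

section \<open>Order types of the affine functions\<close>

text \<open>Not symmetric: strict inequalities at \<open>t\<close> may become ties at
  \<open>t'\<close>, so \<open>t'\<close> ranges over the closure of the cell of
  \<open>t\<close>.\<close>

definition same_order :: "frac list set \<Rightarrow> real list \<Rightarrow> real list \<Rightarrow> bool" where
  "same_order L t t' \<longleftrightarrow>
     (\<forall>f \<in> L. \<forall>g \<in> L. aff (rvs f) t \<le> aff (rvs g) t \<longrightarrow> aff (rvs f) t' \<le> aff (rvs g) t')"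

text \<open>A function that is greatest at \<open>t\<close> stays greatest wherever the weak order
  persists, so \<open>l\<close> can be chosen before \<open>t'\<close>.\<close>

lemma select_Max:
  assumes "finite X" "X \<noteq> {}" "X \<subseteq> L"
  shows "\<exists>l \<in> X. \<forall>t'. same_order L t t' \<longrightarrow> Max ((\<lambda>f. aff (rvs f) t') ` X) = aff (rvs l) t'"
proof -
  obtain l where l: "l \<in> X" "\<And>f. f \<in> X \<Longrightarrow> aff (rvs f) t \<le> aff (rvs l) t"
    using finite_maximizer[OF assms(1,2), of "\<lambda>f. aff (rvs f) t"] by blast
  have "Max ((\<lambda>f. aff (rvs f) t') ` X) = aff (rvs l) t'" if "same_order L t t'" for t'
    using that l assms by (intro Max_eqI) (auto simp: same_order_def subset_iff)
  thus ?thesis using l(1) by blast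
qed

definition capped :: "nat \<Rightarrow> real list \<Rightarrow> box \<Rightarrow> nat \<Rightarrow> real" where
  "capped m t b j = min (t ! j) (zval m t b)"

lemma select_capped:
  assumes "wf_box m b" "j < m" "set (coords m) \<subseteq> L" "set (zfuns m b) \<subseteq> L" "length t = m"
  shows "\<exists>l \<in> L. \<forall>t'. same_order L t t' \<longrightarrow> length t' = m \<longrightarrow> capped m t' b j = aff (rvs l) t'"
proof -
  obtain f where f: "f \<in> set (zfuns m b)" "\<And>t'. same_order L t t' \<Longrightarrow> zval m t' b = aff (rvs f) t'"
    using select_Max[of "set (zfuns m b)" L t] zfuns_nonempty[OF assms(1)] assms(4)
    unfolding zval_def by auto
  obtain e where e: "e \<in> set (coords m)" "\<And>t'. length t' = m \<Longrightarrow> aff (rvs e) t' = t' ! j"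
    using coords_aff[OF assms(2)] by blast
  have L: "e \<in> L" "f \<in> L" using e f assms by auto
  have "capped m t' b j = aff (rvs (if aff (rvs e) t \<le> aff (rvs f) t then e else f)) t'"
    if "same_order L t t'" "length t' = m" for t'
  proof -
    have "capped m t' b j = min (aff (rvs e) t') (aff (rvs f) t')"
      using that f(2) e(2) by (simp add: capped_def)
    thus ?thesis using that(1) L unfolding same_order_def
      by (smt (verit, best) linear min.absorb1 min.absorb2)
  qed
  thus ?thesis using L by (intro bexI[of _ "if aff (rvs e) t \<le> aff (rvs f) t then e else f"]) auto
qed

lemma same_order_walls:
  assumes "\<And>f. f \<in> set (walls m bs) \<Longrightarrow> wpres (aff (rvs f) t) (aff (rvs f) t')"
    and "\<And>f. f \<in> set (lfuns m bs) \<Longrightarrow> length f = Suc m" "length t = m" "length t' = m"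
  shows "same_order (set (lfuns m bs)) t t'"
  unfolding same_order_def
proof (intro ballI impI)
  fix f g assume fg: "f \<in> set (lfuns m bs)" "g \<in> set (lfuns m bs)" "aff (rvs f) t \<le> aff (rvs g) t"
  hence "vsub f g \<in> set (walls m bs)" unfolding walls_def by auto
  hence "wpres (aff (rvs f) t - aff (rvs g) t) (aff (rvs f) t' - aff (rvs g) t')"
    using assms(1)[of "vsub f g"] assms(2-4) fg by (simp add: aff_vsub)
  thus "aff (rvs f) t' \<le> aff (rvs g) t'" using fg(3) by (auto simp: wpres_def)
qed

text \<open>For negative \<open>s\<close> the point lies beyond \<open>t\<close>, as seen from
  \<open>t'\<close>.\<close>

definition comb :: "real \<Rightarrow> real list \<Rightarrow> real list \<Rightarrow> real list" where
  "comb s t t' = map (\<lambda>q. (1 - s) * fst q + s * snd q) (zip t t')"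

lemma length_comb [simp]: "length t' = length t \<Longrightarrow> length (comb s t t') = length t"
  by (simp add: comb_def)

lemma nth_comb: "length t' = length t \<Longrightarrow> j < length t \<Longrightarrow> comb s t t' ! j = (1 - s) * t ! j + s * t' ! j"
  by (simp add: comb_def)

lemma aff_comb:
  assumes "length f = Suc (length t)" "length t' = length t"
  shows "aff f (comb s t t') = (1 - s) * aff f t + s * aff f t'"
  using assms
  by (simp add: aff_sum nth_comb sum_distrib_left sum.distrib[symmetric] algebra_simps)

text \<open>Small moves preserve strict inequalities, and functions that tie at \<open>t\<close>
  also tie at \<open>t'\<close>, hence on the whole line. So the segment from \<open>t'\<close> can
  be prolonged beyond \<open>t\<close>.\<close>

lemma same_order_extrapolate:
  assumes "finite L" "\<And>f. f \<in> L \<Longrightarrow> length f = Suc (length t)" "length t' = length t" "same_order L t t'"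
  shows "\<exists>s > 0. same_order L t (comb (- s) t t')"
proof -
  have "eventually (\<lambda>s. \<forall>f \<in> L. \<forall>g \<in> L. aff (rvs f) t \<le> aff (rvs g) t \<longrightarrow>
      aff (rvs f) (comb (- s) t t') \<le> aff (rvs g) (comb (- s) t t')) (at_right 0)"
    (is "eventually ?P _")
  proof (intro eventually_ball_finite assms(1) ballI)
    fix f g assume fg: "f \<in> L" "g \<in> L"
    define a b where "a = aff (rvs g) t - aff (rvs f) t" "b = aff (rvs g) t' - aff (rvs f) t'"
    have diff: "aff (rvs g) (comb (- s) t t') - aff (rvs f) (comb (- s) t t') = (1 + s) * a - s * b" for s
      using fg assms(2,3) by (simp add: aff_comb a_b_def algebra_simps)
    have ab: "b = 0" if "a = 0"
      using assms(4) fg that by (auto simp: same_order_def a_b_def intro: antisym)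
    show "eventually (\<lambda>s. aff (rvs f) t \<le> aff (rvs g) t \<longrightarrow>
      aff (rvs f) (comb (- s) t t') \<le> aff (rvs g) (comb (- s) t t')) (at_right 0)"
    proof (cases "0 < a")
      case True
      have "((\<lambda>s. (1 + s) * a - s * b) \<longlongrightarrow> (1 + 0) * a - 0 * b) (at_right 0)"
        by (intro tendsto_intros)
      hence "eventually (\<lambda>s. 0 < (1 + s) * a - s * b) (at_right 0)"
        using True by (intro order_tendstoD(1)) auto
      thus ?thesis using diff by (auto elim!: eventually_mono) (smt (verit))
    next
      case False
      have "aff (rvs f) (comb (- s) t t') \<le> aff (rvs g) (comb (- s) t t')"
        if "aff (rvs f) t \<le> aff (rvs g) t" for s
        using diff[of s] ab False that by (simp add: a_b_def)
      thus ?thesis by simp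
    qed
  qed
  moreover have "eventually (\<lambda>s :: real. 0 < s) (at_right 0)" by (rule eventually_at_right_less)
  ultimately have "eventually (\<lambda>s. ?P s \<and> 0 < s) (at_right 0)" by (rule eventually_conj)
  then obtain s where "?P s" "0 < s"
    using eventually_happens[of _ "at_right (0 :: real)"] trivial_limit_at_right_real by blast
  thus ?thesis unfolding same_order_def by blast
qed

section \<open>The value of the agent and the persistence of best responses\<close>

section \<open>Contracts as points\<close>

locale encoded_inst =
  fixes I :: inst and m :: nat and cs rs :: "frac list" and ps :: "frac list list"
  assumes valid: "valid_inst I"
    and m: "n_out I = m"
    and length_cs: "length cs = n_act I" and length_ps: "length ps = n_act I"
    and length_rs: "length rs = m"
    and length_row: "i < n_act I \<Longrightarrow> length (ps ! i) = m"
    and cost: "i < n_act I \<Longrightarrow> cost I i = rv (cs ! i)"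
    and reward: "j < m \<Longrightarrow> reward I j = rv (rs ! j)"
    and prob: "i < n_act I \<Longrightarrow> j < m \<Longrightarrow> pmf (outcome_pmf I i) j = rv (ps ! i ! j)"
begin

abbreviation act_box :: "nat \<Rightarrow> box" where "act_box i \<equiv> (cs ! i, ps ! i)"

definition all_boxes :: "box list" where
  "all_boxes = zero_box m # zip cs ps"

abbreviation L :: "frac list set" where "L \<equiv> set (lfuns m all_boxes)"

lemma m_pos: "0 < m"
  using valid m by (simp add: valid_inst_def)

lemma supp: "i < n_act I \<Longrightarrow> set_pmf (outcome_pmf I i) \<subseteq> {..<m}"
  using set_outcome_pmf[OF valid] m by simp

lemma wf_box_nth: "i < n_act I \<Longrightarrow> wf_box m (act_box i)"
proof -
  assume i: "i < n_act I"
  have "0 \<le> cost I i"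
    using valid i by (auto simp: valid_inst_def cost_def n_act_def)
  moreover have "0 \<le> rv q" if "q \<in> set (ps ! i)" for q
    using that prob[OF i] length_row[OF i] by (metis in_set_conv_nth pmf_nonneg)
  moreover have "(\<Sum>q\<leftarrow>ps ! i. rv q) = (\<Sum>j<m. pmf (outcome_pmf I i) j)"
    using prob[OF i] length_row[OF i] by (simp add: sum_list_sum_nth atLeast0LessThan)
  moreover have "\<dots> = 1" by (intro sum_pmf_eq_1 finite_lessThan supp i)
  ultimately show ?thesis using cost[OF i] length_row[OF i] by (simp add: wf_box_def)
qed

lemma set_all_boxes: "set all_boxes = insert (zero_box m) (act_box ` {..<n_act I})"
  using length_cs length_ps by (auto simp: all_boxes_def set_zip)

lemma wf_all_boxes: "b \<in> set all_boxes \<Longrightarrow> wf_box m b"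
  using wf_zero_box[OF m_pos] wf_box_nth by (auto simp: set_all_boxes)

lemma length_lfuns: "f \<in> L \<Longrightarrow> length f = Suc m"
  using length_zfuns[OF wf_all_boxes] by (auto simp: lfuns_def length_coords)

lemma length_walls: "f \<in> set (walls m all_boxes) \<Longrightarrow> length f = Suc m"
  using length_lfuns by (auto simp: walls_def length_coords vsub_def)

lemma coords_L: "set (coords m) \<subseteq> L"
  by (auto simp: lfuns_def)

lemma zfuns_L: "b \<in> set all_boxes \<Longrightarrow> set (zfuns m b) \<subseteq> L"
  by (auto simp: lfuns_def)

lemma outcomes_lt: "x \<in> set_pmf (outcomes_pmf I) \<Longrightarrow> i < n_act I \<Longrightarrow> x i < m"
  using set_Pi_pmf_subset'[of "{..<n_act I}" 0 "outcome_pmf I"] supp[of i]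
  by (force simp: outcomes_pmf_def PiE_dflt_def)

lemma final_outcome_lt:
  assumes "\<pi> \<in> strategies I" "x \<in> set_pmf (outcomes_pmf I)"
  shows "final_outcome I \<pi> x < m"
proof -
  have "x i < n_out I" if "i < n_act I" for i using outcomes_lt assms(2) that m by simp
  note halt = strategy_halts[OF assms(1), of x, OF this]
  from halt(2) obtain j where j: "j \<in> insert 0 (snd ` set (final_history I \<pi> x))"
    "\<pi> (final_history I \<pi> x) = Halt j" by metis
  have "snd ` set (final_history I \<pi> x) \<subseteq> {..<m}"
    using halt(1) m by (auto simp: histories_def)
  hence "j < m" using j(1) m_pos by blast
  thus ?thesis using j(2) by (simp add: final_outcome_def)
qed

subsection \<open>The value of the agent\<close>

definition top_value :: "real list \<Rightarrow> (nat \<Rightarrow> nat) \<Rightarrow> real" where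
  "top_value t x = Max (insert (t ! 0) ((\<lambda>i. capped m t (act_box i) (x i)) ` {..<n_act I}))"

definition V :: "real list \<Rightarrow> real" where
  "V t = measure_pmf.expectation (outcomes_pmf I) (top_value t)"

lemma agent_value:
  assumes t: "length t = m"
  shows "\<pi> \<in> strategies I \<Longrightarrow> agent_utility I ((!) t) \<pi> \<le> V t"
    and "\<exists>\<pi> \<in> strategies I. agent_utility I ((!) t) \<pi> = V t"
proof -
  interpret pandora I "(!) t" "\<lambda>i. zval m t (act_box i)"
  proof
    fix i assume i: "i < n_act I"
    have "measure_pmf.expectation (outcome_pmf I i) (\<lambda>a. max 0 (t ! a - zval m t (act_box i))) =
        (\<Sum>j<m. max 0 (t ! j - zval m t (act_box i)) * pmf (outcome_pmf I i) j)"
      using supp[OF i] by (intro integral_measure_pmf_real) auto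
    also have "\<dots> = (\<Sum>j<m. rv (snd (act_box i) ! j) * max 0 (t ! j - zval m t (act_box i)))"
      using prob[OF i] by (intro sum.cong) auto
    also have "\<dots> = rv (fst (act_box i))" by (rule index_equation[OF wf_box_nth[OF i] t])
    finally show "measure_pmf.expectation (outcome_pmf I i) (\<lambda>a. max 0 (t ! a - zval m t (act_box i))) = cost I i"
      using cost[OF i] by simp
  qed (rule valid)
  have "W {..<n_act I} (t ! 0) = V t"
    by (simp add: W_def V_def outcomes_pmf_def top_cap_def[abs_def] top_value_def[abs_def]
        cap_def capped_def)
  thus "\<pi> \<in> strategies I \<Longrightarrow> agent_utility I ((!) t) \<pi> \<le> V t"
    and "\<exists>\<pi> \<in> strategies I. agent_utility I ((!) t) \<pi> = V t"
    using agent_optimum by auto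
qed

lemma agent_optimal_iff:
  assumes "length t = m"
  shows "\<pi> \<in> agent_optimal I ((!) t) \<longleftrightarrow> \<pi> \<in> strategies I \<and> agent_utility I ((!) t) \<pi> = V t"
proof -
  obtain \<pi>' where \<pi>': "\<pi>' \<in> strategies I" "agent_utility I ((!) t) \<pi>' = V t"
    using agent_value(2)[OF assms] by blast
  show ?thesis
  proof
    assume \<pi>: "\<pi> \<in> agent_optimal I ((!) t)"
    hence "agent_utility I ((!) t) \<pi>' \<le> agent_utility I ((!) t) \<pi>"
      using \<pi>'(1) by (simp add: agent_optimal_def)
    thus "\<pi> \<in> strategies I \<and> agent_utility I ((!) t) \<pi> = V t"
      using agent_value(1)[OF assms, of \<pi>] \<pi> \<pi>'(2) by (simp add: agent_optimal_def)
  qed (simp add: agent_optimal_def agent_value(1)[OF assms])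
qed

text \<open>For a fixed realization, the minima and maxima are decided by the order of the functions
  at \<open>t\<close>, so a single affine function gives the top value on the closure of the
  cell.\<close>

lemma select_top_value:
  assumes t: "length t = m" and x: "x \<in> set_pmf (outcomes_pmf I)"
  shows "\<exists>l \<in> L. \<forall>t'. same_order L t t' \<longrightarrow> length t' = m \<longrightarrow> top_value t' x = aff (rvs l) t'"
proof -
  have "\<exists>l \<in> L. \<forall>t'. same_order L t t' \<longrightarrow> length t' = m \<longrightarrow> capped m t' (act_box i) (x i) = aff (rvs l) t'"
    if "i < n_act I" for i
    using that wf_box_nth outcomes_lt[OF x] coords_L zfuns_L t
    by (intro select_capped) (auto simp: set_all_boxes)
  then obtain g where g: "\<And>i. i < n_act I \<Longrightarrow> g i \<in> L"
    "\<And>i t'. i < n_act I \<Longrightarrow> same_order L t t' \<Longrightarrow> length t' = m \<Longrightarrow>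
      capped m t' (act_box i) (x i) = aff (rvs (g i)) t'"
    by metis
  obtain e where e: "e \<in> set (coords m)" "\<And>t'. length t' = m \<Longrightarrow> aff (rvs e) t' = t' ! 0"
    using coords_aff[OF m_pos] by blast
  let ?X = "insert e (g ` {..<n_act I})"
  obtain l where l: "l \<in> ?X" "\<And>t'. same_order L t t' \<Longrightarrow> Max ((\<lambda>f. aff (rvs f) t') ` ?X) = aff (rvs l) t'"
    using select_Max[of ?X L t] g(1) e(1) coords_L by auto
  have "top_value t' x = aff (rvs l) t'" if "same_order L t t'" "length t' = m" for t'
  proof -
    have "(\<lambda>f. aff (rvs f) t') ` ?X = insert (t' ! 0) ((\<lambda>i. capped m t' (act_box i) (x i)) ` {..<n_act I})"
      using g(2) that e(2) by (force simp: image_iff)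
    thus ?thesis using l(2)[OF that(1)] by (simp add: top_value_def)
  qed
  moreover have "l \<in> L" using l(1) g(1) e(1) coords_L by auto
  ultimately show ?thesis by blast
qed

lemma same_order_refl: "same_order L t t"
  by (simp add: same_order_def)

lemma V_extrapolate:
  assumes "length t = m" "length t' = m" "same_order L t t'" "same_order L t (comb s t t')"
  shows "V (comb s t t') = (1 - s) * V t + s * V t'"
proof -
  have "top_value (comb s t t') x = (1 - s) * top_value t x + s * top_value t' x"
    if x: "x \<in> set_pmf (outcomes_pmf I)" for x
  proof -
    obtain l where l: "l \<in> L"
      "\<And>t'. same_order L t t' \<Longrightarrow> length t' = m \<Longrightarrow> top_value t' x = aff (rvs l) t'"
      using select_top_value[OF assms(1) x] by blast
    thus ?thesis using assms length_lfuns[OF l(1)] same_order_refl by (simp add: aff_comb)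
  qed
  hence "V (comb s t t') = measure_pmf.expectation (outcomes_pmf I)
      (\<lambda>x. (1 - s) * top_value t x + s * top_value t' x)"
    unfolding V_def by (rule expectation_cong)
  thus ?thesis
    unfolding V_def using finite_outcomes_pmf[OF valid] by (subst (asm) expectation_add) auto
qed

subsection \<open>Utilities are affine in the contract\<close>

text \<open>The weights \<open>1 - s\<close> and \<open>s\<close> add up to 1, so the cost is
  counted exactly once.\<close>

lemma agent_utility_comb:
  assumes "\<pi> \<in> strategies I" "length t = m" "length t' = m"
  shows "agent_utility I ((!) (comb s t t')) \<pi> =
    (1 - s) * agent_utility I ((!) t) \<pi> + s * agent_utility I ((!) t') \<pi>"
proof -
  let ?C = "\<lambda>x. \<Sum>i \<in> taken I \<pi> x. cost I i" and ?o = "final_outcome I \<pi>"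
  have "agent_utility I ((!) (comb s t t')) \<pi> = measure_pmf.expectation (outcomes_pmf I)
      (\<lambda>x. (1 - s) * (t ! ?o x - ?C x) + s * (t' ! ?o x - ?C x))"
    unfolding agent_utility_def using final_outcome_lt[OF assms(1)] assms(2,3)
    by (intro expectation_cong) (simp add: nth_comb algebra_simps)
  thus ?thesis
    unfolding agent_utility_def using finite_outcomes_pmf[OF valid]
    by (subst (asm) expectation_add) auto
qed

lemma agent_utility_towards_rewards:
  assumes "\<pi> \<in> strategies I" "length t = m"
  shows "agent_utility I ((!) (comb s t (rvs rs))) \<pi> =
    agent_utility I ((!) t) \<pi> + s * principal_utility I ((!) t) \<pi>"
proof -
  let ?C = "\<lambda>x. \<Sum>i \<in> taken I \<pi> x. cost I i" and ?o = "final_outcome I \<pi>"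
  have "agent_utility I ((!) (comb s t (rvs rs))) \<pi> = measure_pmf.expectation (outcomes_pmf I)
      (\<lambda>x. (t ! ?o x - ?C x) + s * (reward I (?o x) - t ! ?o x))"
    unfolding agent_utility_def using final_outcome_lt[OF assms(1)] assms(2) length_rs reward
    by (intro expectation_cong) (simp add: nth_comb algebra_simps)
  thus ?thesis
    unfolding agent_utility_def principal_utility_def using finite_outcomes_pmf[OF valid]
    by (subst (asm) expectation_add) auto
qed

text \<open>The law of the final outcome under a fixed strategy does not depend on the contract: its
  negated probabilities are the coefficients of \<open>g\<close>, and the expected reward is the
  constant. Nonnegative payments only lower the value, hence the bound.\<close>

lemma principal_utility_affine:
  assumes "\<pi> \<in> strategies I"
  obtains g B where "length g = Suc m"
    "\<And>t. length t = m \<Longrightarrow> principal_utility I ((!) t) \<pi> = aff g t"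
    "\<And>t. length t = m \<Longrightarrow> (\<And>j. j < m \<Longrightarrow> 0 \<le> t ! j) \<Longrightarrow> aff g t \<le> B"
proof -
  let ?M = "outcomes_pmf I" and ?o = "final_outcome I \<pi>"
  define B where "B = measure_pmf.expectation ?M (\<lambda>x. reward I (?o x))"
  define P where "P = pmf (map_pmf ?o ?M)"
  define g where "g = map (\<lambda>j. - P j) [0..<m] @ [B]"
  have fin: "finite (set_pmf ?M)" by (rule finite_outcomes_pmf[OF valid])
  have u: "principal_utility I ((!) t) \<pi> = aff g t" if t: "length t = m" for t
  proof -
    have "measure_pmf.expectation ?M (\<lambda>x. t ! ?o x) = measure_pmf.expectation (map_pmf ?o ?M) ((!) t)"
      by simp
    also have "\<dots> = (\<Sum>j<m. t ! j * P j)"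
      unfolding P_def using final_outcome_lt[OF assms]
      by (intro integral_measure_pmf_real) auto
    finally have "principal_utility I ((!) t) \<pi> = B - (\<Sum>j<m. t ! j * P j)"
      unfolding principal_utility_def B_def by (subst expectation_diff[OF fin]) simp
    thus ?thesis using t by (simp add: aff_sum g_def nth_append sum_negf mult.commute)
  qed
  have "aff g t \<le> B" if "length t = m" "\<And>j. j < m \<Longrightarrow> 0 \<le> t ! j" for t
  proof -
    have "0 \<le> (\<Sum>j<m. P j * t ! j)"
      using that(2) by (intro sum_nonneg mult_nonneg_nonneg) (auto simp: P_def)
    thus ?thesis using that(1) by (simp add: aff_sum g_def nth_append sum_negf)
  qed
  thus thesis using u by (intro that[of g B]) (auto simp: g_def)
qed

lemma utility_cong:
  assumes "\<pi> \<in> strategies I" "\<And>j. j < m \<Longrightarrow> t j = t' j"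
  shows "agent_utility I t \<pi> = agent_utility I t' \<pi>" "principal_utility I t \<pi> = principal_utility I t' \<pi>"
  unfolding agent_utility_def principal_utility_def
  using final_outcome_lt[OF assms(1)] assms(2) by (auto intro!: expectation_cong)

text \<open>
  The agent's utility under \<open>\<pi>\<close> lies below \<open>V\<close>, and both are affine on a segment that ends in
  \<open>t'\<close> and has \<open>t\<close> in its interior: if they touch at \<open>t\<close>, they agree at \<open>t'\<close>.
\<close>

lemma agent_optimal_persists:
  assumes "length t = m" "length t' = m" "same_order L t t'" "\<pi> \<in> agent_optimal I ((!) t)"
  shows "\<pi> \<in> agent_optimal I ((!) t')"
proof -
  have \<pi>: "\<pi> \<in> strategies I" "agent_utility I ((!) t) \<pi> = V t"
    using assms(4) agent_optimal_iff[OF assms(1)] by auto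
  obtain s where s: "0 < s" "same_order L t (comb (- s) t t')"
    using same_order_extrapolate[of L t t'] length_lfuns assms by auto
  have "(1 + s) * V t - s * agent_utility I ((!) t') \<pi> = agent_utility I ((!) (comb (- s) t t')) \<pi>"
    using agent_utility_comb[OF \<pi>(1) assms(1,2), of "- s"] \<pi>(2) by simp
  also have "\<dots> \<le> V (comb (- s) t t')" by (intro agent_value(1) \<pi>(1)) (simp add: assms)
  also have "\<dots> = (1 + s) * V t - s * V t'"
    using V_extrapolate[OF assms(1-3) s(2)] by simp
  finally have "V t' \<le> agent_utility I ((!) t') \<pi>" using s(1) by simp
  thus ?thesis using agent_optimal_iff[OF assms(2)] agent_value(1)[OF assms(2) \<pi>(1)] \<pi>(1) by simp
qed

end

section \<open>Symbolic perturbation and the one-sided derivative of the agent's value\<close>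

section \<open>The value of the principal as a directional derivative\<close>

definition mass_on :: "(real \<Rightarrow> bool) \<Rightarrow> (real \<times> real) list \<Rightarrow> real" where
  "mass_on R A = (\<Sum>a\<leftarrow>filter (\<lambda>a. R (fst a)) A. snd a)"

lemma pick_max:
  fixes \<phi> :: "'a \<Rightarrow> real"
  assumes "\<And>x y. x \<in> insert a (set xs) \<Longrightarrow> y \<in> insert a (set xs) \<Longrightarrow> lt x y \<longleftrightarrow> \<phi> x < \<phi> y"
  shows "\<phi> (pick lt a xs) = Max (\<phi> ` insert a (set xs))"
  using assms
proof (induction xs arbitrary: a)
  case (Cons x xs)
  let ?a = "if lt a x then x else a"
  have "\<phi> (pick lt a (x # xs)) = \<phi> (pick lt ?a xs)" by (simp add: pick_def)
  also have "\<dots> = Max (\<phi> ` insert ?a (set xs))"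
    using Cons.prems by (intro Cons.IH) (auto split: if_splits)
  also have "\<phi> ?a = max (\<phi> a) (\<phi> x)" using Cons.prems[of a x] by auto
  hence "Max (\<phi> ` insert ?a (set xs)) = Max (\<phi> ` insert a (set (x # xs)))"
    by (cases "xs = []") (auto simp: max.assoc)
  finally show ?case .
qed (simp add: pick_def)

lemma prob_expectation:
  "set_pmf M \<subseteq> {..<m} \<Longrightarrow> measure_pmf.prob M B = (\<Sum>j<m. if j \<in> B then pmf M j else 0)" for m :: nat
proof -
  assume "set_pmf M \<subseteq> {..<m}"
  hence "measure_pmf.expectation M (indicator B) = (\<Sum>j<m. indicator B j * pmf M j)"
    by (intro integral_measure_pmf_real) auto
  thus ?thesis by (simp add: indicator_def sum.inter_restrict)
qed

lemma sum_count_list: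
  fixes f :: "'a \<Rightarrow> real"
  shows "(\<Sum>x\<in>set xs. real (count_list xs x) * f x) = (\<Sum>x\<leftarrow>xs. f x)"
proof (induction xs)
  case (Cons x xs)
  have "(\<Sum>y\<in>set (x # xs). real (count_list (x # xs) y) * f y) =
      (\<Sum>y\<in>set (x # xs). (if y = x then f y else 0) + real (count_list xs y) * f y)"
    by (intro sum.cong) (auto simp: algebra_simps)
  also have "\<dots> = f x + (\<Sum>y\<in>set (x # xs). real (count_list xs y) * f y)"
    by (simp add: sum.distrib)
  also have "(\<Sum>y\<in>set (x # xs). real (count_list xs y) * f y) =
      (\<Sum>y\<in>set xs. real (count_list xs y) * f y)"
    by (intro sum.mono_neutral_right) (auto simp: count_list_0_iff)
  finally show ?case using Cons by simp
qed simp

definition lex_at :: "real \<Rightarrow> lex \<Rightarrow> real" where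
  "lex_at s u = (1 - s) * rv (fst u) + s * rv (snd u)"

definition separates :: "real \<Rightarrow> lex set \<Rightarrow> bool" where
  "separates s P \<longleftrightarrow> (\<forall>u \<in> P. \<forall>v \<in> P. lex_less u v \<longleftrightarrow> lex_at s u < lex_at s v)"

text \<open>For small \<open>s > 0\<close>, the sign of \<open>(1 - s) * a + s * b\<close> is that
  of \<open>a\<close>, or that of \<open>b\<close> if \<open>a = 0\<close>.\<close>

lemma eventually_separates:
  assumes "finite P"
  shows "eventually (\<lambda>s. separates s P) (at_right 0)"
  unfolding separates_def
proof (intro eventually_ball_finite assms ballI)
  fix u v
  define a b where "a = rv (fst v) - rv (fst u)" "b = rv (snd v) - rv (snd u)"
  have diff: "lex_at s u < lex_at s v \<longleftrightarrow> 0 < (1 - s) * a + s * b" for s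
    by (simp add: lex_at_def a_b_def algebra_simps)
  have less: "lex_less u v \<longleftrightarrow> 0 < a \<or> a = 0 \<and> 0 < b"
    by (auto simp: lex_less_def a_b_def)
  have lim: "((\<lambda>s. (1 - s) * a + s * b) \<longlongrightarrow> (1 - 0) * a + 0 * b) (at_right 0)"
    by (intro tendsto_intros)
  consider "0 < a" | "a < 0" | "a = 0" by linarith
  thus "eventually (\<lambda>s. lex_less u v \<longleftrightarrow> lex_at s u < lex_at s v) (at_right 0)"
  proof cases
    case 1
    hence "eventually (\<lambda>s. 0 < (1 - s) * a + s * b) (at_right 0)"
      using lim by (intro order_tendstoD(1)) auto
    thus ?thesis by (rule eventually_mono) (use 1 less diff in auto)
  next
    case 2
    hence "eventually (\<lambda>s. (1 - s) * a + s * b < 0) (at_right 0)"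
      using lim by (intro order_tendstoD(2)) auto
    thus ?thesis by (rule eventually_mono) (use 2 less diff in auto)
  next
    case 3
    have "eventually (\<lambda>s :: real. 0 < s) (at_right 0)" by (rule eventually_at_right_less)
    thus ?thesis by (rule eventually_mono) (use 3 less diff in \<open>auto simp: zero_less_mult_iff\<close>)
  qed
qed

context encoded_inst
begin

definition ratoms :: "real list \<Rightarrow> box \<Rightarrow> (real \<times> real) list" where
  "ratoms t b = map (\<lambda>j. (capped m t b j, rv (snd b ! j))) [0..<m]"

definition ratomss :: "real list \<Rightarrow> (real \<times> real) list list" where
  "ratomss t = map (ratoms t) all_boxes"

lemma mass_on_ratoms:
  "mass_on R (ratoms t b) = (\<Sum>j<m. if R (capped m t b j) then rv (snd b ! j) else 0)"
  by (simp add: mass_on_def ratoms_def sum_list_map_filter' comp_def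
      interv_sum_list_conv_sum_set_nat atLeast0LessThan cong: if_cong)

text \<open>\<open>R\<close> will be \<open>v \<le> u\<close> or \<open>v < u\<close>: a maximum
  satisfies it iff all members do, and independence turns this into a product. The zero box supplies
  the factor for the constant \<open>t ! 0\<close>.\<close>

lemma prob_top_value:
  assumes t: "length t = m"
    and R: "\<And>X :: real set. finite X \<Longrightarrow> X \<noteq> {} \<Longrightarrow> R (Max X) \<longleftrightarrow> (\<forall>y \<in> X. R y)"
  shows "measure_pmf.prob (outcomes_pmf I) {x. R (top_value t x)} =
    (\<Prod>A\<leftarrow>ratomss t. mass_on R A)"
proof -
  let ?B = "\<lambda>i. {a. R (capped m t (act_box i) a)}"
  have "{x. R (top_value t x)} = (if R (t ! 0) then Pi {..<n_act I} ?B else {})"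
    by (auto simp: top_value_def R)
  hence "measure_pmf.prob (outcomes_pmf I) {x. R (top_value t x)} =
      (if R (t ! 0) then 1 else 0) * (\<Prod>i<n_act I. measure_pmf.prob (outcome_pmf I i) (?B i))"
    unfolding outcomes_pmf_def by (simp add: measure_Pi_pmf_Pi)
  also have "(\<Prod>i<n_act I. measure_pmf.prob (outcome_pmf I i) (?B i)) =
      (\<Prod>i<n_act I. mass_on R (ratoms t (act_box i)))"
  proof (intro prod.cong refl)
    fix i assume "i \<in> {..<n_act I}"
    hence i: "i < n_act I" by simp
    show "measure_pmf.prob (outcome_pmf I i) (?B i) = mass_on R (ratoms t (act_box i))"
      unfolding prob_expectation[OF supp[OF i]] mass_on_ratoms
      using prob[OF i] by (intro sum.cong) auto
  qed
  also have "(if R (t ! 0) then 1 else 0) = mass_on R (ratoms t (zero_box m))"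
  proof -
    have "mass_on R (ratoms t (zero_box m)) =
        (\<Sum>j<m. if j = 0 then (if R (capped m t (zero_box m) 0) then 1 else 0) else 0)"
      unfolding mass_on_ratoms by (intro sum.cong) (auto simp: zero_box_def)
    also have "\<dots> = (if R (t ! 0) then 1 else 0)"
      using m_pos zval_zero_box[OF m_pos t] by (simp add: sum.delta capped_def min_absorb1)
    finally show ?thesis by simp
  qed
  also have "mass_on R (ratoms t (zero_box m)) * (\<Prod>i<n_act I. mass_on R (ratoms t (act_box i))) =
      (\<Prod>A\<leftarrow>ratomss t. mass_on R A)"
  proof -
    have "(\<Prod>b\<leftarrow>zip cs ps. mass_on R (ratoms t b)) = (\<Prod>i<n_act I. mass_on R (ratoms t (act_box i)))"
      using length_cs length_ps by (simp add: prod.list_conv_set_nth atLeast0LessThan)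
    thus ?thesis by (simp add: ratomss_def all_boxes_def comp_def)
  qed
  finally show ?thesis .
qed

text \<open>The top value is always one of the \<open>us\<close>, and its point masses are
  differences of the two products. The sum runs over the list, repetitions included, and
  \<open>count_list\<close> corrects for them.\<close>

lemma V_formula:
  assumes t: "length t = m"
  defines "us \<equiv> map fst (concat (ratomss t))"
  shows "V t = (\<Sum>u\<leftarrow>us. u * ((\<Prod>A\<leftarrow>ratomss t. mass_on (\<lambda>v. v \<le> u) A) -
    (\<Prod>A\<leftarrow>ratomss t. mass_on (\<lambda>v. v < u) A)) / count_list us u)"
proof -
  let ?M = "outcomes_pmf I" and ?T = "top_value t"
  let ?D = "\<lambda>u. (\<Prod>A\<leftarrow>ratomss t. mass_on (\<lambda>v. v \<le> u) A) - (\<Prod>A\<leftarrow>ratomss t. mass_on (\<lambda>v. v < u) A)"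
  have us: "set us = {capped m t b j |b j. b \<in> set all_boxes \<and> j < m}"
    by (force simp: us_def ratomss_def ratoms_def image_iff)
  have point: "pmf (map_pmf ?T ?M) u = ?D u" for u
  proof -
    have "{x. ?T x \<le> u} = {x. ?T x < u} \<union> {x. ?T x = u}" by auto
    hence "measure_pmf.prob ?M {x. ?T x \<le> u} =
        measure_pmf.prob ?M {x. ?T x < u} + measure_pmf.prob ?M {x. ?T x = u}"
      by (simp only:) (rule measure_pmf.finite_measure_Union; auto)
    moreover have "?T -` {u} = {x. ?T x = u}" by auto
    ultimately show ?thesis
      using prob_top_value[OF t, of "\<lambda>v. v \<le> u"] prob_top_value[OF t, of "\<lambda>v. v < u"]
      by (simp add: pmf_map)
  qed
  have "?T x \<in> set us" if x: "x \<in> set_pmf ?M" for x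
  proof -
    have "?T x \<in> insert (t ! 0) ((\<lambda>i. capped m t (act_box i) (x i)) ` {..<n_act I})"
      unfolding top_value_def by (intro Max_in) auto
    moreover have "t ! 0 = capped m t (zero_box m) 0"
      using zval_zero_box[OF m_pos t] by (simp add: capped_def)
    ultimately have "?T x = capped m t (zero_box m) 0 \<or>
        (\<exists>i<n_act I. ?T x = capped m t (act_box i) (x i))" by auto
    thus ?thesis
      unfolding us set_all_boxes using m_pos outcomes_lt[OF x] by blast
  qed
  hence "measure_pmf.expectation (map_pmf ?T ?M) (\<lambda>u. u) = (\<Sum>u\<in>set us. u * pmf (map_pmf ?T ?M) u)"
    by (intro integral_measure_pmf_real) auto
  hence "V t = (\<Sum>u\<in>set us. u * ?D u)" by (simp add: V_def point)
  also have "\<dots> = (\<Sum>u\<in>set us. real (count_list us u) * (u * ?D u / count_list us u))"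
    by (intro sum.cong) (auto simp: count_list_0_iff)
  also have "\<dots> = (\<Sum>u\<leftarrow>us. u * ?D u / count_list us u)"
    by (rule sum_count_list)
  finally show ?thesis .
qed

text \<open>All pairs that the score compares. They are finitely many, so one small \<open>s\<close>
  separates them all.\<close>

definition points :: "frac list \<Rightarrow> lex set" where
  "points t = lval t rs ` L \<union> set (zip t rs)"

definition frac_atoms :: "frac list \<Rightarrow> (lex \<times> frac) list list" where
  "frac_atoms t = map (atoms m t rs) all_boxes"

lemma finite_points: "finite (points t)"
  by (simp add: points_def)

context
  fixes t :: "frac list" and s :: real
  assumes t: "length t = m" and sep: "separates s (points t)"
begin

abbreviation (input) ts :: "real list" where "ts \<equiv> comb s (rvs t) (rvs rs)"

lemma lex_less_iff: "u \<in> points t \<Longrightarrow> v \<in> points t \<Longrightarrow> lex_less u v \<longleftrightarrow> lex_at s u < lex_at s v"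
  using sep by (simp add: separates_def)

lemma lex_at_lval: "f \<in> L \<Longrightarrow> lex_at s (lval t rs f) = aff (rvs f) ts"
  using length_lfuns t length_rs by (simp add: lex_at_def lval_def aff_comb)

lemma lex_at_index:
  assumes "b \<in> set all_boxes"
  shows "index m t rs b \<in> points t" "lex_at s (index m t rs b) = zval m ts b"
proof -
  obtain v vs where v: "map (lval t rs) (zfuns m b) = v # vs"
    using zfuns_nonempty[OF wf_all_boxes[OF assms]] by (cases "map (lval t rs) (zfuns m b)") auto
  have set: "insert v (set vs) = lval t rs ` set (zfuns m b)"
    by (metis v list.set_map list.simps(15))
  have sub: "insert v (set vs) \<subseteq> points t"
    unfolding set points_def using zfuns_L[OF assms] by blast
  show "index m t rs b \<in> points t"
    unfolding index_def v using pick_in[of lex_less v vs] sub by auto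
  have "lex_at s (index m t rs b) = Max (lex_at s ` insert v (set vs))"
    unfolding index_def v list.case using sub lex_less_iff by (intro pick_max) blast
  also have "lex_at s ` insert v (set vs) = (\<lambda>f. aff (rvs f) ts) ` set (zfuns m b)"
    unfolding set image_image using lex_at_lval zfuns_L[OF assms] by (intro image_cong) auto
  finally show "lex_at s (index m t rs b) = zval m ts b" by (simp add: zval_def)
qed

text \<open>The algorithm never sees \<open>s\<close>: its lexicographic atoms, evaluated at any
  separating \<open>s\<close>, are those of the perturbed contract.\<close>

lemma atoms_nth:
  assumes b: "b \<in> set all_boxes"
  shows "fst ` set (atoms m t rs b) \<subseteq> points t"
    and "map (\<lambda>a. (lex_at s (fst a), rv (snd a))) (atoms m t rs b) = ratoms ts b"
proof -
  let ?z = "index m t rs b"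
  have len: "length (snd b) = m" using wf_all_boxes[OF b] by (simp add: wf_box_def)
  have pt: "(t ! j, rs ! j) \<in> points t" if "j < m" for j
    using that t length_rs by (auto simp: points_def set_zip)
  have z: "?z \<in> points t" "lex_at s ?z = zval m ts b" using lex_at_index[OF b] by auto
  show "fst ` set (atoms m t rs b) \<subseteq> points t"
  proof
    fix u assume "u \<in> fst ` set (atoms m t rs b)"
    then obtain q where "q \<in> set (zip (zip t rs) (snd b))" "u \<in> {fst q, ?z}"
      by (auto simp: atoms_def)
    thus "u \<in> points t"
      using z(1) set_zip_leftD[of "fst q" "snd q" "zip t rs" "snd b"] by (auto simp: points_def)
  qed
  show "map (\<lambda>a. (lex_at s (fst a), rv (snd a))) (atoms m t rs b) = ratoms ts b"
  proof (rule nth_equalityI)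
    fix j assume "j < length (map (\<lambda>a. (lex_at s (fst a), rv (snd a))) (atoms m t rs b))"
    hence j: "j < m" using len t length_rs by (simp add: atoms_def)
    have "lex_at s (t ! j, rs ! j) = ts ! j"
      using j t length_rs by (simp add: lex_at_def nth_comb)
    hence "lex_at s (if lex_less (t ! j, rs ! j) ?z then (t ! j, rs ! j) else ?z) = capped m ts b j"
      using lex_less_iff[OF pt[OF j] z(1)] z(2) by (simp add: capped_def min_def)
    thus "map (\<lambda>a. (lex_at s (fst a), rv (snd a))) (atoms m t rs b) ! j = ratoms ts b ! j"
      using j len t length_rs by (auto simp: atoms_def ratoms_def split: if_splits)
  qed (use len t length_rs in \<open>simp add: atoms_def ratoms_def\<close>)
qed

lemma rv_weight:
  assumes u: "u \<in> points t"
  shows "rv (weight (frac_atoms t) u) =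
    ((\<Prod>A\<leftarrow>ratomss ts. mass_on (\<lambda>v. v \<le> lex_at s u) A) - (\<Prod>A\<leftarrow>ratomss ts. mass_on (\<lambda>v. v < lex_at s u) A)) /
    count_list (map fst (concat (ratomss ts))) (lex_at s u)"
proof -
  let ?r = "\<lambda>a. (lex_at s (fst a), rv (snd a))"
  have AA: "ratomss ts = map (map ?r) (frac_atoms t)"
    using atoms_nth(2) by (simp add: ratomss_def frac_atoms_def)
  have pts: "fst a \<in> points t" if "A \<in> set (frac_atoms t)" "a \<in> set A" for A a
    using atoms_nth(1) that by (auto simp: frac_atoms_def)
  have "rv (mass (filter (\<lambda>a. \<not> lex_less u (fst a)) A)) = mass_on (\<lambda>v. v \<le> lex_at s u) (map ?r A)"
    if "A \<in> set (frac_atoms t)" for A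
  proof -
    have "filter (\<lambda>a. \<not> lex_less u (fst a)) A = filter (\<lambda>a. lex_at s (fst a) \<le> lex_at s u) A"
      using lex_less_iff[OF u] pts[OF that] by (intro filter_cong) auto
    thus ?thesis by (simp add: mass_def mass_on_def filter_map comp_def)
  qed
  hence le: "(\<Prod>A\<leftarrow>frac_atoms t. rv (mass (filter (\<lambda>a. \<not> lex_less u (fst a)) A))) =
      (\<Prod>A\<leftarrow>ratomss ts. mass_on (\<lambda>v. v \<le> lex_at s u) A)"
    unfolding AA map_map by (intro arg_cong[of _ _ prod_list] map_cong) auto
  have "rv (mass (filter (\<lambda>a. lex_less (fst a) u) A)) = mass_on (\<lambda>v. v < lex_at s u) (map ?r A)"
    if "A \<in> set (frac_atoms t)" for A
  proof -
    have "filter (\<lambda>a. lex_less (fst a) u) A = filter (\<lambda>a. lex_at s (fst a) < lex_at s u) A"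
      using lex_less_iff[OF _ u] pts[OF that] by (intro filter_cong) auto
    thus ?thesis by (simp add: mass_def mass_on_def filter_map comp_def)
  qed
  hence lt: "(\<Prod>A\<leftarrow>frac_atoms t. rv (mass (filter (\<lambda>a. lex_less (fst a) u) A))) =
      (\<Prod>A\<leftarrow>ratomss ts. mass_on (\<lambda>v. v < lex_at s u) A)"
    unfolding AA map_map by (intro arg_cong[of _ _ prod_list] map_cong) auto
  have "filter (\<lambda>a. \<not> lex_less u (fst a) \<and> \<not> lex_less (fst a) u) (concat (frac_atoms t)) =
      filter (\<lambda>a. lex_at s u = lex_at s (fst a)) (concat (frac_atoms t))"
    using lex_less_iff[OF u] lex_less_iff[OF _ u] pts by (intro filter_cong) force+
  moreover have "map fst (concat (ratomss ts)) = map (\<lambda>a. lex_at s (fst a)) (concat (frac_atoms t))"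
    by (simp add: AA map_concat comp_def)
  ultimately have "length (filter (\<lambda>a. \<not> lex_less u (fst a) \<and> \<not> lex_less (fst a) u) (concat (frac_atoms t))) =
      count_list (map fst (concat (ratomss ts))) (lex_at s u)"
    by (simp add: count_list_eq_length_filter filter_map comp_def)
  thus ?thesis
    unfolding weight_def using le lt by (simp add: comp_def sum_list_triv)
qed

text \<open>The weights rest on comparisons only and do not depend on \<open>s\<close>, while each
  value is affine in \<open>s\<close>.\<close>

lemma V_near:
  "V ts = (\<Sum>a\<leftarrow>concat (frac_atoms t). rv (fst (fst a)) * rv (weight (frac_atoms t) (fst a))) +
    s * rv (score (frac_atoms t))"
proof -
  let ?r = "\<lambda>a. (lex_at s (fst a), rv (snd a))"
  have AA: "ratomss ts = map (map ?r) (frac_atoms t)"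
    using atoms_nth(2) by (simp add: ratomss_def frac_atoms_def)
  have pts: "fst a \<in> points t" if "a \<in> set (concat (frac_atoms t))" for a
    using atoms_nth(1) that by (auto simp: frac_atoms_def)
  have us: "map fst (concat (ratomss ts)) = map (\<lambda>a. lex_at s (fst a)) (concat (frac_atoms t))"
    by (simp add: AA map_concat comp_def)
  have "V ts = (\<Sum>a\<leftarrow>concat (frac_atoms t). lex_at s (fst a) * rv (weight (frac_atoms t) (fst a)))"
    unfolding V_formula[of ts, OF length_comb[of "rvs rs" "rvs t" s, unfolded length_map t length_rs, OF refl]]
    unfolding us map_map comp_def using rv_weight[OF pts]
    by (intro arg_cong[of _ _ sum_list] map_cong) (simp_all add: us comp_def)
  also have "\<dots> = (\<Sum>a\<leftarrow>concat (frac_atoms t). rv (fst (fst a)) * rv (weight (frac_atoms t) (fst a)) +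
      s * ((rv (snd (fst a)) - rv (fst (fst a))) * rv (weight (frac_atoms t) (fst a))))"
    by (intro arg_cong[of _ _ sum_list] map_cong) (simp_all add: lex_at_def algebra_simps)
  also have "\<dots> = (\<Sum>a\<leftarrow>concat (frac_atoms t). rv (fst (fst a)) * rv (weight (frac_atoms t) (fst a))) +
    s * rv (score (frac_atoms t))"
    by (simp add: sum_list_addf sum_list_const_mult score_def comp_def)
  finally show ?thesis .
qed

end

text \<open>
  Moving the contract from \<open>t\<close> towards the rewards adds to the agent's utility a small multiple
  of the principal's: the agent then breaks ties in favour of the principal.
\<close>

lemma favourable_value:
  assumes t: "length t = m"
    and lin: "eventually (\<lambda>s. V (comb s t (rvs rs)) = \<alpha> + s * \<beta>) (at_right 0)"
    and \<pi>: "\<pi> \<in> favourable I ((!) t)"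
  shows "principal_utility I ((!) t) \<pi> = \<beta>"
proof -
  let ?a = "agent_utility I ((!) t)" and ?b = "principal_utility I ((!) t)"
  let ?t = "\<lambda>s. comb s t (rvs rs)"
  have \<pi>S: "\<pi> \<in> strategies I" and opt: "\<And>\<rho>. \<rho> \<in> strategies I \<Longrightarrow> ?a \<rho> \<le> ?a \<pi>"
    using \<pi> by (auto simp: favourable_def agent_optimal_def)
  have tie: "?b \<rho> \<le> ?b \<pi>" if "\<rho> \<in> strategies I" "?a \<rho> = ?a \<pi>" for \<rho>
    using \<pi> that by (auto simp: favourable_def agent_optimal_def)
  have u: "agent_utility I ((!) (?t s)) \<rho> = ?a \<rho> + s * ?b \<rho>" if "\<rho> \<in> strategies I" for \<rho> s
    using agent_utility_towards_rewards[OF that t] .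
  have len: "length (?t s) = m" for s using t length_rs by simp
  \<comment> \<open>For each of finitely many strategies, a strict deficit at \<open>s = 0\<close>
    survives small \<open>s\<close>, and in a tie \<pi> has at least as large a slope.\<close>
  have "eventually (\<lambda>s. \<forall>\<rho> \<in> strategies I. ?a \<rho> + s * ?b \<rho> \<le> ?a \<pi> + s * ?b \<pi>) (at_right 0)"
  proof (intro eventually_ball_finite finite_strategies ballI)
    fix \<rho> assume \<rho>: "\<rho> \<in> strategies I"
    show "eventually (\<lambda>s. ?a \<rho> + s * ?b \<rho> \<le> ?a \<pi> + s * ?b \<pi>) (at_right 0)"
    proof (cases "?a \<rho> = ?a \<pi>")
      case True
      have "eventually (\<lambda>s :: real. 0 < s) (at_right 0)" by (rule eventually_at_right_less)
      thus ?thesis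
        by (rule eventually_mono) (use True tie[OF \<rho> True] in \<open>simp add: mult_left_mono\<close>)
    next
      case False
      have "((\<lambda>s. (?a \<pi> + s * ?b \<pi>) - (?a \<rho> + s * ?b \<rho>)) \<longlongrightarrow> (?a \<pi> + 0 * ?b \<pi>) - (?a \<rho> + 0 * ?b \<rho>)) (at_right 0)"
        by (intro tendsto_intros)
      hence "eventually (\<lambda>s. 0 < (?a \<pi> + s * ?b \<pi>) - (?a \<rho> + s * ?b \<rho>)) (at_right 0)"
        using False opt[OF \<rho>] by (intro order_tendstoD(1)) auto
      thus ?thesis by (rule eventually_mono) simp
    qed
  qed
  hence "eventually (\<lambda>s. V (?t s) = ?a \<pi> + s * ?b \<pi>) (at_right 0)"
  proof (rule eventually_mono)
    fix s assume *: "\<forall>\<rho> \<in> strategies I. ?a \<rho> + s * ?b \<rho> \<le> ?a \<pi> + s * ?b \<pi>"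
    obtain \<rho> where "\<rho> \<in> strategies I" "agent_utility I ((!) (?t s)) \<rho> = V (?t s)"
      using agent_value(2)[OF len] by blast
    hence "V (?t s) \<le> ?a \<pi> + s * ?b \<pi>" using * u by metis
    moreover have "?a \<pi> + s * ?b \<pi> \<le> V (?t s)" using agent_value(1)[OF len \<pi>S, of s] u[OF \<pi>S] by simp
    ultimately show "V (?t s) = ?a \<pi> + s * ?b \<pi>" by simp
  qed
  hence "eventually (\<lambda>s. \<alpha> + s * \<beta> = ?a \<pi> + s * ?b \<pi>) (at_right 0)"
    using lin by eventually_elim simp
  then obtain e where e: "0 < e" "\<And>s. 0 < s \<Longrightarrow> s < e \<Longrightarrow> \<alpha> + s * \<beta> = ?a \<pi> + s * ?b \<pi>"
    unfolding eventually_at_right_field by auto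
  \<comment> \<open>Evaluation at the two points \<open>e / 2\<close> and \<open>e / 3\<close>
    determines an affine function.\<close>
  have "2 * \<alpha> + e * \<beta> = 2 * ?a \<pi> + e * ?b \<pi>" "3 * \<alpha> + e * \<beta> = 3 * ?a \<pi> + e * ?b \<pi>"
    using e(1) e(2)[of "e / 2"] e(2)[of "e / 3"] by (simp_all add: field_simps)
  hence "e * ?b \<pi> = e * \<beta>" by linarith
  thus ?thesis using e(1) by simp
qed

lemma best_response_favourable:
  "linear_order_on (strategies I) ord \<Longrightarrow> best_response I ord t \<in> favourable I t"
  using theI'[OF best_response_unique] unfolding best_response_def by blast

text \<open>The score does not involve \<open>ord\<close>: all favourable strategies give the
  principal the same utility.\<close>

lemma principal_value_score:
  assumes "linear_order_on (strategies I) ord" "length t = m"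
  shows "principal_value I ord ((!) (rvs t)) = rv (score (frac_atoms t))"
  unfolding principal_value_def
proof (rule favourable_value)
  show "eventually (\<lambda>s. V (comb s (rvs t) (rvs rs)) =
      (\<Sum>a\<leftarrow>concat (frac_atoms t). rv (fst (fst a)) * rv (weight (frac_atoms t) (fst a))) +
      s * rv (score (frac_atoms t))) (at_right 0)"
    using eventually_separates[OF finite_points] by (rule eventually_mono) (rule V_near[OF assms(2)])
qed (use assms best_response_favourable in auto)

end

section \<open>Optimality of the best candidate, and its translation to encoded instances\<close>

section \<open>Correctness\<close>

lemma length_cand: "(\<And>f. f \<in> set F \<Longrightarrow> length f = Suc k) \<Longrightarrow> c \<in> set (cand k F) \<Longrightarrow> length c = k"
proof (induction k arbitrary: F c)
  case (Suc k)
  from Suc.prems(2) obtain a as c' where c: "a # as \<in> set F" "length c = Suc (length c')"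
    "c' \<in> set (cand k (map (elim a as) F))"
    by (auto split: list.splits if_splits)
  have "length (elim a as f) = Suc k" if "f \<in> set F" for f
    using Suc.prems(1)[OF that] Suc.prems(1)[OF c(1)] by (cases f) (auto simp: elim_def)
  thus ?case using Suc.IH[OF _ c(3)] c(2) by auto
qed simp

lemma nonneg_iff: "nonneg t \<longleftrightarrow> (\<forall>x \<in> set (rvs t). 0 \<le> x)"
  by (auto simp: nonneg_def filter_empty_conv not_less)

lemma best_greatest:
  assumes "xs \<noteq> []"
  shows "\<exists>v \<in> set xs. best xs = snd v \<and> (\<forall>w \<in> set xs. rv (fst w) \<le> rv (fst v))"
proof -
  obtain v vs where xs: "xs = v # vs" using assms by (cases xs) auto
  let ?p = "pick (\<lambda>x y. fless (fst x) (fst y)) v vs"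
  have "rv (fst ?p) = Max ((\<lambda>x. rv (fst x)) ` insert v (set vs))"
    by (rule pick_max) simp
  hence "\<forall>w \<in> set xs. rv (fst w) \<le> rv (fst ?p)" using xs by auto
  moreover have "?p \<in> set xs" using pick_in[of _ v vs] xs by auto
  ultimately show ?thesis by (intro bexI[of _ ?p]) (auto simp: best_def xs)
qed

context encoded_inst
begin

abbreviation candidates :: "frac list list" where
  "candidates \<equiv> feasible m all_boxes"

lemma length_candidate: "t \<in> set candidates \<Longrightarrow> length t = m"
  unfolding feasible_def using length_walls by (auto intro: length_cand)

text \<open>With \<pi> held fixed, \<open>cand_improve\<close> moves the contract within the closure
  of its cell, where \<pi> stays optimal for the agent and its utility to the principal is affine
  and bounded above.\<close>

lemma better_candidate:
  assumes "is_contract I t" "\<pi> \<in> agent_optimal I t"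
  shows "\<exists>c \<in> set candidates. \<pi> \<in> agent_optimal I ((!) (rvs c)) \<and>
    principal_utility I t \<pi> \<le> principal_utility I ((!) (rvs c)) \<pi>"
proof -
  define x where "x = map t [0..<m]"
  have x: "length x = m" "\<And>j. j < m \<Longrightarrow> x ! j = t j" "\<And>y. y \<in> set x \<Longrightarrow> 0 \<le> y"
    using assms(1) m by (auto simp: x_def is_contract_def)
  have \<pi>S: "\<pi> \<in> strategies I" using assms(2) by (simp add: agent_optimal_def)
  have \<pi>x: "\<pi> \<in> agent_optimal I ((!) x)"
    using assms(2) utility_cong(1)[of _ t "(!) x"] x(2) by (auto simp: agent_optimal_def)
  obtain g B where g: "length g = Suc m"
    "\<And>t. length t = m \<Longrightarrow> principal_utility I ((!) t) \<pi> = aff g t"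
    "\<And>t. length t = m \<Longrightarrow> (\<And>j. j < m \<Longrightarrow> 0 \<le> t ! j) \<Longrightarrow> aff g t \<le> B"
    using principal_utility_affine[OF \<pi>S] by blast
  have coords: "\<exists>f \<in> set (walls m all_boxes). \<forall>t. length t = m \<longrightarrow> aff (rvs f) t = t ! j" if "j < m" for j
    using coords_aff[OF that] by (auto simp: walls_def)
  have nonneg: "0 \<le> y ! j"
    if "length y = m" "\<And>f. f \<in> set (walls m all_boxes) \<Longrightarrow> wpres (aff (rvs f) x) (aff (rvs f) y)" "j < m" for y j
  proof -
    have "wpres (x ! j) (y ! j)" using coords[OF that(3)] that(1,2) x(1) by metis
    moreover have "0 \<le> x ! j" using x(1,3) that(3) by simp
    ultimately show ?thesis by (auto simp: wpres_def less_le)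
  qed
  have "\<exists>c \<in> set (cand m (walls m all_boxes)). length c = m \<and>
      (\<forall>f \<in> set (walls m all_boxes). wpres (aff (rvs f) x) (aff (rvs f) (rvs c))) \<and>
      aff g x \<le> aff g (rvs c)"
    by (rule cand_improve[where B = B]) (use length_walls coords x g nonneg in auto)
  then obtain c where c: "c \<in> set (cand m (walls m all_boxes))" "length c = m"
    "\<And>f. f \<in> set (walls m all_boxes) \<Longrightarrow> wpres (aff (rvs f) x) (aff (rvs f) (rvs c))"
    "aff g x \<le> aff g (rvs c)"
    by blast
  have "c \<in> set candidates"
    using c(1) nonneg[of "rvs c"] c(2,3) by (auto simp: feasible_def nonneg_iff in_set_conv_nth)
  moreover have "\<pi> \<in> agent_optimal I ((!) (rvs c))"
    using c(2) by (intro agent_optimal_persists[OF x(1) _ same_order_walls[OF c(3) length_lfuns x(1)] \<pi>x])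
      simp_all
  moreover have "principal_utility I t \<pi> \<le> principal_utility I ((!) (rvs c)) \<pi>"
    using utility_cong(2)[OF \<pi>S, of t "(!) x"] x(1,2) g(2)[of x] g(2)[of "rvs c"] c(2,4) by simp
  ultimately show ?thesis by blast
qed

text \<open>Improving the zero contract already yields a candidate.\<close>

lemma candidates_nonempty: "candidates \<noteq> []"
proof -
  obtain \<pi> where "\<pi> \<in> agent_optimal I (\<lambda>_. 0)"
    using finite_maximizer[OF finite_strategies[of I] strategies_nonempty[of I],
        where f = "agent_utility I (\<lambda>_. 0)"]
    unfolding agent_optimal_def by blast
  from better_candidate[OF _ this] show ?thesis by (auto simp: is_contract_def)
qed

lemma solve_candidate:
  obtains t where "t \<in> set candidates" "solve m (cs, rs, ps) = t"
    "\<And>c. c \<in> set candidates \<Longrightarrow> rv (score (frac_atoms c)) \<le> rv (score (frac_atoms t))"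
proof -
  let ?xs = "map (\<lambda>t. (score (frac_atoms t), t)) candidates"
  have "solve m (cs, rs, ps) = best ?xs"
    by (simp add: solve_def scored_def frac_atoms_def[abs_def] all_boxes_def)
  thus thesis
    using best_greatest[of ?xs] candidates_nonempty that by auto
qed

theorem solve_optimal:
  assumes ord: "linear_order_on (strategies I) ord"
  shows "optimal_contract I ord ((!) (rvs (solve m (cs, rs, ps))))"
proof -
  obtain t where t: "t \<in> set candidates" "solve m (cs, rs, ps) = t"
    "\<And>c. c \<in> set candidates \<Longrightarrow> rv (score (frac_atoms c)) \<le> rv (score (frac_atoms t))"
    using solve_candidate by blast
  have "is_contract I ((!) (rvs t))"
    using t(1) length_candidate[OF t(1)] m
    by (auto simp: is_contract_def feasible_def nonneg_iff)
  moreover have "principal_value I ord t' \<le> principal_value I ord ((!) (rvs t))" if t': "is_contract I t'" for t'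
  proof -
    let ?\<pi> = "best_response I ord t'"
    have "?\<pi> \<in> agent_optimal I t'"
      using best_response_favourable[OF ord] by (auto simp: favourable_def)
    then obtain c where c: "c \<in> set candidates" "?\<pi> \<in> agent_optimal I ((!) (rvs c))"
      "principal_utility I t' ?\<pi> \<le> principal_utility I ((!) (rvs c)) ?\<pi>"
      using better_candidate[OF t'] by blast
    have "principal_value I ord t' \<le> principal_utility I ((!) (rvs c)) ?\<pi>"
      using c(3) by (simp add: principal_value_def)
    \<comment> \<open>The best response at \<open>c\<close> may be another strategy, but ties favour
      the principal, so it serves her at least as well.\<close>
    also have "\<dots> \<le> principal_value I ord ((!) (rvs c))"
      using best_response_favourable[OF ord, of "(!) (rvs c)"] c(2)
      by (simp add: principal_value_def favourable_def)
    also have "\<dots> = rv (score (frac_atoms c))"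
      using principal_value_score[OF ord length_candidate[OF c(1)]] .
    also have "\<dots> \<le> rv (score (frac_atoms t))" by (rule t(3)[OF c(1)])
    also have "\<dots> = principal_value I ord ((!) (rvs t))"
      using principal_value_score[OF ord length_candidate[OF t(1)]] by simp
    finally show ?thesis .
  qed
  ultimately show ?thesis unfolding t(2) by (auto simp: optimal_contract_def)
qed

lemma length_solve: "length (solve m (cs, rs, ps)) = m"
  using solve_candidate length_candidate by metis

end

subsection \<open>Encodings\<close>

definition rat_of :: "frac \<Rightarrow> rat" where
  "rat_of x = Rat.Fract (fst (Rep_frac x)) (snd (Rep_frac x))"

lemma of_rat_rat_of: "real_of_rat (rat_of x) = rv x"
  using denominator_pos[of x] by (simp add: rat_of_def rv_def of_rat_rat)

lemma enc_rat_code: "enc_rat v q \<longleftrightarrow> (\<exists>x. v = code x \<and> q = rat_of x)"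
proof
  assume "enc_rat v q"
  then obtain a b where ab: "0 < b" "v = Node (Atom a) (Atom b)" "q = Rat.Fract a b"
    by (auto simp: enc_rat_def)
  hence "Rep_frac (Abs_frac (a, b)) = (a, b)" by (intro Abs_frac_inverse) simp
  thus "\<exists>x. v = code x \<and> q = rat_of x"
    using ab by (intro exI[of _ "Abs_frac (a, b)"]) (simp add: code_frac_def code_int_def rat_of_def)
next
  assume "\<exists>x. v = code x \<and> q = rat_of x"
  then obtain x where "v = code x" "q = rat_of x" by blast
  thus "enc_rat v q"
    using denominator_pos[of x]
    by (auto simp: enc_rat_def code_frac_def code_prod_def code_int_def rat_of_def)
qed

lemma enc_list_code:
  assumes "\<And>u x. E u x \<longleftrightarrow> (\<exists>y. u = code y \<and> x = f y)"
  shows "enc_list E v xs \<longleftrightarrow> (\<exists>ys. v = code ys \<and> xs = map f ys)"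
proof (induction xs arbitrary: v)
  case (Cons x xs)
  show ?case
  proof
    assume "enc_list E v (x # xs)"
    then obtain y ys where "v = Node (code y) (code ys)" "x # xs = map f (y # ys)"
      using Cons assms by auto
    thus "\<exists>ys. v = code ys \<and> x # xs = map f ys" by (intro exI[of _ "y # ys"]) simp
  next
    assume "\<exists>ys. v = code ys \<and> x # xs = map f ys"
    then obtain y ys where y: "v = code (y # ys)" "x # xs = map f (y # ys)"
      by (metis list.map_disc_iff neq_Nil_conv)
    have "E (code y) x" using assms y(2) by auto
    moreover have "enc_list E (code ys) xs" using Cons y(2) by auto
    ultimately show "enc_list E v (x # xs)" by (simp add: y(1))
  qed
qed auto

lemma enc_inst_code:
  assumes "enc_inst v I"
  obtains cs rs ps where "v = code (cs, rs, ps)" "costs I = map rat_of cs"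
    "rewards I = map rat_of rs" "probs I = map (map rat_of) ps"
proof -
  note list = enc_list_code[of enc_rat rat_of, OF enc_rat_code]
  obtain vc vr vp where "v = Node vc (Node vr vp)" "enc_list enc_rat vc (costs I)"
    "enc_list enc_rat vr (rewards I)" "enc_list (enc_list enc_rat) vp (probs I)"
    using assms by (auto simp: enc_inst_def)
  thus thesis
    using that unfolding list enc_list_code[of "enc_list enc_rat", OF list] by fastforce
qed

lemma encoded_inst:
  assumes "valid_inst I" "costs I = map rat_of cs" "rewards I = map rat_of rs"
    "probs I = map (map rat_of) ps"
  shows "encoded_inst I (n_out I) cs rs ps"
proof
  show "valid_inst I" "n_out I = n_out I" by (use assms in auto)
  show "length cs = n_act I" "length rs = n_out I" "length ps = n_act I"
    using assms by (auto simp: n_act_def n_out_def valid_inst_def)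
  show len: "length (ps ! i) = n_out I" if "i < n_act I" for i
  proof -
    have "map rat_of (ps ! i) \<in> set (probs I)"
      using that assms(1,4) by (auto simp: valid_inst_def)
    thus ?thesis using assms(1) by (auto simp: valid_inst_def)
  qed
  show "cost I i = rv (cs ! i)" if "i < n_act I" for i
    using that assms(2) by (simp add: cost_def n_act_def of_rat_rat_of)
  show "reward I j = rv (rs ! j)" if "j < n_out I" for j
    using that assms(3) by (simp add: reward_def n_out_def of_rat_rat_of)
  show "pmf (outcome_pmf I i) j = rv (ps ! i ! j)" if "i < n_act I" "j < n_out I" for i j
    using that assms(1,4) len[OF that(1)]
    by (simp add: pmf_outcome_pmf of_rat_rat_of) (simp add: valid_inst_def of_rat_rat_of)
qed

text \<open>The empty stack \<open>Atom 0\<close> is put under the input at the start and removed at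
  the end.\<close>

lemma ptime_program:
  assumes "ptime f"
  shows "\<exists>c p. \<forall>x. \<exists>k s. exec c (initial (code x)) k s \<and> k \<le> poly p (vsize (code x)) \<and> s 0 = code (f x)"
proof -
  have "transforms UNIV (\<lambda>x. code x) (\<lambda>x. Node (code x) (Atom 0))"
    by (rule transforms_expr[of "Pair_expr (Var 0) (Lit 0)"]) (auto intro!: poly_expr_intros)
  moreover have "transforms UNIV (\<lambda>x. Node (code x) (Atom 0)) (\<lambda>x. Node (code (f x)) (Atom 0))"
    using assms unfolding ptime_def by (rule transforms_reindex) auto
  moreover have "transforms UNIV (\<lambda>x. Node (code (f x)) (Atom 0)) (\<lambda>x. code (f x))"
    by (rule transforms_expr[of Top]) (auto intro!: poly_expr_intros)
  ultimately have "transforms UNIV (\<lambda>x. code x) (\<lambda>x. code (f x))"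
    by (blast intro: transforms_seq)
  then obtain c p where "\<And>x s. s 0 = code x \<Longrightarrow>
      \<exists>k s'. exec c s k s' \<and> s' 0 = code (f x) \<and> k \<le> poly p (vsize (code x))"
    unfolding transforms_def by blast
  hence "\<exists>k s'. exec c (initial (code x)) k s' \<and> s' 0 = code (f x) \<and> k \<le> poly p (vsize (code x))" for x
    by (simp add: initial_def)
  thus ?thesis by blast
qed

theorem theorem3p2:
  fixes m :: nat
  assumes "1 \<le> m"
  shows "poly_time_solvable
    (\<lambda>v I. enc_inst v I \<and> valid_inst I \<and> n_out I = m)
    (\<lambda>I w. \<exists>t. enc_contract I w t \<and>
       (\<forall>ord. linear_order_on (strategies I) ord \<longrightarrow> optimal_contract I ord t))"
proof -
  obtain c p where c: "\<And>x. \<exists>k s. exec c (initial (code x)) k s \<and>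
      k \<le> poly p (vsize (code x)) \<and> s 0 = code (solve m x)"
    using ptime_program[OF ptime_solve] by blast
  have "\<exists>k s. exec c (initial v) k s \<and> k \<le> poly p (vsize v) \<and> (\<exists>t. enc_contract I (s 0) t \<and>
      (\<forall>ord. linear_order_on (strategies I) ord \<longrightarrow> optimal_contract I ord t))"
    if I: "enc_inst v I" "valid_inst I" "n_out I = m" for v I
  proof -
    obtain cs rs ps where x: "v = code (cs, rs, ps)" "costs I = map rat_of cs"
      "rewards I = map rat_of rs" "probs I = map (map rat_of) ps"
      using enc_inst_code[OF I(1)] .
    interpret encoded_inst I m cs rs ps
      using encoded_inst[OF I(2) x(2-4)] I(3) by simp
    define t where "t = solve m (cs, rs, ps)"
    have "enc_list enc_rat (code t) (map rat_of t)"
      using enc_list_code[of enc_rat rat_of, OF enc_rat_code] by blast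
    hence "enc_contract I (code t) ((!) (rvs t))"
      using length_solve I(3)
      by (auto simp: enc_contract_def of_rat_rat_of t_def intro!: exI[of _ "map rat_of t"])
    moreover obtain k s where "exec c (initial v) k s" "k \<le> poly p (vsize v)" "s 0 = code t"
      using c[of "(cs, rs, ps)"] x(1) by (auto simp: t_def)
    ultimately show ?thesis using solve_optimal t_def by metis
  qed
  thus ?thesis unfolding poly_time_solvable_def by blast
qed

end
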